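(* Let $K=\mathbb{C}\{\!\{t\}\!\}$ be the field of Puiseux series, let $B\in\mathbb{Z}^{m\times m}$, and let $\mathbf{c}\in(K^* )^m$. Let $\phi_B:(K^* )^m\to(K^* )^m$, $\phi_B(\mathbf{x})=\mathbf{x}^B$, be the associated monomial map, let $L=\operatorname{im}(B^T)\subset\mathbb{Z}^m$, and assume that the solution set $$X_B(\mathbf{c})=\{\mathbf{x}\in(K^* )^m:\mathbf{x}^B=\mathbf{c}\}$$ is nonempty. Then: 1. If $\operatorname{rank}(B)=m$, then $X_B(\mathbf{c})$ is a torsor under the finite group $\ker(\phi_B)$, and in particular $$|X_B(\mathbf{c})|=|\ker(\phi_B)|=[\mathbb{Z}^m:L].$$ Equivalently, if $B$ is invertible over $\mathbb{Q}$, then $|X_B(\mathbf{c})|=|\det(B)|$. 2. If $\operatorname{rank}(B)=m$ and $[\mathbb{Z}^m:L]=1$, equivalently $B\in GL_m(\mathbb{Z})$, then $X_B(\mathbf{c})$ consists of a unique point of $(K^* )^m$. 3. If $\operatorname{rank}(B)=r<m$, then $X_B(\mathbf{c})$ is a translate of $\ker(\phi_B)$. Moreover, the identity component of $\ker(\phi_B)$ is an algebraic subtorus of dimension $m-r$, and $X_B(\mathbf{c})$ is therefore a torsor under a group of the form $(\text{finite torsion group})\times(K^* )^{m-r}$. In particular, every nonempty solution set has pure dimension $m-r$.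
   Context: For $\mathbf{x}=(x_1,\dots,x_m)\in(K^* )^m$ and $B=(B_{ij})\in\mathbb{Z}^{m\times m}$, the vector $\mathbf{x}^B\in(K^* )^m$ has $i$-th coordinate $\prod_{j=1}^m x_j^{B_{ij}}$ (the monomial whose exponent vector is the $i$-th row of $B$). Thus $\phi_B$ is a homomorphism of algebraic tori, $L$ is the sublattice of $\mathbb{Z}^m$ generated by the rows of $B$, and "translate" means coset for coordinatewise multiplication. The field $K=\mathbb{C}\{\!\{t\}\!\}$ is algebraically closed of characteristic $0$. *)

theory Defs
  imports
    "HOL-Analysis.Analysis"
    "HOL-Computational_Algebra.Formal_Laurent_Series"
    "HOL-Algebra.Product_Groups"
    "HOL-Algebra.Group_Action"
begin

section \<open>The field of Puiseux series\<close>

text \<open>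
  A series \<open>\<Sum> f(q) t\<^sup>q\<close> is represented by its coefficient function \<open>f\<close>. Its support has to lie
  in \<open>{N/d, (N+1)/d, \<dots>}\<close> for some \<open>N\<close> and some \<open>d > 0\<close>, so that the type is the union over
  all \<open>d\<close> of the Laurent series in \<open>t\<close> to the power \<open>1/d\<close>.
\<close>

typedef (overloaded) 'a puiseux =
  "{f :: rat \<Rightarrow> 'a::zero. \<exists>d>0. \<exists>N::int. \<forall>q. f q \<noteq> 0 \<longrightarrow> (\<exists>k\<ge>N. q = of_int k / of_nat d)}"
  morphisms puiseux_nth Abs_puiseux
  by (rule exI[of _ "\<lambda>_. 0"]) auto

setup_lifting type_definition_puiseux

lemma puiseux_eqI: "(\<And>q. puiseux_nth f q = puiseux_nth g q) \<Longrightarrow> f = g"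
  by (simp add: puiseux_nth_inject[symmetric] fun_eq_iff)

definition puiseux_supp :: "'a::zero puiseux \<Rightarrow> nat \<Rightarrow> int \<Rightarrow> bool" where
  "puiseux_supp f d N \<longleftrightarrow> d > 0 \<and>
     (\<forall>q. puiseux_nth f q \<noteq> 0 \<longrightarrow> (\<exists>k\<ge>N. q = of_int k / of_nat d))"

lemma puiseux_supp_ex: "\<exists>d N. puiseux_supp f d N"
  using puiseux_nth[of f] unfolding puiseux_supp_def by auto

lemma puiseux_supp_mult:
  assumes "puiseux_supp f d N" "e > 0"
  shows "puiseux_supp f (d * e) (N * int e)"
  unfolding puiseux_supp_def
proof (intro conjI allI impI)
  show "d * e > 0" using assms by (simp add: puiseux_supp_def)
  fix q assume "puiseux_nth f q \<noteq> 0"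
  then obtain k where k: "k \<ge> N" "q = of_int k / of_nat d"
    using assms by (auto simp: puiseux_supp_def)
  have "q = of_int (k * int e) / of_nat (d * e)" "k * int e \<ge> N * int e"
    using k assms(2) by (auto simp: mult_right_mono)
  then show "\<exists>k\<ge>N * int e. q = of_int k / of_nat (d * e)" by blast
qed

text \<open>Laurent series read as series in \<open>t\<close> to the power \<open>1/d\<close>. The field laws below are
  transported along these maps.\<close>

lift_definition puiseux_of_fls :: "nat \<Rightarrow> 'a::zero fls \<Rightarrow> 'a puiseux" is
  "\<lambda>d F q. if d > 0 \<and> of_nat d * q \<in> \<int> then fls_nth F \<lfloor>of_nat d * q\<rfloor> else 0"
proof -
  fix d :: nat and F :: "'a fls"
  show "\<exists>d'>0. \<exists>N. \<forall>q. (if d > 0 \<and> of_nat d * q \<in> \<int> then fls_nth F \<lfloor>of_nat d * q\<rfloor> else 0) \<noteq> 0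
          \<longrightarrow> (\<exists>k\<ge>N. q = of_int k / of_nat d')"
  proof (cases "d > 0")
    case True
    have "\<exists>k\<ge>fls_subdegree F. q = of_int k / of_nat d"
      if "(if d > 0 \<and> of_nat d * q \<in> \<int> then fls_nth F \<lfloor>of_nat d * q\<rfloor> else 0) \<noteq> 0" for q
    proof (intro exI[of _ "\<lfloor>of_nat d * q\<rfloor>"] conjI)
      have *: "of_nat d * q \<in> \<int>" "fls_nth F \<lfloor>of_nat d * q\<rfloor> \<noteq> 0"
        using that by (auto split: if_splits)
      show "\<lfloor>of_nat d * q\<rfloor> \<ge> fls_subdegree F"
        using *(2) by (rule fls_subdegree_leI)
      show "q = of_int \<lfloor>of_nat d * q\<rfloor> / of_nat d"
        using * True by (auto elim!: Ints_cases simp: field_simps)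
    qed
    then show ?thesis using True by blast
  qed auto
qed

lemma puiseux_nth_of_fls [simp]:
  "d > 0 \<Longrightarrow> puiseux_nth (puiseux_of_fls d F) (of_int k / of_nat d) = fls_nth F k"
  by transfer simp

lemma puiseux_of_fls_inject:
  assumes "d > 0" "puiseux_of_fls d F = puiseux_of_fls d G"
  shows "F = G"
proof (rule fls_eqI)
  fix k show "fls_nth F k = fls_nth G k"
    using assms puiseux_nth_of_fls[of d F k] by simp
qed

lemma puiseux_nth_of_fls_0:
  "(\<And>k. q \<noteq> of_int k / of_nat d) \<Longrightarrow> puiseux_nth (puiseux_of_fls d F) q = 0"
proof (transfer, rule ccontr)
  fix q :: rat and d :: nat and F :: "'a fls"
  assume q: "\<And>k. q \<noteq> of_int k / of_nat d"
    and "(if d > 0 \<and> of_nat d * q \<in> \<int> then fls_nth F \<lfloor>of_nat d * q\<rfloor> else 0) \<noteq> 0"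
  then have "d > 0" "of_nat d * q \<in> \<int>" by (auto split: if_splits)
  then obtain z where "of_nat d * q = of_int z" by (auto elim: Ints_cases)
  then have "q = of_int z / of_nat d" using \<open>d > 0\<close> by (simp add: field_simps)
  then show False using q by blast
qed

lemma puiseux_of_flsE:
  assumes "puiseux_supp f d N"
  obtains F where "f = puiseux_of_fls d F"
proof
  let ?F = "Abs_fls (\<lambda>k. puiseux_nth f (of_int k / of_nat d))"
  have d: "d > 0" using assms by (simp add: puiseux_supp_def)
  have *: "fls_nth ?F k = puiseux_nth f (of_int k / of_nat d)" for k
  proof (rule nth_Abs_fls_ex_lower_bound, intro exI[of _ N] allI impI, rule ccontr)
    fix n assume n: "n < N" "puiseux_nth f (of_int n / of_nat d) \<noteq> 0"
    then obtain k where "k \<ge> N" "(of_int n / of_nat d :: rat) = of_int k / of_nat d"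
      using assms by (auto simp: puiseux_supp_def)
    then show False using n d by simp
  qed
  show "f = puiseux_of_fls d ?F"
  proof (rule puiseux_eqI)
    fix q
    show "puiseux_nth f q = puiseux_nth (puiseux_of_fls d ?F) q"
    proof (cases "\<exists>k. q = of_int k / of_nat d")
      case True
      then show ?thesis using d * by auto
    next
      case False
      then have "puiseux_nth f q = 0"
        using assms by (auto simp: puiseux_supp_def)
      then show ?thesis using False puiseux_nth_of_fls_0[of q d] by simp
    qed
  qed
qed

lemma puiseux_common_denom3:
  obtains d F G H where "d > 0" "f = puiseux_of_fls d F" "g = puiseux_of_fls d G"
    "h = puiseux_of_fls d H"
proof -
  obtain a N b M c L where s: "puiseux_supp f a N" "puiseux_supp g b M" "puiseux_supp h c L"
    by (meson puiseux_supp_ex)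
  then have pos: "a > 0" "b > 0" "c > 0" by (auto simp: puiseux_supp_def)
  let ?d = "a * b * c"
  have "puiseux_supp f ?d (N * int (b * c))"
    using puiseux_supp_mult[OF s(1), of "b * c"] pos by (simp add: mult.assoc)
  moreover have "puiseux_supp g ?d (M * int (a * c))"
    using puiseux_supp_mult[OF s(2), of "a * c"] pos by (simp add: ac_simps)
  moreover have "puiseux_supp h ?d (L * int (a * b))"
    using puiseux_supp_mult[OF s(3), of "a * b"] pos by (simp add: ac_simps)
  moreover have "?d > 0" using pos by simp
  ultimately show ?thesis using that by (metis puiseux_of_flsE)
qed

instantiation puiseux :: (field) field
begin

lift_definition zero_puiseux :: "'a puiseux" is "\<lambda>_. 0" by auto

lift_definition one_puiseux :: "'a puiseux" is "\<lambda>q. if q = 0 then 1 else 0"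
  by (rule exI[of _ 1], rule conjI, simp, rule exI[of _ 0]) auto

lift_definition uminus_puiseux :: "'a puiseux \<Rightarrow> 'a puiseux" is "\<lambda>f q. - f q" by simp

lift_definition plus_puiseux :: "'a puiseux \<Rightarrow> 'a puiseux \<Rightarrow> 'a puiseux" is "\<lambda>f g q. f q + g q"
proof -
  fix f g :: "rat \<Rightarrow> 'a"
  assume "\<exists>d>0. \<exists>N::int. \<forall>q. f q \<noteq> 0 \<longrightarrow> (\<exists>k\<ge>N. q = of_int k / of_nat d)"
    and "\<exists>d>0. \<exists>N::int. \<forall>q. g q \<noteq> 0 \<longrightarrow> (\<exists>k\<ge>N. q = of_int k / of_nat d)"
  then obtain d N e M where f: "d > 0" "\<forall>q. f q \<noteq> 0 \<longrightarrow> (\<exists>k\<ge>N. q = of_int k / of_nat d)"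
    and g: "e > 0" "\<forall>q. g q \<noteq> 0 \<longrightarrow> (\<exists>k\<ge>M. q = of_int k / of_nat e)"
    by (elim exE conjE)
  have *: "\<exists>k\<ge>min (N * e) (M * d). q = of_int k / of_nat (d * e)" if "f q + g q \<noteq> 0" for q
  proof -
    from that have "f q \<noteq> 0 \<or> g q \<noteq> 0" by auto
    then consider "f q \<noteq> 0" | "g q \<noteq> 0" by blast
    then show ?thesis
    proof cases
      case 1
      then obtain k where k: "k \<ge> N" "q = of_int k / of_nat d" using f(2) by auto
      have "q = of_int (k * e) / of_nat (d * e)" using k f(1) g(1) by simp
      moreover have "k * e \<ge> min (N * e) (M * d)"
        using k(1) by (simp add: min_le_iff_disj mult_right_mono)
      ultimately show ?thesis by blast
    next
      case 2
      then obtain k where k: "k \<ge> M" "q = of_int k / of_nat e" using g(2) by auto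
      have "q = of_int (k * d) / of_nat (d * e)" using k f(1) g(1) by simp
      moreover have "k * d \<ge> min (N * e) (M * d)"
        using k(1) by (simp add: min_le_iff_disj mult_right_mono)
      ultimately show ?thesis by blast
    qed
  qed
  show "\<exists>d>0. \<exists>N::int. \<forall>q. f q + g q \<noteq> 0 \<longrightarrow> (\<exists>k\<ge>N. q = of_int k / of_nat d)"
    by (rule exI[of _ "d * e"], rule conjI) (simp add: f g, rule exI[of _ "min (N * e) (M * d)"], use * in blast)
qed

definition minus_puiseux :: "'a puiseux \<Rightarrow> 'a puiseux \<Rightarrow> 'a puiseux" where
  "minus_puiseux f g = f + - g"

text \<open>The index set of this sum is always finite, by the conditions on the supports.\<close>

lift_definition times_puiseux :: "'a puiseux \<Rightarrow> 'a puiseux \<Rightarrow> 'a puiseux" is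
  "\<lambda>f g q. \<Sum>a | f a \<noteq> 0 \<and> g (q - a) \<noteq> 0. f a * g (q - a)"
proof -
  fix f g :: "rat \<Rightarrow> 'a"
  assume "\<exists>d>0. \<exists>N::int. \<forall>q. f q \<noteq> 0 \<longrightarrow> (\<exists>k\<ge>N. q = of_int k / of_nat d)"
    and "\<exists>d>0. \<exists>N::int. \<forall>q. g q \<noteq> 0 \<longrightarrow> (\<exists>k\<ge>N. q = of_int k / of_nat d)"
  then obtain d N e M where f: "d > 0" "\<forall>q. f q \<noteq> 0 \<longrightarrow> (\<exists>k\<ge>N. q = of_int k / of_nat d)"
    and g: "e > 0" "\<forall>q. g q \<noteq> 0 \<longrightarrow> (\<exists>k\<ge>M. q = of_int k / of_nat e)"
    by (elim exE conjE)
  have *: "\<exists>k\<ge>N * e + M * d. q = of_int k / of_nat (d * e)" if "(\<Sum>a | f a \<noteq> 0 \<and> g (q - a) \<noteq> 0. f a * g (q - a)) \<noteq> 0" for q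
  proof -
    from that have "{a. f a \<noteq> 0 \<and> g (q - a) \<noteq> 0} \<noteq> {}" by (intro notI) simp
    then obtain a where a: "f a \<noteq> 0" "g (q - a) \<noteq> 0" by auto
    obtain k where k: "k \<ge> N" "a = of_int k / of_nat d" using f(2) a(1) by auto
    obtain l where l: "l \<ge> M" "q - a = of_int l / of_nat e" using g(2) a(2) by auto
    note kl = k l
    have "q = of_int k / of_nat d + of_int l / of_nat e" using k(2) l(2) by simp
    also have "\<dots> = of_int (k * e + l * d) / of_nat (d * e)"
      using f(1) g(1) by (simp add: add_divide_distrib)
    finally have "q = of_int (k * e + l * d) / of_nat (d * e)" .
    moreover have "k * e + l * d \<ge> N * e + M * d"
      using kl by (simp add: add_mono mult_right_mono)
    ultimately show ?thesis by (intro exI conjI)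
  qed
  show "\<exists>d>0. \<exists>N::int. \<forall>q. (\<Sum>a | f a \<noteq> 0 \<and> g (q - a) \<noteq> 0. f a * g (q - a)) \<noteq> 0 \<longrightarrow>
          (\<exists>k\<ge>N. q = of_int k / of_nat d)"
    by (rule exI[of _ "d * e"], rule conjI) (simp add: f g, rule exI[of _ "N * e + M * d"], use * in blast)
qed

definition inverse_puiseux :: "'a puiseux \<Rightarrow> 'a puiseux" where
  "inverse_puiseux f = (if f = 0 then 0 else (THE g. f * g = 1))"

definition divide_puiseux :: "'a puiseux \<Rightarrow> 'a puiseux \<Rightarrow> 'a puiseux" where
  "divide_puiseux f g = f * inverse g"

lemma puiseux_of_fls_eqI:
  assumes "d > 0"
    and "\<And>k. puiseux_nth f (of_int k / of_nat d) = fls_nth F k"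
    and "\<And>q. (\<And>k. q \<noteq> of_int k / of_nat d) \<Longrightarrow> puiseux_nth f q = 0"
  shows "puiseux_of_fls d F = f"
proof (rule puiseux_eqI)
  fix q show "puiseux_nth (puiseux_of_fls d F) q = puiseux_nth f q"
  proof (cases "\<exists>k. q = of_int k / of_nat d")
    case True then show ?thesis using assms by auto
  next
    case False then show ?thesis using assms puiseux_nth_of_fls_0[of q d] by simp
  qed
qed

lemma puiseux_of_fls_zero: "d > 0 \<Longrightarrow> puiseux_of_fls d 0 = 0"
  by (rule puiseux_of_fls_eqI) (simp_all add: zero_puiseux.rep_eq)

lemma puiseux_of_fls_one: "d > 0 \<Longrightarrow> puiseux_of_fls d 1 = 1"
proof (rule puiseux_of_fls_eqI)
  fix q :: rat assume "\<And>k. q \<noteq> of_int k / of_nat d"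
  from this[of 0] show "puiseux_nth 1 q = (0 :: 'a)" by (simp add: one_puiseux.rep_eq)
qed (simp_all add: one_puiseux.rep_eq)

lemma puiseux_of_fls_uminus: "d > 0 \<Longrightarrow> puiseux_of_fls d (- F) = - puiseux_of_fls d F"
  by (rule puiseux_of_fls_eqI) (simp_all add: uminus_puiseux.rep_eq puiseux_nth_of_fls_0)

lemma puiseux_of_fls_add:
  "d > 0 \<Longrightarrow> puiseux_of_fls d (F + G) = puiseux_of_fls d F + puiseux_of_fls d G"
  by (rule puiseux_of_fls_eqI) (simp_all add: plus_puiseux.rep_eq puiseux_nth_of_fls_0)

lemma puiseux_of_fls_mult:
  assumes d: "d > 0"
  shows "puiseux_of_fls d (F * G) = puiseux_of_fls d F * puiseux_of_fls d G"
proof (rule puiseux_of_fls_eqI[OF d])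
  let ?f = "puiseux_nth (puiseux_of_fls d F)" and ?g = "puiseux_nth (puiseux_of_fls d G)"
  have supp: "\<exists>k. a = of_int k / of_nat d" if "?f a \<noteq> 0 \<or> ?g a \<noteq> 0" for a
    using that puiseux_nth_of_fls_0[of a d] by metis
  fix n :: int
  let ?h = "\<lambda>i::int. of_int i / (of_nat d :: rat)"
  have diff: "?h n - ?h i = ?h (n - i)" for i by (simp add: diff_divide_distrib)
  have inj: "inj_on ?h A" for A using d by (auto simp: inj_on_def)
  have set: "{a. ?f a \<noteq> 0 \<and> ?g (?h n - a) \<noteq> 0} = ?h ` {i. fls_nth F i \<noteq> 0 \<and> fls_nth G (n - i) \<noteq> 0}"
    (is "?A = _ ` ?I")
  proof (intro equalityI subsetI)
    fix a assume a: "a \<in> ?A"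
    then obtain i where "a = ?h i" using supp by blast
    then show "a \<in> ?h ` ?I" using a d by (auto simp: diff simp del: of_int_diff)
  next
    fix a assume "a \<in> ?h ` ?I"
    then show "a \<in> ?A" using d by (auto simp: diff simp del: of_int_diff)
  qed
  have "puiseux_nth (puiseux_of_fls d F * puiseux_of_fls d G) (?h n) = (\<Sum>a\<in>?A. ?f a * ?g (?h n - a))"
    by (simp add: times_puiseux.rep_eq)
  also have "\<dots> = (\<Sum>i\<in>?I. fls_nth F i * fls_nth G (n - i))"
    unfolding set using d by (simp add: sum.reindex[OF inj] diff del: of_int_diff)
  also have "\<dots> = (\<Sum>i=fls_subdegree F..n - fls_subdegree G. fls_nth F i * fls_nth G (n - i))"
  proof (rule sum.mono_neutral_left)
    show "?I \<subseteq> {fls_subdegree F..n - fls_subdegree G}"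
      using fls_subdegree_leI[of F] fls_subdegree_leI[of G] by force
  qed auto
  also have "\<dots> = fls_nth (F * G) n" by (simp add: fls_times_nth(2))
  finally show "puiseux_nth (puiseux_of_fls d F * puiseux_of_fls d G) (?h n) = fls_nth (F * G) n" .
next
  let ?f = "puiseux_nth (puiseux_of_fls d F)" and ?g = "puiseux_nth (puiseux_of_fls d G)"
  have supp: "\<exists>k. a = of_int k / of_nat d" if "?f a \<noteq> 0 \<or> ?g a \<noteq> 0" for a
    using that puiseux_nth_of_fls_0[of a d] by metis
  fix q :: rat assume q: "\<And>k. q \<noteq> of_int k / of_nat d"
  have "{a. ?f a \<noteq> 0 \<and> ?g (q - a) \<noteq> 0} = {}"
  proof (rule ccontr)
    assume "{a. ?f a \<noteq> 0 \<and> ?g (q - a) \<noteq> 0} \<noteq> {}"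
    then obtain a where "?f a \<noteq> 0" "?g (q - a) \<noteq> 0" by blast
    then obtain k l where "a = of_int k / of_nat d" "q - a = of_int l / of_nat d"
      using supp by meson
    then have "q = of_int (k + l) / of_nat d" by (simp add: add_divide_distrib)
    then show False using q by blast
  qed
  then show "puiseux_nth (puiseux_of_fls d F * puiseux_of_fls d G) q = 0"
    unfolding times_puiseux.rep_eq by (simp only: sum.empty)
qed

lemmas puiseux_of_fls_hom = puiseux_of_fls_zero puiseux_of_fls_one puiseux_of_fls_uminus
  puiseux_of_fls_add puiseux_of_fls_mult

instance
proof
  fix f g h :: "'a puiseux"
  obtain d F G H where d: "d > 0"
    and fgh: "f = puiseux_of_fls d F" "g = puiseux_of_fls d G" "h = puiseux_of_fls d H"
    by (rule puiseux_common_denom3)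
  have hom: "puiseux_of_fls d F + puiseux_of_fls d G = puiseux_of_fls d (F + G)"
    "puiseux_of_fls d F * puiseux_of_fls d G = puiseux_of_fls d (F * G)"
    "- puiseux_of_fls d F = puiseux_of_fls d (- F)"
    "0 = puiseux_of_fls d 0" "1 = puiseux_of_fls d 1" for F G :: "'a fls"
    using d by (simp_all add: puiseux_of_fls_hom)
  show "f * g * h = f * (g * h)" unfolding fgh hom(2) by (simp only: mult.assoc)
  show "f * g = g * f" unfolding fgh hom(2) by (simp only: mult.commute)
  show "1 * f = f" unfolding fgh hom(2,5) by (simp only: mult_1)
  show "f + g + h = f + (g + h)" unfolding fgh hom(1) by (simp only: add.assoc)
  show "f + g = g + f" unfolding fgh hom(1) by (simp only: add.commute)
  show "0 + f = f" unfolding fgh hom(1,4) by (simp only: add_0)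
  show "- f + f = 0" unfolding fgh hom(1,3,4) by (simp only: left_minus)
  show "(f + g) * h = f * h + g * h" unfolding fgh hom(1,2) by (simp only: distrib_right)
  show "f - g = f + - g" by (simp add: minus_puiseux_def)
  show "f div g = f * inverse g" by (simp add: divide_puiseux_def)
  show "inverse (0 :: 'a puiseux) = 0" by (simp add: inverse_puiseux_def)
  have "puiseux_nth (0 :: 'a puiseux) 0 \<noteq> puiseux_nth 1 0"
    by (simp add: zero_puiseux.rep_eq one_puiseux.rep_eq)
  then show "(0 :: 'a puiseux) \<noteq> 1" by auto
next
  fix f :: "'a puiseux" assume nz: "f \<noteq> 0"
  obtain d F where d: "d > 0" and f: "f = puiseux_of_fls d F"
    by (rule puiseux_common_denom3[of f f f])
  have F: "F \<noteq> 0" using nz f d by (auto simp: puiseux_of_fls_zero)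
  have "f * puiseux_of_fls d (inverse F) = puiseux_of_fls d (F * inverse F)"
    using d unfolding f by (simp only: puiseux_of_fls_mult)
  then have inv: "f * puiseux_of_fls d (inverse F) = 1"
    using d F by (simp add: puiseux_of_fls_one)
  have inv_f: "(THE g. f * g = 1) = puiseux_of_fls d (inverse F)"
  proof (rule the_equality)
    show "f * puiseux_of_fls d (inverse F) = 1" by (fact inv)
  next
    fix g assume g: "f * g = 1"
    obtain e F' G I where e: "e > 0" "f = puiseux_of_fls e F'" "g = puiseux_of_fls e G"
      "puiseux_of_fls d (inverse F) = puiseux_of_fls e I"
      by (rule puiseux_common_denom3)
    have "puiseux_of_fls e (F' * G) = puiseux_of_fls e 1"
      "puiseux_of_fls e (F' * I) = puiseux_of_fls e 1"
      using g inv e by (simp_all add: puiseux_of_fls_mult puiseux_of_fls_one)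
    then have "F' * G = 1" "F' * I = 1"
      using puiseux_of_fls_inject[OF e(1)] by blast+
    then have "G = I" by (metis mult.left_commute mult.right_neutral)
    then show "g = puiseux_of_fls d (inverse F)" using e by simp
  qed
  show "inverse f * f = 1"
  proof -
    have "inverse f = puiseux_of_fls d (inverse F)"
      using nz inv_f by (simp only: inverse_puiseux_def if_False)
    then have "inverse f * f = puiseux_of_fls d (inverse F) * puiseux_of_fls d F"
      using f by simp
    also have "\<dots> = puiseux_of_fls d (inverse F * F)"
      using d by (simp only: puiseux_of_fls_mult)
    also have "\<dots> = 1" using F d by (simp add: puiseux_of_fls_one)
    finally show ?thesis .
  qed
qed

end

instance puiseux :: (field_char_0) field_char_0
proof
  have "puiseux_nth (of_nat n :: 'a puiseux) 0 = of_nat n" for n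
    by (induction n) (simp_all add: zero_puiseux.rep_eq one_puiseux.rep_eq plus_puiseux.rep_eq)
  then show "inj (of_nat :: nat \<Rightarrow> 'a puiseux)"
    by (intro injI) (metis of_nat_eq_iff)
qed

section \<open>Algebraic tori\<close>

definition unit_group :: "'k::field monoid" where
  "unit_group = \<lparr>carrier = - {0}, mult = (*), one = 1\<rparr>"

text \<open>The group of \<open>K\<close>-points of the split torus with coordinates indexed by \<open>I\<close>. Indexing by a
  set rather than a type lets \<open>torus {..<d}\<close> stand for the \<open>d\<close>-dimensional torus with \<open>d\<close> a number;
  \<open>torus UNIV\<close> over a finite type \<open>'m\<close> is the torus of dimension \<open>CARD('m)\<close>.\<close>

definition torus :: "'i set \<Rightarrow> ('i \<Rightarrow> 'k::field) monoid" where
  "torus I = product_group I (\<lambda>_. unit_group)"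

lemma group_unit_group: "group (unit_group :: 'k::field monoid)"
proof (rule groupI)
  fix x :: 'k assume "x \<in> carrier unit_group"
  then show "\<exists>y\<in>carrier unit_group. y \<otimes>\<^bsub>unit_group\<^esub> x = \<one>\<^bsub>unit_group\<^esub>"
    by (intro bexI[of _ "inverse x"]) (auto simp: unit_group_def)
qed (auto simp: unit_group_def)

lemma group_torus: "group (torus I)"
  unfolding torus_def by (rule product_group) (rule group_unit_group)

lemma carrier_torus: "carrier (torus I) = {x \<in> extensional I. \<forall>i\<in>I. x i \<noteq> 0}"
  by (auto simp: torus_def unit_group_def PiE_def Pi_def)

text \<open>Functions given by Laurent polynomials in the coordinates \<open>x i\<close>, \<open>i \<in> I\<close>; only their
  values on \<open>torus I\<close> are used.\<close>

definition laurent_functions :: "'i set \<Rightarrow> (('i \<Rightarrow> 'k::field) \<Rightarrow> 'k) set" where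
  "laurent_functions I =
     {\<lambda>x. \<Sum>a\<in>A. c a * (\<Prod>i\<in>I. x i powi a i) | (A :: ('i \<Rightarrow> int) set) c. finite A}"

definition zariski :: "'i set \<Rightarrow> ('i \<Rightarrow> 'k::field) topology" where
  "zariski I =
     topology_generated_by {{x \<in> carrier (torus I). f x \<noteq> 0} | f. f \<in> laurent_functions I}"

lemma laurent_functionsI:
  assumes "finite A"
  shows "(\<lambda>x. \<Sum>a\<in>A. c a * (\<Prod>i\<in>I. x i powi a i)) \<in> laurent_functions I"
  unfolding laurent_functions_def by (intro CollectI exI[of _ A] exI[of _ c] conjI refl assms)

lemma laurent_functions_mult:
  assumes "f \<in> laurent_functions I" "g \<in> laurent_functions I"
  shows "\<exists>h\<in>laurent_functions I. \<forall>x\<in>carrier (torus I). h x = f x * g x"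
proof -
  obtain A c where A: "finite A" "f = (\<lambda>x. \<Sum>a\<in>A. c a * (\<Prod>i\<in>I. x i powi a i))"
    using assms(1) by (auto simp: laurent_functions_def)
  obtain B d where B: "finite B" "g = (\<lambda>x. \<Sum>a\<in>B. d a * (\<Prod>i\<in>I. x i powi a i))"
    using assms(2) by (auto simp: laurent_functions_def)
  let ?m = "\<lambda>x a. \<Prod>i\<in>I. x i powi a i"
  let ?s = "\<lambda>p i. fst p i + snd p i :: int"
  let ?e = "\<lambda>s. \<Sum>p | p \<in> A \<times> B \<and> ?s p = s. c (fst p) * d (snd p)"
  let ?h = "\<lambda>x. \<Sum>s\<in>?s ` (A \<times> B). ?e s * ?m x s"
  have "?h x = f x * g x" if x: "x \<in> carrier (torus I)" for x
  proof -
    have mono: "?m x (?s p) = ?m x (fst p) * ?m x (snd p)" for p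
      unfolding prod.distrib[symmetric]
    proof (rule prod.cong[OF refl])
      fix i assume "i \<in> I"
      then have "x i \<noteq> 0" using x by (simp add: carrier_torus)
      then show "x i powi ?s p i = x i powi fst p i * x i powi snd p i"
        by (simp add: power_int_add)
    qed
    have "f x * g x = (\<Sum>p\<in>A \<times> B. (c (fst p) * ?m x (fst p)) * (d (snd p) * ?m x (snd p)))"
      unfolding A(2) B(2) sum_product sum.cartesian_product
      by (rule sum.cong[OF refl]) (simp only: case_prod_beta)
    also have "\<dots> = (\<Sum>p\<in>A \<times> B. c (fst p) * d (snd p) * ?m x (?s p))"
      unfolding mono by (simp only: ac_simps)
    also have "\<dots> = (\<Sum>s\<in>?s ` (A \<times> B). \<Sum>p | p \<in> A \<times> B \<and> ?s p = s.
        c (fst p) * d (snd p) * ?m x (?s p))"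
      by (rule sum.image_gen) (rule finite_cartesian_product[OF A(1) B(1)])
    also have "\<dots> = (\<Sum>s\<in>?s ` (A \<times> B). \<Sum>p | p \<in> A \<times> B \<and> ?s p = s.
        c (fst p) * d (snd p) * ?m x s)"
    proof (rule sum.cong[OF refl], rule sum.cong[OF refl])
      fix s p assume "p \<in> {p \<in> A \<times> B. ?s p = s}"
      then have s: "s = ?s p" by (elim CollectE conjE) (rule sym)
      show "c (fst p) * d (snd p) * ?m x (?s p) = c (fst p) * d (snd p) * ?m x s"
        unfolding s by (rule refl)
    qed
    also have "\<dots> = ?h x"
      by (rule sum.cong[OF refl], rule sum_distrib_right[symmetric])
    finally show ?thesis by (rule sym)
  qed
  moreover have "?h \<in> laurent_functions I"
    by (rule laurent_functionsI[of "?s ` (A \<times> B)" ?e I]) (intro finite_imageI finite_cartesian_product A(1) B(1))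
  ultimately show ?thesis by (intro bexI[of _ ?h] ballI)
qed

lemma const_laurent_function: "(\<lambda>_. c) \<in> laurent_functions I"
  using laurent_functionsI[of "{\<lambda>_. 0}" "\<lambda>_. c" I] by simp

lemma openin_zariski:
  fixes U :: "('i \<Rightarrow> 'k::field) set"
  shows "openin (zariski I) U \<longleftrightarrow>
     (\<exists>F\<subseteq>laurent_functions I. U = {x \<in> carrier (torus I). \<exists>f\<in>F. f x \<noteq> 0})"
proof
  assume "openin (zariski I) U"
  then have "generate_topology_on {{x \<in> carrier (torus I). f x \<noteq> 0} | f. f \<in> laurent_functions I} U"
    by (simp add: zariski_def openin_topology_generated_by_iff)
  then show "\<exists>F\<subseteq>laurent_functions I. U = {x \<in> carrier (torus I). \<exists>f\<in>F. f x \<noteq> 0}"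
  proof induction
    case Empty
    show ?case by (rule exI[of _ "{}"]) simp
  next
    case (Int U V)
    obtain F where F: "F \<subseteq> laurent_functions I"
      and U: "U = {x \<in> carrier (torus I). \<exists>f\<in>F. f x \<noteq> 0}"
      using Int.IH(1) by (elim exE conjE)
    obtain G where G: "G \<subseteq> laurent_functions I"
      and V: "V = {x \<in> carrier (torus I). \<exists>f\<in>G. f x \<noteq> 0}"
      using Int.IH(2) by (elim exE conjE)
    let ?H = "{h \<in> laurent_functions I. \<exists>f\<in>F. \<exists>g\<in>G. \<forall>x\<in>carrier (torus I). h x = f x * g x}"
    have "x \<in> U \<inter> V \<longleftrightarrow> x \<in> carrier (torus I) \<and> (\<exists>h\<in>?H. h x \<noteq> 0)" for x
    proof
      assume "x \<in> U \<inter> V"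
      then obtain f g where x: "x \<in> carrier (torus I)"
        and fg: "f \<in> F" "f x \<noteq> 0" "g \<in> G" "g x \<noteq> 0"
        unfolding U V by auto
      obtain h where h: "h \<in> laurent_functions I" "\<forall>x\<in>carrier (torus I). h x = f x * g x"
        using laurent_functions_mult[OF subsetD[OF F fg(1)] subsetD[OF G fg(3)]] by (elim bexE)
      have "h \<in> ?H" using h fg(1,3) by (intro CollectI conjI) auto
      moreover have "h x \<noteq> 0" using h(2) x fg by simp
      ultimately show "x \<in> carrier (torus I) \<and> (\<exists>h\<in>?H. h x \<noteq> 0)"
        using x by (intro conjI bexI)
    next
      assume x: "x \<in> carrier (torus I) \<and> (\<exists>h\<in>?H. h x \<noteq> 0)"
      then obtain h f g where fg: "f \<in> F" "g \<in> G" "h x = f x * g x" "h x \<noteq> 0" by auto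
      then have "f x \<noteq> 0" "g x \<noteq> 0" by auto
      then show "x \<in> U \<inter> V" using x fg(1,2) unfolding U V by auto
    qed
    note * = this
    have "U \<inter> V = {x \<in> carrier (torus I). \<exists>h\<in>?H. h x \<noteq> 0}"
    proof (rule Set.set_eqI)
      fix x
      show "x \<in> U \<inter> V \<longleftrightarrow> x \<in> {x \<in> carrier (torus I). \<exists>h\<in>?H. h x \<noteq> 0}"
        using *[of x] by (simp only: mem_Collect_eq)
    qed
    then show ?case by (intro exI[of _ ?H] conjI) auto
  next
    case (UN K)
    define F :: "('i \<Rightarrow> 'k) set \<Rightarrow> (('i \<Rightarrow> 'k) \<Rightarrow> 'k) set" where "F k = (SOME F. F \<subseteq> laurent_functions I \<and>
      k = {x \<in> carrier (torus I). \<exists>f\<in>F. f x \<noteq> 0})" for k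
    have F_some: "F k \<subseteq> laurent_functions I \<and> k = {x \<in> carrier (torus I). \<exists>f\<in>F k. f x \<noteq> 0}"
      if "k \<in> K" for k
      unfolding F_def by (rule someI_ex) (rule UN.IH[OF that])
    note F = F_some[THEN conjunct1] F_some[THEN conjunct2]
    have "x \<in> \<Union>K \<longleftrightarrow> x \<in> carrier (torus I) \<and> (\<exists>f\<in>\<Union>(F ` K). f x \<noteq> 0)" for x
    proof
      assume "x \<in> \<Union>K"
      then obtain k where k: "k \<in> K" "x \<in> k" by (elim UnionE)
      have "x \<in> {x \<in> carrier (torus I). \<exists>f\<in>F k. f x \<noteq> 0}" using k(2) F(2)[OF k(1)] by simp
      then show "x \<in> carrier (torus I) \<and> (\<exists>f\<in>\<Union>(F ` K). f x \<noteq> 0)" using k(1) by auto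
    next
      assume "x \<in> carrier (torus I) \<and> (\<exists>f\<in>\<Union>(F ` K). f x \<noteq> 0)"
      then obtain k f where k: "k \<in> K" and "f \<in> F k" "f x \<noteq> 0" "x \<in> carrier (torus I)" by auto
      then have "x \<in> {x \<in> carrier (torus I). \<exists>f\<in>F k. f x \<noteq> 0}" by auto
      then have "x \<in> k" using F(2)[OF k] by simp
      then show "x \<in> \<Union>K" using k by (intro UnionI)
    qed
    note * = this
    have "\<Union>K = {x \<in> carrier (torus I). \<exists>f\<in>\<Union>(F ` K). f x \<noteq> 0}"
      by (rule Set.set_eqI, unfold mem_Collect_eq, rule *)
    moreover have "\<Union>(F ` K) \<subseteq> laurent_functions I" using F(1) by (intro UN_least)
    ultimately show ?case by (intro exI conjI)
  next
    case (Basis U)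
    then obtain f where "f \<in> laurent_functions I" "U = {x \<in> carrier (torus I). f x \<noteq> 0}" by blast
    then show ?case by (intro exI[of _ "{f}"]) auto
  qed
next
  assume "\<exists>F\<subseteq>laurent_functions I. U = {x \<in> carrier (torus I). \<exists>f\<in>F. f x \<noteq> 0}"
  then obtain F where F: "F \<subseteq> laurent_functions I"
    and U: "U = {x \<in> carrier (torus I). \<exists>f\<in>F. f x \<noteq> 0}"
    by (elim exE conjE)
  have "U = \<Union>((\<lambda>f. {x \<in> carrier (torus I). f x \<noteq> 0}) ` F)"
    unfolding U by auto
  moreover have "openin (zariski I) {x \<in> carrier (torus I). f x \<noteq> 0}" if "f \<in> F" for f
    unfolding zariski_def
    by (intro topology_generated_by_Basis CollectI exI[of _ f] conjI refl subsetD[OF F that])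
  ultimately show "openin (zariski I) U" by (simp only:) (rule openin_Union, erule imageE, simp only:)
qed

lemma topspace_zariski: "topspace (zariski I :: ('i \<Rightarrow> 'k::field) topology) = carrier (torus I)"
proof
  have "openin (zariski I) (carrier (torus I) :: ('i \<Rightarrow> 'k) set)"
    unfolding openin_zariski
    by (rule exI[of _ "{\<lambda>_. 1}"]) (simp add: const_laurent_function)
  then show "carrier (torus I) \<subseteq> topspace (zariski I :: ('i \<Rightarrow> 'k) topology)"
    by (rule openin_subset)
next
  have "openin (zariski I :: ('i \<Rightarrow> 'k) topology) (topspace (zariski I))"
    by (rule openin_topspace)
  then show "topspace (zariski I :: ('i \<Rightarrow> 'k) topology) \<subseteq> carrier (torus I)"
    unfolding openin_zariski by (elim exE conjE) auto
qed

text \<open>The closed sets are exactly the zero loci of systems of Laurent polynomials.\<close>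

lemma closedin_zariski:
  "closedin (zariski I) C \<longleftrightarrow>
     (\<exists>F\<subseteq>laurent_functions I. C = {x \<in> carrier (torus I). \<forall>f\<in>F. f x = 0})"
proof
  assume "closedin (zariski I) C"
  then have C: "C \<subseteq> carrier (torus I)" and "openin (zariski I) (carrier (torus I) - C)"
    unfolding closedin_def topspace_zariski by simp_all
  then obtain F where F: "F \<subseteq> laurent_functions I"
    "carrier (torus I) - C = {x \<in> carrier (torus I). \<exists>f\<in>F. f x \<noteq> 0}"
    unfolding openin_zariski by (elim exE conjE)
  have "C = carrier (torus I) - (carrier (torus I) - C)" using C by auto
  also have "\<dots> = {x \<in> carrier (torus I). \<forall>f\<in>F. f x = 0}" unfolding F(2) by auto
  finally show "\<exists>F\<subseteq>laurent_functions I. C = {x \<in> carrier (torus I). \<forall>f\<in>F. f x = 0}"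
    using F(1) by (intro exI conjI)
next
  assume "\<exists>F\<subseteq>laurent_functions I. C = {x \<in> carrier (torus I). \<forall>f\<in>F. f x = 0}"
  then obtain F where F: "F \<subseteq> laurent_functions I"
    and C: "C = {x \<in> carrier (torus I). \<forall>f\<in>F. f x = 0}"
    by (elim exE conjE)
  have "carrier (torus I) - C = {x \<in> carrier (torus I). \<exists>f\<in>F. f x \<noteq> 0}"
    unfolding C by auto
  then have "openin (zariski I) (carrier (torus I) - C)"
    unfolding openin_zariski using F by (intro exI conjI)
  moreover have "C \<subseteq> carrier (torus I)" unfolding C by auto
  ultimately show "closedin (zariski I) C"
    unfolding closedin_def topspace_zariski by (intro conjI)
qed

section \<open>Irreducible components and dimension\<close>

text \<open>Irreducibility of a subset in its subspace topology, expressed with the closed sets of the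
  ambient space.\<close>

definition irreduciblein :: "'a topology \<Rightarrow> 'a set \<Rightarrow> bool" where
  "irreduciblein X S \<longleftrightarrow> S \<subseteq> topspace X \<and> S \<noteq> {} \<and>
     (\<forall>C D. closedin X C \<and> closedin X D \<and> S \<subseteq> C \<union> D \<longrightarrow> S \<subseteq> C \<or> S \<subseteq> D)"

definition irreducible_components_of :: "'a topology \<Rightarrow> 'a set set" where
  "irreducible_components_of X =
     {Z. irreduciblein X Z \<and> (\<forall>W. irreduciblein X W \<and> Z \<subseteq> W \<longrightarrow> W = Z)}"

text \<open>The supremum of the lengths of chains of irreducible closed subsets; the value on the empty
  space is 0 rather than minus infinity.\<close>

definition krull_dim :: "'a topology \<Rightarrow> enat" where
  "krull_dim X = Sup {enat n | n. \<exists>Z :: nat \<Rightarrow> 'a set.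
     (\<forall>i\<le>n. closedin X (Z i) \<and> irreduciblein X (Z i)) \<and> (\<forall>i<n. Z i \<subset> Z (Suc i))}"

definition pure_dimensional :: "'a topology \<Rightarrow> nat \<Rightarrow> bool" where
  "pure_dimensional X d \<longleftrightarrow>
     (\<forall>Z\<in>irreducible_components_of X. krull_dim (subtopology X Z) = enat d)"

section \<open>Algebraic subgroups and torsors\<close>

text \<open>For a Zariski closed \<open>S\<close>, the regular functions on \<open>S\<close> are the restrictions of Laurent
  polynomials.\<close>

definition regular_map_on ::
    "'i set \<Rightarrow> ('i \<Rightarrow> 'k::field) set \<Rightarrow> 'j set \<Rightarrow> (('i \<Rightarrow> 'k) \<Rightarrow> ('j \<Rightarrow> 'k)) \<Rightarrow> bool" where
  "regular_map_on I S J \<phi> \<longleftrightarrow>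
     (\<forall>x\<in>S. \<phi> x \<in> carrier (torus J)) \<and>
     (\<forall>j\<in>J. \<exists>f\<in>laurent_functions I. \<forall>x\<in>S. \<phi> x j = f x)"

text \<open>Isomorphism of algebraic groups between subgroups \<open>S\<close> of \<open>torus I\<close> and \<open>T\<close> of \<open>torus J\<close>.\<close>

definition algebraic_group_iso ::
    "'i set \<Rightarrow> ('i \<Rightarrow> 'k::field) set \<Rightarrow> 'j set \<Rightarrow> ('j \<Rightarrow> 'k) set \<Rightarrow>
     (('i \<Rightarrow> 'k) \<Rightarrow> ('j \<Rightarrow> 'k)) \<Rightarrow> bool" where
  "algebraic_group_iso I S J T \<phi> \<longleftrightarrow>
     \<phi> \<in> iso (torus I\<lparr>carrier := S\<rparr>) (torus J\<lparr>carrier := T\<rparr>) \<and>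
     regular_map_on I S J \<phi> \<and> regular_map_on J T I (inv_into S \<phi>)"

definition algebraic_subtorus :: "'i set \<Rightarrow> nat \<Rightarrow> ('i \<Rightarrow> 'k::field) set \<Rightarrow> bool" where
  "algebraic_subtorus I d T \<longleftrightarrow> subgroup T (torus I) \<and> closedin (zariski I) T \<and>
     (\<exists>\<gamma>. algebraic_group_iso {..<d} (carrier (torus {..<d})) I T \<gamma>)"

definition identity_component :: "'i set \<Rightarrow> ('i \<Rightarrow> 'k::field) set \<Rightarrow> ('i \<Rightarrow> 'k) set" where
  "identity_component I H =
     connected_component_of_set (subtopology (zariski I) H) \<one>\<^bsub>torus I\<^esub>"

text \<open>In \<open>group_action G E \<phi>\<close> each \<open>\<phi> g\<close> is an extensional function on \<open>E\<close>, hence the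
  restricted abstractions where this predicate is used.\<close>

definition torsor :: "('g, 'r) monoid_scheme \<Rightarrow> 'x set \<Rightarrow> ('g \<Rightarrow> 'x \<Rightarrow> 'x) \<Rightarrow> bool" where
  "torsor G E \<phi> \<longleftrightarrow> group_action G E \<phi> \<and> E \<noteq> {} \<and>
     (\<forall>x\<in>E. \<forall>y\<in>E. \<exists>!g. g \<in> carrier G \<and> \<phi> g x = y)"

section \<open>Monomial maps and their lattices\<close>

text \<open>Row \<open>i\<close> of \<open>B\<close> is the exponent vector of coordinate \<open>i\<close>.\<close>

definition monomial_map :: "int^'m^'m \<Rightarrow> ('m \<Rightarrow> 'k::field) \<Rightarrow> ('m \<Rightarrow> 'k)" where
  "monomial_map B x = (\<lambda>i. \<Prod>j\<in>UNIV. x j powi (B $ i $ j))"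

lemma monomial_map_hom: "monomial_map B \<in> hom (torus UNIV) (torus UNIV)"
  by (auto simp: hom_def carrier_torus monomial_map_def)
     (auto simp: torus_def unit_group_def power_int_mult_distrib prod.distrib)

definition monomial_kernel :: "int^'m^'m \<Rightarrow> ('m \<Rightarrow> 'k::field) set" where
  "monomial_kernel B = kernel (torus UNIV) (torus UNIV) (monomial_map B)"

definition solution_set :: "int^'m^'m \<Rightarrow> ('m \<Rightarrow> 'k::field) \<Rightarrow> ('m \<Rightarrow> 'k) set" where
  "solution_set B c = {x \<in> carrier (torus UNIV). monomial_map B x = c}"

text \<open>The image of the transpose of \<open>B\<close>, i.e. the integer combinations of the rows of \<open>B\<close>.\<close>

definition row_lattice :: "int^'m^'m \<Rightarrow> (int^'m) set" where
  "row_lattice B = range (\<lambda>y. transpose B *v y)"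

definition integer_lattice :: "(int^'m) monoid" where
  "integer_lattice = \<lparr>carrier = UNIV, mult = (+), one = 0\<rparr>"

text \<open>The index of \<open>L\<close> in the full lattice, with value 0 if the index is infinite.\<close>

definition lattice_index :: "(int^'m) set \<Rightarrow> nat" where
  "lattice_index L = card (rcosets\<^bsub>integer_lattice\<^esub> L)"

abbreviation rat_matrix :: "int^'m^'m \<Rightarrow> rat^'m^'m" where
  "rat_matrix B \<equiv> map_matrix rat_of_int B"

end

theory Submission
  imports Defs
begin

text \<open>
  Write \<open>\<phi>\<^sub>B\<close> for the monomial map of \<open>B\<close>. Since \<open>\<phi>\<^sub>A\<^sub>B = \<phi>\<^sub>A \<circ> \<phi>\<^sub>B\<close>, factoring \<open>B = U ** D ** W\<close> with
  \<open>D\<close> diagonal and \<open>U\<close>, \<open>W\<close> invertible over the integers (\<open>unimodular_diagonalization\<close>, obtained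
  by integer row and column operations) turns \<open>\<phi>\<^sub>B x = c\<close> into the decoupled system
  \<open>y\<^sub>i powi D\<^sub>i = c'\<^sub>i\<close> for \<open>y = \<phi>\<^sub>W x\<close>. The coordinates \<open>y\<^sub>i\<close> with \<open>D\<^sub>i = 0\<close> are unconstrained, and
  every other coordinate ranges over a finite set of roots. A nonempty solution set is therefore a
  finite disjoint union of \<^emph>\<open>slices\<close>, on which the coordinates with \<open>D\<^sub>i \<noteq> 0\<close> are fixed
  (\<open>solution_set_eq_union_of_slices\<close>); each slice is a copy of a torus with one coordinate for every
  zero among the \<open>D\<^sub>i\<close>.

  In full rank no coordinate is free. The kernel then has \<open>\<Prod> \<bar>D\<^sub>i\<bar>\<close> elements, because the constant
  series already provide all \<open>n\<close>-th roots of unity, and the same product is both the index of the row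
  lattice, which an automorphism of the full lattice carries to \<open>\<Prod> D\<^sub>i \<int>\<close>, and \<open>\<bar>det B\<bar>\<close>.

  In lower rank the slices are closed, irreducible and finite in number. Hence every irreducible
  component of the solution set is one of them, and the slice through the identity is the identity
  component of the kernel. The roots, with all free coordinates set to 1, form a finite
  complement to it.

  What remains is that a torus with \<open>d\<close> coordinates has Krull dimension \<open>d\<close>. For the lower bound,
  coordinate subtori form a chain. They are irreducible because a torus is (\<open>irreducible_torus\<close>):
  if \<open>f a \<noteq> 0\<close> and \<open>g b \<noteq> 0\<close>, then on the line through \<open>a\<close> and \<open>b\<close> both become nonzero polynomials
  in one variable, up to a power of the product of the coordinates, so \<open>f * g\<close> does not vanish
  identically on the torus. For the upper bound (\<open>krull_dim_zariski_le\<close>), a chain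
  \<open>Z\<^sub>0 \<subset> \<dots> \<subset> Z\<^sub>n\<close> of irreducible closed sets yields Laurent polynomials \<open>f\<^sub>i\<close> that vanish on \<open>Z\<^sub>i\<close> but
  not on all of \<open>Z\<^sub>i\<^sub>+\<^sub>1\<close>. These are algebraically independent, so the \<open>N ^ n\<close> power products with
  exponents below \<open>N\<close> are linearly independent. Yet they lie in the span of the Laurent monomials
  whose exponents are bounded by a constant times \<open>N\<close>, and there are only \<open>O(N ^ d)\<close> of those.
\<close>

(* Without this, $ is ambiguous between vector components and power series coefficients. *)
no_notation fps_nth (infixl \<open>$\<close> 75)

section \<open>Diagonalization of integer matrices\<close>

definition unimodular_equiv :: "int^'m^'m \<Rightarrow> int^'m^'m \<Rightarrow> bool" where
  "unimodular_equiv A A' \<longleftrightarrow> (\<exists>U V. invertible U \<and> invertible V \<and> A' = U ** A ** V)"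

lemma invertible_mat_1: "invertible (mat 1 :: 'a::semiring_1^'n^'n)"
  by (auto simp: invertible_def)

lemma unimodular_equiv_refl: "unimodular_equiv A A"
  unfolding unimodular_equiv_def by (metis invertible_mat_1 matrix_mul_lid matrix_mul_rid)

lemma unimodular_equiv_trans:
  assumes "unimodular_equiv A B" "unimodular_equiv B C"
  shows "unimodular_equiv A C"
proof -
  obtain U V U' V' where "invertible U" "invertible V" "B = U ** A ** V"
    "invertible U'" "invertible V'" "C = U' ** B ** V'"
    using assms by (auto simp: unimodular_equiv_def)
  moreover from this have "C = (U' ** U) ** A ** (V ** V')"
    by (simp add: matrix_mul_assoc)
  ultimately show ?thesis
    unfolding unimodular_equiv_def using invertible_mult by blast
qed

lemma invertible_transpose:
  "invertible (A :: 'a::comm_semiring_1^'n^'n) \<Longrightarrow> invertible (transpose A)"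
  unfolding invertible_def by (metis matrix_transpose_mul transpose_mat)

lemma unimodular_equiv_transpose:
  assumes "unimodular_equiv A B" shows "unimodular_equiv (transpose A) (transpose B)"
proof -
  obtain U V where "invertible U" "invertible V" "B = U ** A ** V"
    using assms by (auto simp: unimodular_equiv_def)
  then show ?thesis
    unfolding unimodular_equiv_def
    by (metis invertible_transpose matrix_transpose_mul matrix_mul_assoc)
qed

text \<open>
  Multiples of column \<open>k\<close> are added to all columns at once. The operation is undone by the multipliers
  \<open>- q j\<close>, because \<open>q k = 0\<close> leaves column \<open>k\<close> itself unchanged.
\<close>

lemma unimodular_equiv_column_operation:
  assumes "q k = 0"
  shows "unimodular_equiv A (\<chi> i j. A$i$j + A$i$k * q j)"
proof -
  define E where "E = (\<lambda>q. (\<chi> a b. (if a = b then 1 else 0) + (if a = k then q b else 0)) :: int^'a^'a)"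
  have mult: "C ** E q = (\<chi> i j. C$i$j + C$i$k * q j)" for C q
  proof -
    have "(\<Sum>a\<in>UNIV. C$i$a * ((if a = j then 1 else 0) + (if a = k then q j else 0))) =
        C$i$j + C$i$k * q j" for i j
      by (simp add: distrib_left sum.distrib if_distrib[of "\<lambda>x. _ * x"] cong: if_cong)
    then show ?thesis
      unfolding vec_eq_iff matrix_matrix_mult_def E_def by simp
  qed
  have inv: "E q ** E q' = mat 1" if "q k = 0" "q' = (\<lambda>j. - q j)" for q q'
    unfolding mult unfolding E_def using that by (auto simp: vec_eq_iff mat_def)
  have "invertible (E q)"
    unfolding invertible_def
    using assms by (intro exI[of _ "E (\<lambda>j. - q j)"] conjI inv) auto
  then show ?thesis
    unfolding unimodular_equiv_def
    by (intro exI[of _ "mat 1"] exI[of _ "E q"]) (simp add: mult invertible_mat_1)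
qed

text \<open>
  Row operations are column operations on the transpose.
\<close>

lemma unimodular_equiv_row_operation:
  assumes "q k = 0"
  shows "unimodular_equiv A (\<chi> i j. A$i$j + q i * A$k$j)"
proof -
  have eq: "(\<chi> i j. A$i$j + q i * A$k$j) = transpose (\<chi> i j. transpose A$i$j + transpose A$i$k * q j)"
    by (simp add: vec_eq_iff transpose_def mult.commute)
  have "unimodular_equiv (transpose (transpose A)) (\<chi> i j. A$i$j + q i * A$k$j)"
    unfolding eq by (intro unimodular_equiv_transpose unimodular_equiv_column_operation assms)
  then show ?thesis by (simp only: transpose_transpose)
qed

lemma unimodular_equiv_swap_columns:
  "unimodular_equiv A (\<chi> i j. A$i$(Transposition.transpose k l j))"
proof -
  let ?t = "Transposition.transpose k l"
  define P where "P = ((\<chi> a b. if a = ?t b then 1 else 0) :: int^'a^'a)"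
  have mult: "C ** P = (\<chi> i j. C$i$(?t j))" for C
    by (simp add: vec_eq_iff matrix_matrix_mult_def P_def if_distrib cong: if_cong)
  have "P ** P = mat 1"
    unfolding mult unfolding P_def by (auto simp: vec_eq_iff mat_def)
  then have "invertible P" unfolding invertible_def by blast
  then show ?thesis
    unfolding unimodular_equiv_def
    by (intro exI[of _ "mat 1"] exI[of _ P]) (simp add: mult invertible_mat_1)
qed

lemma unimodular_equiv_swap_rows:
  "unimodular_equiv A (\<chi> i j. A$(Transposition.transpose k l i)$j)"
proof -
  have eq: "(\<chi> i j. A$(Transposition.transpose k l i)$j) =
      transpose (\<chi> i j. transpose A$i$(Transposition.transpose k l j))"
    by (simp add: vec_eq_iff Finite_Cartesian_Product.transpose_def)
  have "unimodular_equiv (transpose (transpose A)) (\<chi> i j. A$(Transposition.transpose k l i)$j)"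
    unfolding eq by (intro unimodular_equiv_transpose unimodular_equiv_swap_columns)
  then show ?thesis by (simp only: transpose_transpose)
qed

text \<open>
  The rows and columns with index in \<open>S\<close> are already split off as a diagonal block.
\<close>

definition diagonal_in :: "'m set \<Rightarrow> int^'m^'m \<Rightarrow> bool" where
  "diagonal_in S A \<longleftrightarrow> (\<forall>i j. i \<noteq> j \<and> (i \<in> S \<or> j \<in> S) \<longrightarrow> A$i$j = 0)"

text \<open>
  Among all equivalent matrices with the block \<open>S\<close> split off, take one with a nonzero entry of least
  absolute value outside the block and move that entry to position \<open>(k, k)\<close>. Reducing row \<open>k\<close> and
  column \<open>k\<close> modulo this pivot leaves remainders of smaller absolute value, so by minimality they are
  zero.
\<close>

lemma diagonal_step:
  assumes A: "diagonal_in S A" and k: "k \<notin> S"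
  shows "\<exists>A'. unimodular_equiv A A' \<and> diagonal_in (insert k S) A'"
proof (cases "\<exists>A' i j. unimodular_equiv A A' \<and> diagonal_in S A' \<and> i \<notin> S \<and> j \<notin> S \<and> A'$i$j \<noteq> 0")
  case False
  then have "\<forall>i j. i \<notin> S \<and> j \<notin> S \<longrightarrow> A$i$j = 0"
    using A unimodular_equiv_refl by blast
  then have "diagonal_in (insert k S) A"
    using A by (auto simp: diagonal_in_def)
  then show ?thesis using unimodular_equiv_refl by blast
next
  case True
  define M where "M = {A'. unimodular_equiv A A' \<and> diagonal_in S A'}"
  define Q where "Q n \<longleftrightarrow> (\<exists>A' i j. A' \<in> M \<and> i \<notin> S \<and> j \<notin> S \<and> A'$i$j \<noteq> 0 \<and> nat \<bar>A'$i$j\<bar> = n)" for n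
  have "\<exists>n. Q n" using True unfolding Q_def M_def by blast
  then obtain n where n: "Q n" "\<And>n'. n' < n \<Longrightarrow> \<not> Q n'"
    using exists_least_iff[of Q] by blast
  obtain A0 i j where A0: "A0 \<in> M" "i \<notin> S" "j \<notin> S" "A0$i$j \<noteq> 0" "nat \<bar>A0$i$j\<bar> = n"
    using n(1) unfolding Q_def by blast
  have least: "C$a$b = 0" if "C \<in> M" "a \<notin> S" "b \<notin> S" "nat \<bar>C$a$b\<bar> < n" for C a b
    using n(2)[OF that(4)] that unfolding Q_def by blast
  have M_step: "C' \<in> M" if "C \<in> M" "unimodular_equiv C C'" "diagonal_in S C'" for C C'
    using that unimodular_equiv_trans unfolding M_def by blast
  have tr: "Transposition.transpose a k x = x" if "a \<notin> S" "x \<in> S" for a x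
    using that k by (intro transpose_apply_other) auto
  have tr': "Transposition.transpose a k x = x' \<Longrightarrow> x' \<in> S \<Longrightarrow> a \<notin> S \<Longrightarrow> x = x'" for a x x'
    using tr by (metis transpose_involutory)
  \<comment> \<open>Two swaps move the entry at \<open>(i, j)\<close> to the diagonal position \<open>(k, k)\<close>.\<close>
  define A1 where "A1 = (\<chi> a b. A0$(Transposition.transpose i k a)$b)"
  have "diagonal_in S A1"
    unfolding diagonal_in_def
  proof (intro allI impI)
    fix a b assume ab: "a \<noteq> b \<and> (a \<in> S \<or> b \<in> S)"
    let ?a = "Transposition.transpose i k a"
    have "?a \<noteq> b \<and> (?a \<in> S \<or> b \<in> S)"
      using ab tr[OF A0(2), of a] tr'[of i a b, OF _ _ A0(2)] by auto
    then have "A0$(?a)$b = 0" using A0(1) by (simp add: M_def diagonal_in_def)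
    then show "A1$a$b = 0" by (simp add: A1_def)
  qed
  then have A1: "A1 \<in> M"
    by (rule M_step[OF A0(1), rotated]) (unfold A1_def, rule unimodular_equiv_swap_rows)
  define A2 where "A2 = (\<chi> a b. A1$a$(Transposition.transpose j k b))"
  have "diagonal_in S A2"
    unfolding diagonal_in_def
  proof (intro allI impI)
    fix a b assume ab: "a \<noteq> b \<and> (a \<in> S \<or> b \<in> S)"
    let ?b = "Transposition.transpose j k b"
    have "a \<noteq> ?b \<and> (a \<in> S \<or> ?b \<in> S)"
      using ab tr[OF A0(3), of b] tr'[of j b a, OF _ _ A0(3)] by auto
    then have "A1$a$(?b) = 0" using A1 by (simp add: M_def diagonal_in_def)
    then show "A2$a$b = 0" by (simp add: A2_def)
  qed
  then have A2: "A2 \<in> M"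
    by (rule M_step[OF A1, rotated]) (unfold A2_def, rule unimodular_equiv_swap_columns)
  have pivot: "A2$k$k \<noteq> 0" "nat \<bar>A2$k$k\<bar> = n"
    using A0(4,5) by (simp_all add: A2_def A1_def)
  \<comment> \<open>Row \<open>k\<close> is replaced by its remainders modulo the pivot.\<close>
  define q where "q b = (if b = k then 0 else - (A2$k$b div A2$k$k))" for b
  define A3 where "A3 = (\<chi> a b. A2$a$b + A2$a$k * q b)"
  have qS: "q b = 0" if "b \<in> S" for b
    using A2 that k by (auto simp: M_def diagonal_in_def q_def)
  have "diagonal_in S A3"
    unfolding diagonal_in_def
  proof (intro allI impI)
    fix a b assume ab: "a \<noteq> b \<and> (a \<in> S \<or> b \<in> S)"
    have "A2$a$b = 0" using A2 ab by (auto simp: M_def diagonal_in_def)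
    moreover have "A2$a$k = 0 \<or> q b = 0"
    proof (cases "b \<in> S")
      case True then show ?thesis using qS by simp
    next
      case False
      then have "a \<in> S" "a \<noteq> k" using ab k by auto
      then show ?thesis using A2 by (simp add: M_def diagonal_in_def)
    qed
    ultimately show "A3$a$b = 0" by (auto simp: A3_def)
  qed
  then have A3: "A3 \<in> M"
    by (rule M_step[OF A2, rotated])
       (unfold A3_def, rule unimodular_equiv_column_operation, simp add: q_def)
  have mod_less: "nat \<bar>x mod A2$k$k\<bar> < n" for x
    using pivot abs_mod_less[of "A2$k$k" x] by linarith
  have row: "A3$k$b = 0" if "b \<noteq> k" for b
  proof (cases "b \<in> S")
    case True
    then have "k \<noteq> b" using k by auto
    then show ?thesis using A3 True by (simp add: M_def diagonal_in_def)
  next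
    case False
    have "A3$k$b = A2$k$b mod A2$k$k"
      using that by (simp add: A3_def q_def minus_mult_div_eq_mod)
    then show ?thesis using least[OF A3 k False] mod_less by simp
  qed
  have A3kk: "A3$k$k = A2$k$k" by (simp add: A3_def q_def)
  \<comment> \<open>The same for column \<open>k\<close>. Row \<open>k\<close> is already zero off the pivot, so the other columns stay as they are.\<close>
  define p where "p a = (if a = k then 0 else - (A3$a$k div A3$k$k))" for a
  define A4 where "A4 = (\<chi> a b. A3$a$b + p a * A3$k$b)"
  have pS: "p a = 0" if "a \<in> S" for a
    using A3 that k by (auto simp: M_def diagonal_in_def p_def)
  have "diagonal_in S A4"
    unfolding diagonal_in_def
  proof (intro allI impI)
    fix a b assume ab: "a \<noteq> b \<and> (a \<in> S \<or> b \<in> S)"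
    have "A3$a$b = 0" using A3 ab by (auto simp: M_def diagonal_in_def)
    moreover have "p a = 0 \<or> A3$k$b = 0"
    proof (cases "a \<in> S")
      case True then show ?thesis using pS by simp
    next
      case False
      then have "b \<in> S" "k \<noteq> b" using ab k by auto
      then show ?thesis using A3 by (simp add: M_def diagonal_in_def)
    qed
    ultimately show "A4$a$b = 0" by (auto simp: A4_def)
  qed
  then have A4: "A4 \<in> M"
    by (rule M_step[OF A3, rotated])
       (unfold A4_def, rule unimodular_equiv_row_operation, simp add: p_def)
  have row': "A4$k$b = 0" if "b \<noteq> k" for b
    using row[OF that] by (simp add: A4_def)
  have col: "A4$a$k = 0" if "a \<noteq> k" for a
  proof (cases "a \<in> S")
    case True
    then have "a \<noteq> k" using k by auto
    then show ?thesis using A4 True by (simp add: M_def diagonal_in_def)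
  next
    case False
    have "A4$a$k = A3$a$k mod A3$k$k"
      using that by (simp add: A4_def p_def minus_div_mult_eq_mod)
    then show ?thesis using least[OF A4 False k] mod_less by (simp add: A3kk)
  qed
  have "diagonal_in (insert k S) A4"
    using A4 row' col unfolding M_def diagonal_in_def by auto
  then show ?thesis using A4 unfolding M_def by blast
qed

definition diagonal_matrix :: "('m \<Rightarrow> int) \<Rightarrow> int^'m^'m" where
  "diagonal_matrix d = (\<chi> i j. if i = j then d i else 0)"

text \<open>
  The Smith normal form without the divisibility chain between the diagonal entries.
\<close>

theorem unimodular_diagonalization:
  fixes B :: "int^'m^'m"
  obtains U V :: "int^'m^'m" and d where "invertible U" "invertible V" "B = U ** diagonal_matrix d ** V"
proof -
  have "\<exists>A. unimodular_equiv B A \<and> diagonal_in S A" if "finite S" for S :: "'m set"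
    using that
  proof induction
    case empty
    then show ?case using unimodular_equiv_refl by (auto simp: diagonal_in_def)
  next
    case (insert k S)
    then show ?case using diagonal_step unimodular_equiv_trans by meson
  qed
  from this[OF finite[of UNIV]] obtain A where A: "unimodular_equiv B A" "diagonal_in UNIV A" by blast
  then obtain U V where UV: "invertible U" "invertible V" "A = U ** B ** V"
    by (auto simp: unimodular_equiv_def)
  then obtain U' V' where U': "U ** U' = mat 1" "U' ** U = mat 1"
    and V': "V ** V' = mat 1" "V' ** V = mat 1" by (auto simp: invertible_def)
  have "A = diagonal_matrix (\<lambda>i. A$i$i)"
    using A(2) by (simp add: diagonal_in_def diagonal_matrix_def vec_eq_iff)
  moreover have "U' ** A ** V' = B"
    by (simp add: UV(3) matrix_mul_assoc U'(2)) (simp add: V'(1) flip: matrix_mul_assoc)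
  moreover have "invertible U'" "invertible V'" using U' V' by (auto simp: invertible_def)
  ultimately show thesis by (intro that[of U' V' "\<lambda>i. A$i$i"]) simp_all
qed

section \<open>Irreducible sets, components and Krull dimension\<close>

lemma irreducibleinD:
  "irreduciblein X S \<Longrightarrow> closedin X C \<Longrightarrow> closedin X D \<Longrightarrow> S \<subseteq> C \<union> D \<Longrightarrow> S \<subseteq> C \<or> S \<subseteq> D"
  by (simp add: irreduciblein_def)

lemma irreduciblein_continuous_image:
  assumes S: "irreduciblein X S" and g: "continuous_map X Y g"
  shows "irreduciblein Y (g ` S)"
  unfolding irreduciblein_def
proof (intro conjI allI impI)
  have sub: "S \<subseteq> topspace X" using S by (simp add: irreduciblein_def)
  then show "g ` S \<subseteq> topspace Y"
    using continuous_map_image_subset_topspace[OF g] by blast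
  show "g ` S \<noteq> {}" using S by (simp add: irreduciblein_def)
  fix C D assume CD: "closedin Y C \<and> closedin Y D \<and> g ` S \<subseteq> C \<union> D"
  let ?p = "\<lambda>C. {x \<in> topspace X. g x \<in> C}"
  have "closedin X (?p C)" "closedin X (?p D)"
    using closedin_continuous_map_preimage[OF g] CD by blast+
  moreover have "S \<subseteq> ?p C \<union> ?p D" using CD sub by blast
  ultimately have "S \<subseteq> ?p C \<or> S \<subseteq> ?p D" by (rule irreducibleinD[OF S])
  then show "g ` S \<subseteq> C \<or> g ` S \<subseteq> D" by blast
qed

lemma irreduciblein_subtopology:
  "irreduciblein (subtopology X T) S \<longleftrightarrow> irreduciblein X S \<and> S \<subseteq> T"
proof (intro iffI conjI)
  assume L: "irreduciblein (subtopology X T) S"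
  then show ST: "S \<subseteq> T" by (auto simp: irreduciblein_def)
  have "continuous_map (subtopology X T) X (\<lambda>x. x)"
    by (simp add: continuous_map_from_subtopology)
  from irreduciblein_continuous_image[OF L this] show "irreduciblein X S" by simp
next
  assume R: "irreduciblein X S \<and> S \<subseteq> T"
  show "irreduciblein (subtopology X T) S"
    unfolding irreduciblein_def
  proof (intro conjI allI impI)
    show "S \<subseteq> topspace (subtopology X T)" "S \<noteq> {}"
      using R by (auto simp: irreduciblein_def)
    fix C D
    assume "closedin (subtopology X T) C \<and> closedin (subtopology X T) D \<and> S \<subseteq> C \<union> D"
    then obtain C' D' where C': "closedin X C'" "C = C' \<inter> T" and D': "closedin X D'" "D = D' \<inter> T"
      and S: "S \<subseteq> C \<union> D"
      by (auto simp: closedin_subtopology)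
    then have "S \<subseteq> C' \<union> D'" by blast
    then have "S \<subseteq> C' \<or> S \<subseteq> D'" using irreducibleinD[of X S C' D'] R C'(1) D'(1) by blast
    then show "S \<subseteq> C \<or> S \<subseteq> D" using R C'(2) D'(2) by blast
  qed
qed

lemma irreduciblein_imp_connectedin: "irreduciblein X S \<Longrightarrow> connectedin X S"
  unfolding irreduciblein_def connectedin_closedin by blast

text \<open>
  Iterates the definition of irreducibility, which speaks of two closed sets.
\<close>

lemma irreduciblein_subset_finite_Union:
  assumes "irreduciblein X S" "finite \<C>" "\<And>C. C \<in> \<C> \<Longrightarrow> closedin X C" "S \<subseteq> \<Union>\<C>"
  shows "\<exists>C\<in>\<C>. S \<subseteq> C"
  using assms(2,3,4)
proof (induction \<C>)
  case empty
  then show ?case using assms(1) by (simp add: irreduciblein_def)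
next
  case (insert C \<C>)
  have "closedin X C" "closedin X (\<Union>\<C>)"
    using insert by (auto intro!: closedin_Union)
  moreover have "S \<subseteq> C \<union> \<Union>\<C>" using insert.prems by simp
  ultimately have "S \<subseteq> C \<or> S \<subseteq> \<Union>\<C>" by (rule irreducibleinD[OF assms(1)])
  then show ?case using insert by auto
qed

text \<open>
  A component lies in one of the finitely many covering sets and equals it by maximality.
\<close>

lemma irreducible_components_subset_finite_cover:
  assumes "finite \<C>" "topspace X = \<Union>\<C>"
    and "\<And>C. C \<in> \<C> \<Longrightarrow> closedin X C" "\<And>C. C \<in> \<C> \<Longrightarrow> irreduciblein X C"
  shows "irreducible_components_of X \<subseteq> \<C>"
proof
  fix Z assume "Z \<in> irreducible_components_of X"
  then have Z: "irreduciblein X Z" and max: "\<And>W. irreduciblein X W \<Longrightarrow> Z \<subseteq> W \<Longrightarrow> W = Z"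
    by (auto simp: irreducible_components_of_def)
  have "Z \<subseteq> \<Union>\<C>" using Z assms(2) by (auto simp: irreduciblein_def)
  then obtain C where "C \<in> \<C>" "Z \<subseteq> C"
    using irreduciblein_subset_finite_Union[OF Z assms(1,3)] by blast
  then show "Z \<in> \<C>" using max[of C] assms(4) by auto
qed

text \<open>
  The complement of \<open>C\<close> is a finite union of closed sets. So \<open>C\<close> is clopen, and a connected set
  that meets \<open>C\<close> cannot leave it.
\<close>

lemma connected_component_of_finite_partition:
  assumes "finite \<C>" "topspace X = \<Union>\<C>" "disjoint \<C>"
    and "\<And>C. C \<in> \<C> \<Longrightarrow> closedin X C" "C \<in> \<C>" "connectedin X C" "x \<in> C"
  shows "connected_component_of_set X x = C"
proof
  show "C \<subseteq> connected_component_of_set X x"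
    using assms(6,7) by (intro connected_component_of_maximal)
  have "C \<inter> D = {}" if "D \<in> \<C> - {C}" for D
    using assms(3,5) that by (auto simp: disjoint_def)
  then have compl: "topspace X - C = \<Union>(\<C> - {C})" using assms(2,5) by auto
  have "closedin X (\<Union>(\<C> - {C}))" using assms(1,4) by (auto intro!: closedin_Union)
  then have "openin X C"
    using compl closedin_subset[OF assms(4)[OF assms(5)]] by (metis openin_closedin)
  then show "connected_component_of_set X x \<subseteq> C"
    using connectedin_clopen_cases[OF connectedin_connected_component_of[of X x], of C]
      assms(4,5,7) connected_component_of_refl[of X x] assms(2) by (auto simp: disjnt_iff)
qed

lemma krull_dim_ge:
  assumes "\<And>i. i \<le> n \<Longrightarrow> closedin X (Z i)" "\<And>i. i \<le> n \<Longrightarrow> irreduciblein X (Z i)"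
    and "\<And>i. i < n \<Longrightarrow> Z i \<subset> Z (Suc i)"
  shows "enat n \<le> krull_dim X"
  unfolding krull_dim_def using assms by (intro Sup_upper) blast

lemma krull_dim_leI:
  assumes "\<And>n Z. (\<And>i. i \<le> n \<Longrightarrow> closedin X (Z i)) \<Longrightarrow> (\<And>i. i \<le> n \<Longrightarrow> irreduciblein X (Z i)) \<Longrightarrow>
    (\<And>i. i < n \<Longrightarrow> Z i \<subset> Z (Suc i)) \<Longrightarrow> enat n \<le> d"
  shows "krull_dim X \<le> d"
  unfolding krull_dim_def using assms by (intro Sup_least) blast

lemma homeomorphic_maps_krull_dim_le:
  assumes "homeomorphic_maps X Y f g"
  shows "krull_dim X \<le> krull_dim Y"
proof (rule krull_dim_leI)
  have f: "homeomorphic_map X Y f" using assms homeomorphic_maps_map by blast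
  then have inj: "inj_on f (topspace X)" by (rule homeomorphic_imp_injective_map)
  fix n and Z :: "nat \<Rightarrow> 'a set"
  assume Z: "\<And>i. i \<le> n \<Longrightarrow> closedin X (Z i)" "\<And>i. i \<le> n \<Longrightarrow> irreduciblein X (Z i)"
    "\<And>i. i < n \<Longrightarrow> Z i \<subset> Z (Suc i)"
  show "enat n \<le> krull_dim Y"
  proof (rule krull_dim_ge)
    fix i assume i: "i \<le> n"
    show "closedin Y (f ` Z i)"
      using homeomorphic_map_closedness[OF f closedin_subset[OF Z(1)[OF i]]] Z(1)[OF i] by simp
    show "irreduciblein Y (f ` Z i)"
      using irreduciblein_continuous_image[OF Z(2)[OF i] homeomorphic_imp_continuous_map[OF f]] .
  next
    fix i assume i: "i < n"
    have "Z (Suc i) \<subseteq> topspace X" using closedin_subset[OF Z(1)] i by simp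
    then show "f ` Z i \<subset> f ` Z (Suc i)"
      using Z(3)[OF i] inj inj_on_image_eq_iff[OF inj, of "Z i" "Z (Suc i)"] by blast
  qed
qed

lemma homeomorphic_maps_krull_dim:
  "homeomorphic_maps X Y f g \<Longrightarrow> krull_dim X = krull_dim Y"
  by (meson antisym homeomorphic_maps_krull_dim_le homeomorphic_maps_sym)

section \<open>Laurent polynomials with bounded exponents\<close>

definition laurent_monomial :: "'i set \<Rightarrow> ('i \<Rightarrow> int) \<Rightarrow> ('i \<Rightarrow> 'k::field) \<Rightarrow> 'k" where
  "laurent_monomial I a x = (\<Prod>i\<in>I. x i powi a i)"

lemma laurent_monomial_add:
  assumes "x \<in> carrier (torus I)"
  shows "laurent_monomial I (\<lambda>i. a i + b i) x = laurent_monomial I a x * laurent_monomial I b x"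
  using assms unfolding laurent_monomial_def prod.distrib[symmetric]
  by (intro prod.cong) (auto simp: carrier_torus power_int_add)

definition exponent_box :: "'i set \<Rightarrow> nat \<Rightarrow> ('i \<Rightarrow> int) set" where
  "exponent_box I R = I \<rightarrow>\<^sub>E {- int R..int R}"

lemma finite_exponent_box: "finite I \<Longrightarrow> finite (exponent_box I R)"
  by (auto simp: exponent_box_def intro: finite_PiE)

lemma card_exponent_box: "finite I \<Longrightarrow> card (exponent_box I R) = (2 * R + 1) ^ card I"
  by (simp add: exponent_box_def card_PiE) (simp add: nat_add_distrib nat_mult_distrib)

text \<open>
  Functions that agree on the torus with a Laurent polynomial whose exponents are bounded by \<open>R\<close> in
  absolute value. The bound makes the space finite-dimensional, which the dimension count below needs;
  the union over all \<open>R\<close> consists of all functions that are Laurent polynomials on the torus.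
\<close>

definition laurent_span :: "'i set \<Rightarrow> nat \<Rightarrow> (('i \<Rightarrow> 'k::field) \<Rightarrow> 'k) set" where
  "laurent_span I R = {f. \<exists>c. \<forall>x\<in>carrier (torus I).
     f x = (\<Sum>b\<in>exponent_box I R. c b * laurent_monomial I b x)}"

lemma laurent_span_cong:
  "f \<in> laurent_span I R \<Longrightarrow> (\<And>x. x \<in> carrier (torus I) \<Longrightarrow> f x = g x) \<Longrightarrow> g \<in> laurent_span I R"
  unfolding laurent_span_def by auto

lemma laurent_span_monomial:
  assumes "finite I" "\<And>i. i \<in> I \<Longrightarrow> \<bar>a i\<bar> \<le> int R"
  shows "laurent_monomial I a \<in> laurent_span I R"
proof -
  let ?a = "restrict a I"
  have "laurent_monomial I a x =
      (\<Sum>b\<in>exponent_box I R. (if b = ?a then 1 else 0) * laurent_monomial I b x)"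
    if "x \<in> carrier (torus I)" for x :: "'a \<Rightarrow> 'b"
  proof -
    have "?a \<in> exponent_box I R"
      using assms(2) by (fastforce simp: exponent_box_def)
    then have "(\<Sum>b\<in>exponent_box I R. (if b = ?a then 1 else 0) * laurent_monomial I b x) =
        laurent_monomial I ?a x"
      using finite_exponent_box[OF assms(1)] by (simp add: if_distrib[of "\<lambda>y. y * _"] cong: if_cong)
    then show ?thesis by (simp add: laurent_monomial_def)
  qed
  then show ?thesis
    unfolding laurent_span_def by (intro CollectI exI[of _ "\<lambda>b. if b = ?a then 1 else 0"]) blast
qed

lemma laurent_monomial_in_span:
  assumes "finite I"
  shows "\<exists>R. laurent_monomial I a \<in> laurent_span I R"
proof -
  have "\<bar>a i\<bar> \<le> int (nat (\<Sum>i\<in>I. \<bar>a i\<bar>))" if "i \<in> I" for i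
    using that assms member_le_sum[of i I "\<lambda>i. \<bar>a i\<bar>"] by simp
  then show ?thesis using laurent_span_monomial[OF assms] by blast
qed

lemma laurent_span_0: "(\<lambda>_. 0) \<in> laurent_span I R"
  unfolding laurent_span_def by (intro CollectI exI[of _ "\<lambda>_. 0"]) simp

lemma laurent_span_add:
  assumes "f \<in> laurent_span I R" "g \<in> laurent_span I R"
  shows "(\<lambda>x. f x + g x) \<in> laurent_span I R"
proof -
  obtain c d where "\<forall>x\<in>carrier (torus I). f x = (\<Sum>b\<in>exponent_box I R. c b * laurent_monomial I b x)"
    "\<forall>x\<in>carrier (torus I). g x = (\<Sum>b\<in>exponent_box I R. d b * laurent_monomial I b x)"
    using assms unfolding laurent_span_def by blast
  then show ?thesis
    unfolding laurent_span_def
    by (intro CollectI exI[of _ "\<lambda>b. c b + d b"]) (simp add: distrib_right sum.distrib)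
qed

lemma laurent_span_scale:
  assumes "f \<in> laurent_span I R"
  shows "(\<lambda>x. s * f x) \<in> laurent_span I R"
proof -
  obtain c where "\<forall>x\<in>carrier (torus I). f x = (\<Sum>b\<in>exponent_box I R. c b * laurent_monomial I b x)"
    using assms unfolding laurent_span_def by blast
  then show ?thesis
    unfolding laurent_span_def
    by (intro CollectI exI[of _ "\<lambda>b. s * c b"]) (simp add: sum_distrib_left mult.assoc)
qed

lemma laurent_span_sum:
  assumes "\<And>a. a \<in> A \<Longrightarrow> f a \<in> laurent_span I R"
  shows "(\<lambda>x. \<Sum>a\<in>A. f a x) \<in> laurent_span I R"
  using assms
  by (induction A rule: infinite_finite_induct) (simp_all add: laurent_span_0 laurent_span_add)

lemma exponent_box_abs_le: "b \<in> exponent_box I R \<Longrightarrow> i \<in> I \<Longrightarrow> \<bar>b i\<bar> \<le> int R"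
  using PiE_mem[of b I "\<lambda>_. {- int R..int R}" i] by (auto simp: exponent_box_def)

lemma laurent_span_mono:
  assumes "finite I" "f \<in> laurent_span I R" "R \<le> S"
  shows "f \<in> laurent_span I S"
proof -
  obtain c where c: "\<forall>x\<in>carrier (torus I). f x = (\<Sum>b\<in>exponent_box I R. c b * laurent_monomial I b x)"
    using assms(2) unfolding laurent_span_def by blast
  have "(\<lambda>x. \<Sum>b\<in>exponent_box I R. c b * laurent_monomial I b x) \<in> laurent_span I S"
  proof (intro laurent_span_sum laurent_span_scale laurent_span_monomial assms(1))
    fix b i assume "b \<in> exponent_box I R" "i \<in> I"
    then have "\<bar>b i\<bar> \<le> int R" by (rule exponent_box_abs_le)
    then show "\<bar>b i\<bar> \<le> int S" using assms(3) by simp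
  qed
  then show ?thesis by (rule laurent_span_cong) (simp add: c)
qed

lemma laurent_span_mult:
  assumes "finite I" "f \<in> laurent_span I R" "g \<in> laurent_span I S"
  shows "(\<lambda>x. f x * g x) \<in> laurent_span I (R + S)"
proof -
  obtain c d where c: "\<forall>x\<in>carrier (torus I). f x = (\<Sum>b\<in>exponent_box I R. c b * laurent_monomial I b x)"
    and d: "\<forall>x\<in>carrier (torus I). g x = (\<Sum>b\<in>exponent_box I S. d b * laurent_monomial I b x)"
    using assms unfolding laurent_span_def by blast
  have "(\<lambda>x. \<Sum>a\<in>exponent_box I R. \<Sum>b\<in>exponent_box I S.
      (c a * d b) * laurent_monomial I (\<lambda>i. a i + b i) x) \<in> laurent_span I (R + S)"
  proof (intro laurent_span_sum laurent_span_scale laurent_span_monomial assms(1))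
    fix a b i assume "a \<in> exponent_box I R" "b \<in> exponent_box I S" "i \<in> I"
    then show "\<bar>a i + b i\<bar> \<le> int (R + S)"
      using exponent_box_abs_le[of a I R i] exponent_box_abs_le[of b I S i] by auto
  qed
  then show ?thesis
    by (rule laurent_span_cong)
       (simp add: c d sum_product laurent_monomial_add mult_ac)
qed

lemma laurent_span_1: "finite I \<Longrightarrow> (\<lambda>_. 1) \<in> laurent_span I 0"
  using laurent_span_monomial[of I "\<lambda>_. 0" 0] by (simp add: laurent_monomial_def[abs_def])

lemma laurent_span_const: "finite I \<Longrightarrow> (\<lambda>_. s) \<in> laurent_span I 0"
  using laurent_span_scale[OF laurent_span_1, of I s] by simp

lemma laurent_span_power:
  assumes "finite I" "f \<in> laurent_span I R"
  shows "(\<lambda>x. f x ^ k) \<in> laurent_span I (k * R)"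
proof (induction k)
  case 0
  then show ?case using laurent_span_1[OF assms(1)] by simp
next
  case (Suc k)
  then show ?case using laurent_span_mult[OF assms Suc.IH] by simp
qed

lemma laurent_functions_imp_span:
  assumes "finite I" "f \<in> laurent_functions I"
  shows "\<exists>R. f \<in> laurent_span I R"
proof -
  obtain A c where A: "finite A" "f = (\<lambda>x. \<Sum>a\<in>A. c a * (\<Prod>i\<in>I. x i powi a i))"
    using assms(2) by (auto simp: laurent_functions_def)
  define R where "R = nat (\<Sum>a\<in>A. \<Sum>i\<in>I. \<bar>a i\<bar>)"
  have "\<bar>a i\<bar> \<le> int R" if "a \<in> A" "i \<in> I" for a i
  proof -
    have "\<bar>a i\<bar> \<le> (\<Sum>i\<in>I. \<bar>a i\<bar>)"
      using that assms(1) by (intro member_le_sum) auto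
    also have "\<dots> \<le> (\<Sum>a\<in>A. \<Sum>i\<in>I. \<bar>a i\<bar>)"
      using that A(1) by (intro member_le_sum[of a A "\<lambda>a. \<Sum>i\<in>I. \<bar>a i\<bar>"]) (auto intro: sum_nonneg)
    finally show ?thesis by (simp add: R_def sum_nonneg)
  qed
  then have "(\<lambda>x. \<Sum>a\<in>A. c a * laurent_monomial I a x) \<in> laurent_span I R"
    by (intro laurent_span_sum laurent_span_scale laurent_span_monomial assms(1))
  then show ?thesis unfolding A(2) laurent_monomial_def by blast
qed

lemma laurent_span_imp_functions:
  assumes "finite I" "f \<in> laurent_span I R"
  shows "\<exists>g\<in>laurent_functions I. \<forall>x\<in>carrier (torus I). f x = g x"
proof -
  obtain c where c: "\<forall>x\<in>carrier (torus I). f x = (\<Sum>b\<in>exponent_box I R. c b * laurent_monomial I b x)"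
    using assms(2) unfolding laurent_span_def by blast
  define g where "g = (\<lambda>x::'a \<Rightarrow> 'b. \<Sum>b\<in>exponent_box I R. c b * (\<Prod>i\<in>I. x i powi b i))"
  have "g \<in> laurent_functions I"
    unfolding g_def by (rule laurent_functionsI[OF finite_exponent_box[OF assms(1)]])
  moreover have "\<forall>x\<in>carrier (torus I). f x = g x"
    using c by (simp add: g_def laurent_monomial_def)
  ultimately show ?thesis by blast
qed

text \<open>
  The Zariski topology is defined through Laurent polynomials themselves. This version allows functions
  that agree with them only on the torus.
\<close>

lemma closedin_zariski_zero_locus:
  assumes "finite I" "\<And>f. f \<in> F \<Longrightarrow> \<exists>R. f \<in> laurent_span I R"
  shows "closedin (zariski I) {x \<in> carrier (torus I). \<forall>f\<in>F. f x = 0}"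
proof -
  let ?G = "{g \<in> laurent_functions I. \<exists>f\<in>F. \<forall>x\<in>carrier (torus I). f x = g x}"
  have "{x \<in> carrier (torus I). \<forall>f\<in>F. f x = 0} = {x \<in> carrier (torus I). \<forall>g\<in>?G. g x = 0}"
  proof (intro equalityI subsetI CollectI conjI ballI; elim CollectE conjE)
    fix x f assume x: "x \<in> carrier (torus I)" "\<forall>g\<in>?G. g x = 0" and f: "f \<in> F"
    obtain R where "f \<in> laurent_span I R" using assms(2)[OF f] by blast
    from laurent_span_imp_functions[OF assms(1) this]
    obtain g where g: "g \<in> laurent_functions I" "\<forall>x\<in>carrier (torus I). f x = g x" by blast
    then have "g \<in> ?G" using f by blast
    then show "f x = 0" using x g(2) by simp
  next
    fix x g f assume "x \<in> carrier (torus I)" "\<forall>f\<in>F. f x = 0"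
      and "\<exists>f\<in>F. \<forall>x\<in>carrier (torus I). f x = g x"
    then show "g x = 0" by force
  qed
  then show ?thesis unfolding closedin_zariski by (intro exI[of _ ?G] conjI) (blast, assumption)
qed

lemma closedin_zariski_zero_locus1:
  assumes "finite I" "f \<in> laurent_span I R"
  shows "closedin (zariski I) {x \<in> carrier (torus I). f x = 0}"
  using closedin_zariski_zero_locus[of I "{f}"] assms by auto

text \<open>
  Every coordinate is a Laurent monomial with a nonzero coefficient. Over an infinite field all
  morphisms between tori have this form, because these terms are the units of the Laurent polynomial
  ring.
\<close>

definition monomial_transformation ::
    "'i set \<Rightarrow> 'j set \<Rightarrow> (('i \<Rightarrow> 'k::field) \<Rightarrow> ('j \<Rightarrow> 'k)) \<Rightarrow> bool" where
  "monomial_transformation I J \<phi> \<longleftrightarrow>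
     (\<forall>x\<in>carrier (torus I). \<phi> x \<in> carrier (torus J)) \<and>
     (\<forall>j\<in>J. \<exists>s a. s \<noteq> 0 \<and> (\<forall>x\<in>carrier (torus I). \<phi> x j = s * laurent_monomial I a x))"

lemma prod_powi_distrib: "(\<Prod>i\<in>I. f i :: 'k::field) powi n = (\<Prod>i\<in>I. f i powi n)"
  by (induction I rule: infinite_finite_induct) (simp_all add: power_int_mult_distrib)

lemma monomial_transformation_monomial:
  fixes \<phi> :: "('i \<Rightarrow> 'k::field) \<Rightarrow> ('j \<Rightarrow> 'k)"
  assumes fin: "finite I" "finite J" and \<phi>: "monomial_transformation I J \<phi>"
  shows "\<exists>t e. t \<noteq> 0 \<and> (\<forall>x\<in>carrier (torus I). laurent_monomial J b (\<phi> x) = t * laurent_monomial I e x)"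
proof -
  obtain s a where s0: "\<And>j. j \<in> J \<Longrightarrow> s j \<noteq> 0"
    and s: "\<And>j x. j \<in> J \<Longrightarrow> x \<in> carrier (torus I) \<Longrightarrow> \<phi> x j = s j * laurent_monomial I (a j) x"
    using \<phi> unfolding monomial_transformation_def by metis
  let ?e = "\<lambda>i. \<Sum>j\<in>J. a j i * b j"
  have "laurent_monomial J b (\<phi> x) = (\<Prod>j\<in>J. s j powi b j) * laurent_monomial I ?e x"
    if x: "x \<in> carrier (torus I)" for x
  proof -
    have x0: "x i \<noteq> 0" if "i \<in> I" for i using x that by (simp add: carrier_torus)
    have sum: "x i powi (\<Sum>j\<in>J. a j i * b j) = (\<Prod>j\<in>J. x i powi (a j i * b j))" if "i \<in> I" for i
      using fin(2) x0[OF that] by (induction J) (simp_all add: power_int_add)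
    have "laurent_monomial J b (\<phi> x) = (\<Prod>j\<in>J. s j powi b j * (\<Prod>i\<in>I. x i powi (a j i * b j)))"
      unfolding laurent_monomial_def[of J]
      by (intro prod.cong refl)
         (simp add: s x laurent_monomial_def power_int_mult_distrib prod_powi_distrib power_int_mult)
    also have "\<dots> = (\<Prod>j\<in>J. s j powi b j) * (\<Prod>i\<in>I. \<Prod>j\<in>J. x i powi (a j i * b j))"
      unfolding prod.distrib by (subst prod.swap) (rule refl)
    also have "(\<Prod>i\<in>I. \<Prod>j\<in>J. x i powi (a j i * b j)) = laurent_monomial I ?e x"
      unfolding laurent_monomial_def by (intro prod.cong refl) (simp add: sum)
    finally show ?thesis .
  qed
  moreover have "(\<Prod>j\<in>J. s j powi b j) \<noteq> 0"
    using s0 fin(2) by simp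
  ultimately show ?thesis by blast
qed

lemma monomial_transformation_comp:
  fixes \<phi> :: "('i \<Rightarrow> 'k::field) \<Rightarrow> ('j \<Rightarrow> 'k)" and \<psi> :: "('j \<Rightarrow> 'k) \<Rightarrow> ('l \<Rightarrow> 'k)"
  assumes "finite I" "finite J" "monomial_transformation I J \<phi>" "monomial_transformation J K \<psi>"
  shows "monomial_transformation I K (\<lambda>x. \<psi> (\<phi> x))"
  unfolding monomial_transformation_def
proof (intro conjI ballI)
  fix x :: "'i \<Rightarrow> 'k" assume "x \<in> carrier (torus I)"
  then show "\<psi> (\<phi> x) \<in> carrier (torus K)"
    using assms(3,4) by (simp add: monomial_transformation_def)
next
  fix k assume "k \<in> K"
  then obtain s b where s: "s \<noteq> 0" "\<And>y. y \<in> carrier (torus J) \<Longrightarrow> \<psi> y k = s * laurent_monomial J b y"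
    using assms(4) unfolding monomial_transformation_def by blast
  obtain t e where t: "t \<noteq> 0"
    "\<And>x. x \<in> carrier (torus I) \<Longrightarrow> laurent_monomial J b (\<phi> x) = t * laurent_monomial I e x"
    using monomial_transformation_monomial[OF assms(1-3)] by blast
  show "\<exists>s a. s \<noteq> 0 \<and> (\<forall>x\<in>carrier (torus I). \<psi> (\<phi> x) k = s * laurent_monomial I a x)"
    using s t assms(3)
    by (intro exI[of _ "s * t"] exI[of _ e]) (simp add: monomial_transformation_def mult.assoc)
qed

text \<open>
  Monomials pull back to nonzero multiples of monomials. A common exponent bound exists because only
  finitely many monomials occur in \<open>f\<close>.
\<close>

lemma monomial_transformation_pullback:
  fixes \<phi> :: "('i \<Rightarrow> 'k::field) \<Rightarrow> ('j \<Rightarrow> 'k)"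
  assumes fin: "finite I" "finite J" and \<phi>: "monomial_transformation I J \<phi>"
    and f: "f \<in> laurent_span J S"
  shows "\<exists>R. (\<lambda>x. f (\<phi> x)) \<in> laurent_span I R"
proof -
  obtain c where c: "\<forall>x\<in>carrier (torus J). f x = (\<Sum>b\<in>exponent_box J S. c b * laurent_monomial J b x)"
    using f unfolding laurent_span_def by blast
  have "\<exists>R. (\<lambda>x. laurent_monomial J b (\<phi> x)) \<in> laurent_span I R" for b
  proof -
    obtain t e where t:
      "\<And>x. x \<in> carrier (torus I) \<Longrightarrow> laurent_monomial J b (\<phi> x) = t * laurent_monomial I e x"
      using monomial_transformation_monomial[OF fin \<phi>] by blast
    obtain R where "laurent_monomial I e \<in> (laurent_span I R :: (('i \<Rightarrow> 'k) \<Rightarrow> 'k) set)"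
      using laurent_monomial_in_span[OF fin(1)] by blast
    then have "(\<lambda>x. t * laurent_monomial I e x) \<in> laurent_span I R"
      by (rule laurent_span_scale)
    then have "(\<lambda>x. laurent_monomial J b (\<phi> x)) \<in> laurent_span I R"
      by (rule laurent_span_cong) (simp add: t)
    then show ?thesis by blast
  qed
  then obtain R where R: "\<And>b. (\<lambda>x. laurent_monomial J b (\<phi> x)) \<in> laurent_span I (R b)"
    by metis
  define M where "M = (\<Sum>b\<in>exponent_box J S. R b)"
  have "(\<lambda>x. laurent_monomial J b (\<phi> x)) \<in> laurent_span I M" if "b \<in> exponent_box J S" for b
    using that finite_exponent_box[OF fin(2)] unfolding M_def
    by (intro laurent_span_mono[OF fin(1) R[of b]] member_le_sum) auto
  then have "(\<lambda>x. \<Sum>b\<in>exponent_box J S. c b * laurent_monomial J b (\<phi> x)) \<in> laurent_span I M"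
    by (intro laurent_span_sum laurent_span_scale)
  then have "(\<lambda>x. f (\<phi> x)) \<in> laurent_span I M"
    using \<phi> c by (elim laurent_span_cong) (simp add: monomial_transformation_def)
  then show ?thesis by blast
qed

lemma monomial_transformation_continuous:
  fixes \<phi> :: "('i \<Rightarrow> 'k::field) \<Rightarrow> ('j \<Rightarrow> 'k)"
  assumes fin: "finite I" "finite J" and \<phi>: "monomial_transformation I J \<phi>"
  shows "continuous_map (zariski I) (zariski J) \<phi>"
  unfolding continuous_map_closedin topspace_zariski
proof (intro conjI allI impI)
  show "\<phi> \<in> carrier (torus I) \<rightarrow> carrier (torus J)"
    using \<phi> by (auto simp: monomial_transformation_def)
  fix C :: "('j \<Rightarrow> 'k) set" assume "closedin (zariski J) C"
  then obtain F where F: "F \<subseteq> laurent_functions J" "C = {x \<in> carrier (torus J). \<forall>f\<in>F. f x = 0}"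
    unfolding closedin_zariski by blast
  have "{x \<in> carrier (torus I). \<phi> x \<in> C} =
      {x \<in> carrier (torus I). \<forall>g\<in>(\<lambda>f x. f (\<phi> x)) ` F. g x = 0}"
    using \<phi> by (auto simp: F(2) monomial_transformation_def)
  also have "closedin (zariski I) \<dots>"
  proof (rule closedin_zariski_zero_locus[OF fin(1)])
    fix g assume "g \<in> (\<lambda>f x. f (\<phi> x)) ` F"
    then obtain f where f: "f \<in> F" "g = (\<lambda>x. f (\<phi> x))" by blast
    then obtain S where "f \<in> laurent_span J S"
      using F(1) laurent_functions_imp_span[OF fin(2)] by blast
    then show "\<exists>R. g \<in> laurent_span I R"
      unfolding f(2) by (rule monomial_transformation_pullback[OF fin \<phi>])
  qed
  finally show "closedin (zariski I) {x \<in> carrier (torus I). \<phi> x \<in> C}" .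
qed

section \<open>The dimension of a torus is at most its number of coordinates\<close>

text \<open>
  The ideal of an irreducible set is prime.
\<close>

lemma laurent_span_zero_irreducible:
  assumes "irreduciblein (zariski I) S" "finite I" "f \<in> laurent_span I Q" "g \<in> laurent_span I R"
    and "\<And>x. x \<in> S \<Longrightarrow> f x * g x = 0"
  shows "(\<forall>x\<in>S. f x = 0) \<or> (\<forall>x\<in>S. g x = 0)"
proof -
  let ?V = "\<lambda>f. {x \<in> carrier (torus I). f x = 0}"
  have sub: "S \<subseteq> carrier (torus I)" using assms(1) by (simp add: irreduciblein_def topspace_zariski)
  then have "S \<subseteq> ?V f \<union> ?V g" using assms(5) by auto
  with closedin_zariski_zero_locus1[OF assms(2,3)] closedin_zariski_zero_locus1[OF assms(2,4)]
  have "S \<subseteq> ?V f \<or> S \<subseteq> ?V g" by (rule irreducibleinD[OF assms(1)])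
  then show ?thesis by blast
qed

text \<open>
  A list \<open>ks\<close> of length \<open>n\<close> encodes the power product of \<open>f 0, \<dots>, f (n - 1)\<close> with exponents \<open>ks\<close>. The
  head of the list belongs to the \<^emph>\<open>last\<close> function, so that removing the head passes from a chain of
  \<open>n + 1\<close> sets to one of \<open>n\<close> sets.
\<close>

primrec power_monomial :: "(nat \<Rightarrow> 'a \<Rightarrow> 'k::comm_ring_1) \<Rightarrow> nat list \<Rightarrow> 'a \<Rightarrow> 'k" where
  "power_monomial f [] x = 1"
| "power_monomial f (k # ks) x = f (length ks) x ^ k * power_monomial f ks x"

definition exponent_lists :: "nat \<Rightarrow> nat \<Rightarrow> nat list set" where
  "exponent_lists n N = {ks. set ks \<subseteq> {..<N} \<and> length ks = n}"

lemma finite_exponent_lists: "finite (exponent_lists n N)"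
  unfolding exponent_lists_def by (intro finite_lists_length_eq) simp

lemma card_exponent_lists: "card (exponent_lists n N) = N ^ n"
  unfolding exponent_lists_def using card_lists_length_eq[of "{..<N}" n] by simp

lemma sum_exponent_lists_Suc:
  "(\<Sum>ks\<in>exponent_lists (Suc n) N. F ks) = (\<Sum>k<N. \<Sum>ks\<in>exponent_lists n N. F (k # ks))"
proof -
  have "bij_betw (\<lambda>(k, ks). k # ks) ({..<N} \<times> exponent_lists n N) (exponent_lists (Suc n) N)"
  proof (rule bij_betwI')
    fix y assume "y \<in> exponent_lists (Suc n) N"
    then obtain k ks where "y = k # ks" "(k, ks) \<in> {..<N} \<times> exponent_lists n N"
      by (cases y) (auto simp: exponent_lists_def)
    then show "\<exists>x\<in>{..<N} \<times> exponent_lists n N. y = (case x of (k, ks) \<Rightarrow> k # ks)" by force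
  qed (auto simp: exponent_lists_def)
  from sum.reindex_bij_betw[OF this, of F] show ?thesis
    by (simp add: sum.cartesian_product case_prod_beta)
qed

lemma laurent_span_power_monomial:
  assumes "finite I" "\<And>i. i < length ks \<Longrightarrow> f i \<in> laurent_span I M" "set ks \<subseteq> {..<N}"
  shows "power_monomial f ks \<in> laurent_span I (length ks * (N * M))"
  using assms(2,3)
proof (induction ks)
  case Nil
  then show ?case using laurent_span_1[OF assms(1)] by (simp add: power_monomial.simps[abs_def])
next
  case (Cons k ks)
  have "(\<lambda>x. f (length ks) x ^ k) \<in> laurent_span I (N * M)"
    using Cons.prems
    by (intro laurent_span_mono[OF assms(1) laurent_span_power[OF assms(1)]]) auto
  moreover have "power_monomial f ks \<in> laurent_span I (length ks * (N * M))"
    using Cons by simp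
  ultimately show ?case
    using laurent_span_mult[OF assms(1)] by (fastforce simp: power_monomial.simps[abs_def])
qed

text \<open>
  Restricting the relation \<open>\<Sum> g l * h ^ l = 0\<close> to \<open>S'\<close>, where \<open>h\<close> vanishes, kills all terms except
  \<open>g 0\<close>. So \<open>g 0\<close> vanishes on \<open>S'\<close>, hence on \<open>S\<close> by \<open>extend\<close>. The rest of the sum is divisible by \<open>h\<close>,
  which can be cancelled on the irreducible set \<open>S\<close>. The assumption \<open>extend\<close> is what the algebraic
  independence on the smaller set provides.
\<close>

lemma vanishing_power_sum_coefficients:
  assumes "finite I" "irreduciblein (zariski I) S" "S' \<subseteq> S"
    and h: "h \<in> laurent_span I R" "\<And>x. x \<in> S' \<Longrightarrow> h x = 0" "\<exists>x\<in>S. h x \<noteq> 0"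
    and g: "\<And>l. g l \<in> laurent_span I Q"
    and extend: "\<And>l x. (\<And>y. y \<in> S' \<Longrightarrow> g l y = 0) \<Longrightarrow> x \<in> S \<Longrightarrow> g l x = 0"
    and zero: "\<And>x. x \<in> S \<Longrightarrow> (\<Sum>l<N. g l x * h x ^ l) = 0"
    and "l < N" "x \<in> S"
  shows "g l x = 0"
  using g extend zero \<open>l < N\<close>
proof (induction N arbitrary: g l)
  case 0
  then show ?case by simp
next
  case (Suc N)
  define t where "t = (\<lambda>x. \<Sum>l<N. g (Suc l) x * h x ^ l)"
  have split: "(\<Sum>l<Suc N. g l x * h x ^ l) = g 0 x + h x * t x" for x
    by (simp only: t_def sum.lessThan_Suc_shift sum_distrib_left) (simp add: mult_ac)
  have "g 0 y = 0" if "y \<in> S'" for y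
    using Suc.prems(3)[of y, unfolded split] that assms(3) h(2)[OF that] by auto
  then have g0: "g 0 x = 0" if "x \<in> S" for x
    using Suc.prems(2) that by blast
  have "(\<lambda>x. h x ^ l) \<in> laurent_span I (N * R)" if "l < N" for l
    using that by (intro laurent_span_mono[OF assms(1) laurent_span_power[OF assms(1) h(1)]]) simp
  then have "t \<in> laurent_span I (Q + N * R)"
    unfolding t_def
    by (intro laurent_span_sum laurent_span_mult[OF assms(1) Suc.prems(1)]) simp
  moreover have "h x * t x = 0" if "x \<in> S" for x
    using Suc.prems(3)[OF that, unfolded split] g0[OF that] by simp
  ultimately have "\<forall>x\<in>S. t x = 0"
    using laurent_span_zero_irreducible[OF assms(2,1) h(1)] h(3) by blast
  then have IH: "g (Suc l) x = 0" if "l < N" for l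
    using Suc.IH[of "\<lambda>l. g (Suc l)" l] Suc.prems(1,2) that unfolding t_def by blast
  show ?case using g0[OF assms(11)] IH[of "l - 1"] Suc.prems(4) by (cases l) auto
qed

text \<open>
  A polynomial relation between \<open>f 0, \<dots>, f n\<close> on the largest set is expanded in powers of \<open>f n\<close>, which
  vanishes on the next smaller set. By the preceding lemma the coefficients of these powers are
  relations between \<open>f 0, \<dots>, f (n - 1)\<close> on that smaller set, to which induction applies.
\<close>

lemma chain_algebraically_independent:
  fixes f :: "nat \<Rightarrow> ('i \<Rightarrow> 'k::field) \<Rightarrow> 'k"
  assumes I: "finite I"
    and Z: "\<And>i. i \<le> n \<Longrightarrow> irreduciblein (zariski I) (Z i)" "\<And>i. i < n \<Longrightarrow> Z i \<subseteq> Z (Suc i)"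
    and f: "\<And>i. i < n \<Longrightarrow> f i \<in> laurent_span I M"
    and vanish: "\<And>i x. i < n \<Longrightarrow> x \<in> Z i \<Longrightarrow> f i x = 0"
    and nonvanish: "\<And>i. i < n \<Longrightarrow> \<exists>x\<in>Z (Suc i). f i x \<noteq> 0"
    and rel: "\<And>x. x \<in> Z n \<Longrightarrow> (\<Sum>ks\<in>exponent_lists n N. c ks * power_monomial f ks x) = 0"
    and ks: "ks \<in> exponent_lists n N"
  shows "c ks = 0"
  using Z f vanish nonvanish rel ks
proof (induction n arbitrary: c ks)
  case 0
  have "Z 0 \<noteq> {}" using 0(1)[of 0] by (simp add: irreduciblein_def)
  then obtain x where x: "x \<in> Z 0" by blast
  have "exponent_lists 0 N = {[]}" by (auto simp: exponent_lists_def)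
  then show ?case using 0(6)[OF x] 0(7) by simp
next
  case (Suc n)
  define g where "g k x = (\<Sum>ks\<in>exponent_lists n N. c (k # ks) * power_monomial f ks x)" for k x
  have g: "g k \<in> laurent_span I (n * (N * M))" for k
    unfolding g_def[abs_def]
  proof (intro laurent_span_sum laurent_span_scale)
    fix ks assume "ks \<in> exponent_lists n N"
    then have "length ks = n" "set ks \<subseteq> {..<N}" by (auto simp: exponent_lists_def)
    then show "power_monomial f ks \<in> laurent_span I (n * (N * M))"
      using laurent_span_power_monomial[OF I, of ks f M N] Suc.prems(3) by simp
  qed
  have IH: "c (k # ks) = 0" if "\<And>y. y \<in> Z n \<Longrightarrow> g k y = 0" "ks \<in> exponent_lists n N" for k ks
    by (rule Suc.IH[of "\<lambda>ks. c (k # ks)", OF _ _ _ _ _ _ that(2)])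
       (use Suc.prems(1-5) that(1) in \<open>simp_all add: g_def\<close>)
  have sum: "(\<Sum>l<N. g l x * f n x ^ l) = 0" if "x \<in> Z (Suc n)" for x
  proof -
    have "(\<Sum>l<N. g l x * f n x ^ l) =
        (\<Sum>l<N. \<Sum>ks\<in>exponent_lists n N. c (l # ks) * power_monomial f (l # ks) x)"
      unfolding g_def sum_distrib_right
      by (intro sum.cong refl) (auto simp: exponent_lists_def mult_ac)
    also have "\<dots> = 0"
      using Suc.prems(6)[OF that] unfolding sum_exponent_lists_Suc .
    finally show ?thesis .
  qed
  obtain k ks' where ks': "ks = k # ks'" "k < N" "ks' \<in> exponent_lists n N"
    using Suc.prems(7) by (cases ks) (auto simp: exponent_lists_def)
  have "g k y = 0" if "y \<in> Z n" for y
  proof (rule vanishing_power_sum_coefficients[where S' = "Z n" and S = "Z (Suc n)" and h = "f n"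
        and g = g and N = N])
    show "y \<in> Z (Suc n)" using that Suc.prems(2)[of n] by blast
    show "g l x = 0" if "\<And>y. y \<in> Z n \<Longrightarrow> g l y = 0" for l x
      using IH[OF that] by (simp add: g_def)
    show "irreduciblein (zariski I) (Z (Suc n))" by (rule Suc.prems(1)) simp
    show "f n \<in> laurent_span I M" by (rule Suc.prems(3)) simp
  qed (use I Suc.prems(2,4,5)[of n] g sum ks' in simp_all)
  then show ?case using IH ks' by blast
qed

text \<open>
  Gaussian elimination: an unknown that occurs in the equation \<open>y\<close> is eliminated from all others.
\<close>

lemma homogeneous_system_nontrivial_solution:
  fixes E :: "'a \<Rightarrow> 'b \<Rightarrow> 'k::field"
  assumes "finite Y" "finite X" "card Y < card X"
  shows "\<exists>c. (\<exists>x\<in>X. c x \<noteq> 0) \<and> (\<forall>y\<in>Y. (\<Sum>x\<in>X. c x * E x y) = 0)"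
  using assms
proof (induction Y arbitrary: X E)
  case empty
  then have "X \<noteq> {}" by auto
  then show ?case by (intro exI[of _ "\<lambda>_. 1"]) auto
next
  case (insert y Y)
  show ?case
  proof (cases "\<exists>p\<in>X. E p y \<noteq> 0")
    case False
    have "card Y < card X" using insert.hyps insert.prems(2) by simp
    then obtain c where "\<exists>x\<in>X. c x \<noteq> 0" "\<forall>y\<in>Y. (\<Sum>x\<in>X. c x * E x y) = 0"
      using insert.IH[OF insert.prems(1)] by blast
    then show ?thesis using False by (intro exI[of _ c]) auto
  next
    case True
    then obtain p where p: "p \<in> X" "E p y \<noteq> 0" by blast
    let ?X = "X - {p}"
    define E' where "E' x z = E x z - E x y / E p y * E p z" for x z
    have "card Y < card ?X" using insert p(1) by simp
    then obtain c where c: "\<exists>x\<in>?X. c x \<noteq> 0" "\<forall>z\<in>Y. (\<Sum>x\<in>?X. c x * E' x z) = 0"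
      using insert.IH[of ?X E'] insert.prems(1) by blast
    \<comment> \<open>The value at \<open>p\<close> solves the equation \<open>y\<close> for the eliminated unknown.\<close>
    define c' where "c' = c(p := - (\<Sum>x\<in>?X. c x * E x y) / E p y)"
    have sum: "(\<Sum>x\<in>X. c' x * E x z) = (\<Sum>x\<in>?X. c x * E' x z)" for z
    proof -
      have "(\<Sum>x\<in>X. c' x * E x z) = c' p * E p z + (\<Sum>x\<in>?X. c x * E x z)"
        unfolding sum.remove[OF insert.prems(1) p(1)]
        by (intro arg_cong2[of _ _ _ _ "(+)"] sum.cong refl) (auto simp: c'_def)
      also have "\<dots> = (\<Sum>x\<in>?X. c x * E x z) - (\<Sum>x\<in>?X. c x * E x y) / E p y * E p z"
        by (simp add: c'_def)
      also have "\<dots> = (\<Sum>x\<in>?X. c x * E' x z)"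
        unfolding E'_def right_diff_distrib sum_subtractf sum_divide_distrib sum_distrib_right
        by (simp add: mult_ac)
      finally show ?thesis .
    qed
    have "E' x y = 0" for x using p(2) by (simp add: E'_def)
    then have "\<forall>z\<in>insert y Y. (\<Sum>x\<in>X. c' x * E x z) = 0"
      using c(2) by (simp add: sum)
    moreover have "\<exists>x\<in>X. c' x \<noteq> 0" using c(1) by (auto simp: c'_def)
    ultimately show ?thesis by blast
  qed
qed

text \<open>
  The left-hand side is the number of Laurent monomials in \<open>d\<close> variables that can occur in power products of \<open>n\<close> Laurent
  polynomials with exponents at most \<open>M\<close>, each taken to a power below \<open>N\<close>. It grows like \<open>N ^ d\<close>,
  and \<open>d < n\<close>.
\<close>

lemma exists_power_exceeding_box_size:
  assumes "d < n"
  shows "\<exists>N. (2 * (n * (N * M)) + 1) ^ d < N ^ n"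
proof -
  \<comment> \<open>The number of monomials is at most \<open>(C * N) ^ d = C ^ d * N ^ d\<close>, which falls below \<open>N ^ (d + 1)\<close> once \<open>N\<close> exceeds \<open>C ^ d\<close>.\<close>
  define C where "C = 2 * (n * M) + 1"
  define N where "N = C ^ d + 1"
  have N: "N \<ge> 1" by (simp add: N_def)
  have "2 * (n * (N * M)) + 1 \<le> C * N" using N by (simp add: C_def algebra_simps)
  then have "(2 * (n * (N * M)) + 1) ^ d \<le> (C * N) ^ d" by (rule power_mono) simp
  also have "\<dots> = C ^ d * N ^ d" by (rule power_mult_distrib)
  also have "\<dots> < N * N ^ d" using N by (intro mult_strict_right_mono) (auto simp: N_def)
  also have "\<dots> = N ^ Suc d" by simp
  also have "\<dots> \<le> N ^ n" using assms N by (intro power_increasing) auto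
  finally show ?thesis by blast
qed

text \<open>
  A chain that is longer than the number of coordinates gives more algebraically independent power
  products than there are Laurent monomials to express them, and linear algebra produces a forbidden
  relation.
\<close>

theorem krull_dim_zariski_le:
  assumes I: "finite I"
  shows "krull_dim (zariski I :: ('i \<Rightarrow> 'k::field) topology) \<le> enat (card I)"
proof -
  have bound: "n \<le> card I"
    if closed: "\<And>i. i \<le> n \<Longrightarrow> closedin (zariski I) (Z i)"
      and irred: "\<And>i. i \<le> n \<Longrightarrow> irreduciblein (zariski I) (Z i)"
      and chain: "\<And>i. i < n \<Longrightarrow> Z i \<subset> Z (Suc i)" for n and Z :: "nat \<Rightarrow> ('i \<Rightarrow> 'k) set"
  proof (rule ccontr)
    assume "\<not> n \<le> card I"
    have "\<exists>f R. f \<in> laurent_span I R \<and> (\<forall>x\<in>Z i. f x = 0) \<and> (\<exists>x\<in>Z (Suc i). f x \<noteq> 0)"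
      if i: "i < n" for i
    proof -
      obtain F where F: "F \<subseteq> laurent_functions I" "Z i = {x \<in> carrier (torus I). \<forall>f\<in>F. f x = 0}"
        using closed[of i] i unfolding closedin_zariski by auto
      obtain x where x: "x \<in> Z (Suc i)" "x \<notin> Z i" using chain[OF i] by blast
      have "x \<in> carrier (torus I)"
        using x(1) closedin_subset[OF closed[of "Suc i"]] i by (auto simp: topspace_zariski)
      then obtain f where f: "f \<in> F" "f x \<noteq> 0" using x(2) F(2) by auto
      moreover obtain R where "f \<in> laurent_span I R"
        using laurent_functions_imp_span[OF I] f(1) F(1) by blast
      moreover have "\<forall>x\<in>Z i. f x = 0" using F(2) f(1) by auto
      ultimately show ?thesis using x(1) by blast
    qed
    then obtain f R where f: "\<And>i. i < n \<Longrightarrow> f i \<in> laurent_span I (R i)"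
      "\<And>i x. i < n \<Longrightarrow> x \<in> Z i \<Longrightarrow> f i x = 0" "\<And>i. i < n \<Longrightarrow> \<exists>x\<in>Z (Suc i). f i x \<noteq> 0"
      by metis
    define M where "M = (\<Sum>i<n. R i)"
    have fM: "f i \<in> laurent_span I M" if "i < n" for i
      using that unfolding M_def
      by (intro laurent_span_mono[OF I f(1)[OF that]] member_le_sum) auto
    obtain N where N: "(2 * (n * (N * M)) + 1) ^ card I < N ^ n"
      using exists_power_exceeding_box_size \<open>\<not> n \<le> card I\<close> by (metis not_le)
    let ?X = "exponent_lists n N" and ?Y = "exponent_box I (n * (N * M))"
    have "\<exists>e. \<forall>x\<in>carrier (torus I). power_monomial f ks x = (\<Sum>b\<in>?Y. e b * laurent_monomial I b x)"
      if "ks \<in> ?X" for ks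
    proof -
      have "length ks = n" "set ks \<subseteq> {..<N}" using that by (auto simp: exponent_lists_def)
      then have "power_monomial f ks \<in> laurent_span I (n * (N * M))"
        using laurent_span_power_monomial[OF I, of ks f M N] fM by simp
      then show ?thesis by (simp add: laurent_span_def)
    qed
    then obtain E where E: "\<And>ks x. ks \<in> ?X \<Longrightarrow> x \<in> carrier (torus I) \<Longrightarrow>
        power_monomial f ks x = (\<Sum>b\<in>?Y. E ks b * laurent_monomial I b x)"
      by metis
    have "card ?Y < card ?X"
      using N by (simp add: card_exponent_box[OF I] card_exponent_lists)
    from homogeneous_system_nontrivial_solution[OF finite_exponent_box[OF I] finite_exponent_lists this]
    obtain c ks where c: "ks \<in> ?X" "c ks \<noteq> 0" "\<And>b. b \<in> ?Y \<Longrightarrow> (\<Sum>ks\<in>?X. c ks * E ks b) = 0"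
      by blast
    have "(\<Sum>ks\<in>?X. c ks * power_monomial f ks x) = 0" if "x \<in> Z n" for x
    proof -
      have x: "x \<in> carrier (torus I)"
        using that closedin_subset[OF closed[of n]] by (auto simp: topspace_zariski)
      have "(\<Sum>ks\<in>?X. c ks * power_monomial f ks x) =
          (\<Sum>ks\<in>?X. \<Sum>b\<in>?Y. c ks * E ks b * laurent_monomial I b x)"
        by (intro sum.cong refl) (simp add: E x sum_distrib_left mult.assoc)
      also have "\<dots> = (\<Sum>b\<in>?Y. (\<Sum>ks\<in>?X. c ks * E ks b) * laurent_monomial I b x)"
        by (subst sum.swap) (simp add: sum_distrib_right)
      also have "\<dots> = 0" using c(3) by simp
      finally show ?thesis .
    qed
    then have "c ks = 0"
      using chain f(2,3)
      by (intro chain_algebraically_independent[where I = I and n = n and Z = Z and f = f and M = M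
            and c = c and N = N] I irred fM c(1)) blast+
    then show False using c(2) by simp
  qed
  show ?thesis
  proof (rule krull_dim_leI)
    fix n and Z :: "nat \<Rightarrow> ('i \<Rightarrow> 'k) set"
    assume "\<And>i. i \<le> n \<Longrightarrow> closedin (zariski I) (Z i)"
      "\<And>i. i \<le> n \<Longrightarrow> irreduciblein (zariski I) (Z i)" "\<And>i. i < n \<Longrightarrow> Z i \<subset> Z (Suc i)"
    from bound[where n = n and Z = Z, OF this] show "enat n \<le> enat (card I)" by simp
  qed
qed

section \<open>Tori are irreducible\<close>

text \<open>
  Multiplying by the \<open>R\<close>-th power of the product of all coordinates clears the negative exponents, and
  each coordinate is a polynomial of degree at most 1 in the parameter \<open>s\<close> of the line through \<open>a\<close> and
  \<open>b\<close>.
\<close>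

lemma laurent_span_on_line:
  fixes a b :: "'i \<Rightarrow> 'k::field"
  assumes I: "finite I" and f: "f \<in> laurent_span I R"
  shows "\<exists>p. \<forall>s. (\<lambda>i\<in>I. a i + s * (b i - a i)) \<in> carrier (torus I) \<longrightarrow>
    poly p s = f (\<lambda>i\<in>I. a i + s * (b i - a i)) * (\<Prod>i\<in>I. a i + s * (b i - a i)) ^ R"
proof -
  obtain c where c: "\<forall>x\<in>carrier (torus I). f x = (\<Sum>e\<in>exponent_box I R. c e * laurent_monomial I e x)"
    using f unfolding laurent_span_def by blast
  let ?l = "\<lambda>i. [:a i, b i - a i:]"
  let ?x = "\<lambda>s. \<lambda>i\<in>I. a i + s * (b i - a i)"
  define p where "p = (\<Sum>e\<in>exponent_box I R. smult (c e) (\<Prod>i\<in>I. ?l i ^ nat (e i + int R)))"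
  have "poly p s = f (?x s) * (\<Prod>i\<in>I. a i + s * (b i - a i)) ^ R"
    if x: "?x s \<in> carrier (torus I)" for s
  proof -
    have nz: "a i + s * (b i - a i) \<noteq> 0" if "i \<in> I" for i
      using x that by (auto simp: carrier_torus)
    have shift: "(a i + s * (b i - a i)) ^ nat (e i + int R) =
        (a i + s * (b i - a i)) powi e i * (a i + s * (b i - a i)) ^ R"
      if e: "e \<in> exponent_box I R" and i: "i \<in> I" for e i
    proof -
      have "e i + int R \<ge> 0" using exponent_box_abs_le[OF e i] by simp
      then have "(a i + s * (b i - a i)) ^ nat (e i + int R) = (a i + s * (b i - a i)) powi (e i + int R)"
        by (simp add: power_int_def)
      then show ?thesis using nz[OF i] by (simp add: power_int_add)
    qed
    have "poly p s = (\<Sum>e\<in>exponent_box I R. c e * (\<Prod>i\<in>I. (a i + s * (b i - a i)) ^ nat (e i + int R)))"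
      by (simp add: p_def poly_sum poly_prod)
    also have "\<dots> = (\<Sum>e\<in>exponent_box I R. c e * laurent_monomial I e (?x s)) *
        (\<Prod>i\<in>I. a i + s * (b i - a i)) ^ R"
      unfolding sum_distrib_right
      by (intro sum.cong refl)
         (simp add: shift prod.distrib laurent_monomial_def prod_power_distrib mult.assoc)
    also have "\<dots> = f (?x s) * (\<Prod>i\<in>I. a i + s * (b i - a i)) ^ R"
      using c x by simp
    finally show ?thesis .
  qed
  then show ?thesis by blast
qed

text \<open>
  If neither of two closed sets contained the torus, there would be Laurent polynomials \<open>f\<close> and \<open>g\<close>
  with \<open>f a \<noteq> 0\<close>, \<open>g b \<noteq> 0\<close> and \<open>f * g = 0\<close> on the torus. On the line through \<open>a\<close> and \<open>b\<close> this becomes a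
  product of nonzero polynomials in one variable that vanishes at every parameter value, which is
  impossible over an infinite field.
\<close>

theorem irreducible_torus:
  assumes I: "finite I"
  shows "irreduciblein (zariski I) (carrier (torus I) :: ('i \<Rightarrow> 'k::field_char_0) set)"
  unfolding irreduciblein_def topspace_zariski
proof (intro conjI allI impI)
  let ?T = "carrier (torus I) :: ('i \<Rightarrow> 'k) set"
  show "?T \<subseteq> ?T" by simp
  have "(\<lambda>i\<in>I. 1) \<in> ?T" by (simp add: carrier_torus)
  then show "?T \<noteq> {}" by blast
  fix C D :: "('i \<Rightarrow> 'k) set"
  assume CD: "closedin (zariski I) C \<and> closedin (zariski I) D \<and> ?T \<subseteq> C \<union> D"
  have separate: "\<exists>f R a. f \<in> laurent_span I R \<and> (\<forall>x\<in>C. f x = 0) \<and> a \<in> ?T \<and> f a \<noteq> 0"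
    if C: "closedin (zariski I) C" "\<not> ?T \<subseteq> C" for C :: "('i \<Rightarrow> 'k) set"
  proof -
    obtain F where F: "F \<subseteq> laurent_functions I" "C = {x \<in> ?T. \<forall>f\<in>F. f x = 0}"
      using C(1) unfolding closedin_zariski by blast
    obtain a where a: "a \<in> ?T" "a \<notin> C" using C(2) by blast
    then obtain f where f: "f \<in> F" "f a \<noteq> 0" using F(2) by auto
    moreover obtain R where "f \<in> laurent_span I R"
      using laurent_functions_imp_span[OF I] f(1) F(1) by blast
    moreover have "\<forall>x\<in>C. f x = 0" using F(2) f(1) by auto
    ultimately show ?thesis using a(1) by blast
  qed
  show "?T \<subseteq> C \<or> ?T \<subseteq> D"
  proof (rule ccontr)
    assume "\<not> (?T \<subseteq> C \<or> ?T \<subseteq> D)"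
    then obtain f R a g S b where
      f: "f \<in> laurent_span I R" "\<forall>x\<in>C. f x = 0" "a \<in> ?T" "f a \<noteq> 0" and
      g: "g \<in> laurent_span I S" "\<forall>x\<in>D. g x = 0" "b \<in> ?T" "g b \<noteq> 0"
      using separate[of C] separate[of D] CD by blast
    let ?x = "\<lambda>s. \<lambda>i\<in>I. a i + s * (b i - a i)"
    \<comment> \<open>The parameters at which the line leaves the torus are the zeros of \<open>h\<close>; the factor \<open>h\<close> below makes the product vanish there too.\<close>
    define h where "h = (\<Prod>i\<in>I. [:a i, b i - a i:])"
    have h: "poly h s = (\<Prod>i\<in>I. a i + s * (b i - a i))" for s
      by (simp add: h_def poly_prod)
    have h_iff: "?x s \<in> ?T \<longleftrightarrow> poly h s \<noteq> 0" for s
      using I by (auto simp: h carrier_torus)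
    obtain p where p: "\<And>s. ?x s \<in> ?T \<Longrightarrow> poly p s = f (?x s) * poly h s ^ R"
      using laurent_span_on_line[OF I f(1), of a b] unfolding h by blast
    obtain q where q: "\<And>s. ?x s \<in> ?T \<Longrightarrow> poly q s = g (?x s) * poly h s ^ S"
      using laurent_span_on_line[OF I g(1), of a b] unfolding h by blast
    have "poly (p * q * h) s = 0" for s
    proof (cases "poly h s = 0")
      case False
      then have "?x s \<in> ?T" using h_iff by blast
      then have "f (?x s) = 0 \<or> g (?x s) = 0" using f(2) g(2) CD by blast
      then show ?thesis using p q \<open>?x s \<in> ?T\<close> by auto
    qed simp
    then have "p * q * h = 0" using poly_all_0_iff_0 by blast
    \<comment> \<open>The line runs through \<open>a\<close> at parameter 0 and through \<open>b\<close> at parameter 1.\<close>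
    moreover have "?x 0 = a" "?x 1 = b"
      using f(3) g(3) by (auto simp: carrier_torus fun_eq_iff extensional_def)
    then have "poly h 0 \<noteq> 0" "poly p 0 \<noteq> 0" "poly q 1 \<noteq> 0"
      using h_iff[of 0] h_iff[of 1] p[of 0] q[of 1] f(3,4) g(3,4) by auto
    then have "h \<noteq> 0" "p \<noteq> 0" "q \<noteq> 0" by auto
    ultimately show False by simp
  qed
qed

section \<open>Monomial maps\<close>

lemma torus_mult: "x \<otimes>\<^bsub>torus I\<^esub> y = (\<lambda>i\<in>I. x i * y i)"
  by (simp add: torus_def unit_group_def)

lemma torus_one: "\<one>\<^bsub>torus I\<^esub> = (\<lambda>i\<in>I. 1)"
  by (simp add: torus_def unit_group_def)

lemma torus_mult_UNIV: "x \<otimes>\<^bsub>torus UNIV\<^esub> y = (\<lambda>i. x i * y i)"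
  by (simp add: torus_mult restrict_def)

lemma torus_one_UNIV: "\<one>\<^bsub>torus UNIV\<^esub> = (\<lambda>i. 1)"
  by (simp add: torus_one restrict_def)

lemma carrier_torus_UNIV: "x \<in> carrier (torus UNIV) \<longleftrightarrow> (\<forall>i. x i \<noteq> 0)"
  by (simp add: carrier_torus)

lemma monomial_map_carrier:
  "x \<in> carrier (torus UNIV) \<Longrightarrow> monomial_map B x \<in> carrier (torus UNIV)"
  using monomial_map_hom by (auto simp: hom_def)

lemma monomial_map_torus_mult:
  "x \<in> carrier (torus UNIV) \<Longrightarrow> y \<in> carrier (torus UNIV) \<Longrightarrow>
    monomial_map B (x \<otimes>\<^bsub>torus UNIV\<^esub> y) = monomial_map B x \<otimes>\<^bsub>torus UNIV\<^esub> monomial_map B y"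
  using monomial_map_hom[of B] by (auto simp: hom_def)

lemma monomial_map_one: "monomial_map B (\<lambda>_. 1) = (\<lambda>_. 1)"
  by (simp add: monomial_map_def)

lemma powi_sum:
  fixes x :: "'k::field"
  assumes "x \<noteq> 0"
  shows "x powi (\<Sum>j\<in>J. f j) = (\<Prod>j\<in>J. x powi f j)"
  using assms by (induction J rule: infinite_finite_induct) (simp_all add: power_int_add)

text \<open>
  This is what lets integer matrix factorizations act on binomial systems.
\<close>

lemma monomial_map_matrix_mult:
  assumes "x \<in> carrier (torus UNIV)"
  shows "monomial_map (A ** B) x = monomial_map A (monomial_map B x)"
proof
  fix i
  have nz: "x k \<noteq> 0" for k using assms by (simp add: carrier_torus)
  have "monomial_map A (monomial_map B x) i = (\<Prod>j\<in>UNIV. \<Prod>k\<in>UNIV. x k powi (B$j$k * A$i$j))"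
    by (simp add: monomial_map_def prod_powi_distrib power_int_mult)
  also have "\<dots> = (\<Prod>k\<in>UNIV. x k powi (\<Sum>j\<in>UNIV. A$i$j * B$j$k))"
    by (subst prod.swap) (simp add: powi_sum nz mult.commute)
  also have "\<dots> = monomial_map (A ** B) x i"
    by (simp add: monomial_map_def matrix_matrix_mult_def)
  finally show "monomial_map (A ** B) x i = monomial_map A (monomial_map B x) i" ..
qed

lemma monomial_map_diagonal: "monomial_map (diagonal_matrix d) x i = x i powi d i"
proof -
  have "monomial_map (diagonal_matrix d) x i = (\<Prod>j\<in>UNIV. if i = j then x j powi d j else 1)"
    unfolding monomial_map_def by (intro prod.cong) (simp_all add: diagonal_matrix_def)
  then show ?thesis by simp
qed

lemma monomial_map_mat_1: "monomial_map (mat 1) x = x"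
proof
  fix i
  have "(mat 1 :: int^'a^'a) = diagonal_matrix (\<lambda>_. 1)"
    by (simp add: mat_def diagonal_matrix_def)
  then show "monomial_map (mat 1) x i = x i" by (simp add: monomial_map_diagonal)
qed

lemma monomial_transformation_monomial_map:
  "monomial_transformation UNIV UNIV (monomial_map B)"
  unfolding monomial_transformation_def
proof (intro conjI ballI)
  fix i
  show "\<exists>s a. s \<noteq> 0 \<and> (\<forall>x\<in>carrier (torus UNIV). monomial_map B x i = s * laurent_monomial UNIV a x)"
    by (intro exI[of _ 1] exI[of _ "\<lambda>j. B$i$j"]) (simp add: monomial_map_def laurent_monomial_def)
qed (rule monomial_map_carrier)

lemma laurent_monomial_coordinate:
  assumes "finite I" "i \<in> I"
  shows "laurent_monomial I (\<lambda>j. if j = i then 1 else 0) x = x i"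
proof -
  have "laurent_monomial I (\<lambda>j. if j = i then 1 else 0) x = (\<Prod>j\<in>I. if j = i then x j else 1)"
    unfolding laurent_monomial_def by (intro prod.cong) auto
  then show ?thesis using assms by simp
qed

lemma coordinate_in_laurent_span:
  assumes "finite I" "i \<in> I"
  shows "\<exists>R. (\<lambda>x. x i) \<in> laurent_span I R"
  using laurent_monomial_in_span[OF assms(1), of "\<lambda>j. if j = i then 1 else 0"]
  unfolding laurent_monomial_coordinate[OF assms, abs_def] .

lemma monomial_transformation_regular:
  fixes \<phi> :: "('i \<Rightarrow> 'k::field) \<Rightarrow> ('j \<Rightarrow> 'k)"
  assumes "finite I" "monomial_transformation I J \<phi>" "S \<subseteq> carrier (torus I)"
  shows "regular_map_on I S J \<phi>"
  unfolding regular_map_on_def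
proof (intro conjI ballI)
  fix x assume "x \<in> S"
  then show "\<phi> x \<in> carrier (torus J)" using assms(2,3) by (auto simp: monomial_transformation_def)
next
  fix j assume "j \<in> J"
  then obtain s a where s: "\<forall>x\<in>carrier (torus I). \<phi> x j = s * laurent_monomial I a x"
    using assms(2) unfolding monomial_transformation_def by blast
  have "(\<lambda>x::'i \<Rightarrow> 'k. \<Sum>a\<in>{a}. s * (\<Prod>i\<in>I. x i powi a i)) \<in> laurent_functions I"
    by (rule laurent_functionsI) simp
  then show "\<exists>f\<in>laurent_functions I. \<forall>x\<in>S. \<phi> x j = f x"
    using s assms(3) by (intro bexI) (auto simp: laurent_monomial_def)
qed

text \<open>
  The coordinates in \<open>K\<close> are read off from \<open>s\<close> along \<open>u\<close>, the others are the constants \<open>a\<close>. The map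
  serves both to embed a smaller torus and, with all of \<open>J\<close> contained in \<open>K\<close>, to select coordinates.
\<close>

definition reindex_extend ::
    "'j set \<Rightarrow> ('j \<Rightarrow> 'i) \<Rightarrow> 'j set \<Rightarrow> ('j \<Rightarrow> 'k) \<Rightarrow> ('i \<Rightarrow> 'k) \<Rightarrow> ('j \<Rightarrow> 'k::field)" where
  "reindex_extend J u K a s = (\<lambda>j\<in>J. if j \<in> K then s (u j) else a j)"

lemma monomial_transformation_reindex_extend:
  assumes "finite I" "\<And>j. j \<in> J \<inter> K \<Longrightarrow> u j \<in> I" "\<And>j. j \<in> J - K \<Longrightarrow> a j \<noteq> 0"
  shows "monomial_transformation I J (reindex_extend J u K a)"
  unfolding monomial_transformation_def
proof (intro conjI ballI)
  fix s :: "'a \<Rightarrow> 'c" assume "s \<in> carrier (torus I)"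
  then show "reindex_extend J u K a s \<in> carrier (torus J)"
    using assms(2,3) by (auto simp: carrier_torus reindex_extend_def)
next
  fix j assume j: "j \<in> J"
  show "\<exists>s e. s \<noteq> 0 \<and> (\<forall>x\<in>carrier (torus I). reindex_extend J u K a x j = s * laurent_monomial I e x)"
  proof (cases "j \<in> K")
    case True
    then show ?thesis
      using assms(1,2) j
      by (intro exI[of _ 1] exI[of _ "\<lambda>i. if i = u j then 1 else 0"])
         (simp add: reindex_extend_def laurent_monomial_coordinate)
  next
    case False
    then show ?thesis
      using assms(3) j
      by (intro exI[of _ "a j"] exI[of _ "\<lambda>_. 0"])
         (simp add: reindex_extend_def laurent_monomial_def)
  qed
qed

section \<open>The dimension of a torus\<close>

text \<open>
  The conditions are the vanishing of the Laurent polynomials \<open>W x j - a j\<close>.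
\<close>

lemma closedin_prescribed_coordinates:
  fixes W :: "('i \<Rightarrow> 'k::field) \<Rightarrow> 'j \<Rightarrow> 'k"
  assumes "finite I" "finite J" "monomial_transformation I J W" "K \<subseteq> J"
  shows "closedin (zariski I) {x \<in> carrier (torus I). \<forall>j\<in>K. W x j = a j}"
proof -
  have "{x \<in> carrier (torus I). \<forall>j\<in>K. W x j = a j} =
      {x \<in> carrier (torus I). \<forall>f\<in>(\<lambda>j x. W x j + - a j) ` K. f x = 0}"
    by auto
  also have "closedin (zariski I) \<dots>"
  proof (rule closedin_zariski_zero_locus[OF assms(1)])
    fix f assume "f \<in> (\<lambda>j x. W x j + - a j) ` K"
    then obtain j where j: "j \<in> K" "f = (\<lambda>x. W x j + - a j)" by blast
    have "\<exists>R. (\<lambda>y :: 'j \<Rightarrow> 'k. y j) \<in> laurent_span J R"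
      using coordinate_in_laurent_span[OF assms(2)] j(1) assms(4) by blast
    then obtain R where "(\<lambda>x. W x j) \<in> laurent_span I R"
      using monomial_transformation_pullback[OF assms(1-3)] by blast
    moreover have "(\<lambda>_. - a j) \<in> laurent_span I R"
      using laurent_span_mono[OF assms(1) laurent_span_const[OF assms(1)]] by blast
    ultimately have "f \<in> laurent_span I R" unfolding j(2) by (rule laurent_span_add)
    then show "\<exists>R. f \<in> laurent_span I R" by blast
  qed
  finally show ?thesis .
qed

text \<open>
  The subtori on which the last coordinates equal 1 form a chain of length \<open>d\<close>, so the upper bound is
  attained.
\<close>

theorem krull_dim_zariski:
  "krull_dim (zariski {..<d} :: (nat \<Rightarrow> 'k::field_char_0) topology) = enat d"
proof (rule antisym)
  show "krull_dim (zariski {..<d} :: (nat \<Rightarrow> 'k) topology) \<le> enat d"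
    using krull_dim_zariski_le[of "{..<d}"] by simp
  define Z :: "nat \<Rightarrow> (nat \<Rightarrow> 'k) set" where
    "Z i = {x \<in> carrier (torus {..<d}). \<forall>j\<in>{i..<d}. x j = 1}" for i
  show "enat d \<le> krull_dim (zariski {..<d} :: (nat \<Rightarrow> 'k) topology)"
  proof (rule krull_dim_ge)
    fix i assume i: "i \<le> d"
    have "monomial_transformation {..<d} {..<d} (\<lambda>x :: nat \<Rightarrow> 'k. x)"
      unfolding monomial_transformation_def
    proof (intro conjI ballI)
      fix j assume "j \<in> {..<d}"
      then show "\<exists>s a. s \<noteq> 0 \<and> (\<forall>x\<in>carrier (torus {..<d}). (x j :: 'k) = s * laurent_monomial {..<d} a x)"
        by (intro exI[of _ 1] exI[of _ "\<lambda>i. if i = j then 1 else 0"])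
           (simp add: laurent_monomial_coordinate)
    qed
    from closedin_prescribed_coordinates[OF _ _ this, of "{i..<d}" "\<lambda>_. 1"]
    show "closedin (zariski {..<d}) (Z i)" unfolding Z_def by fastforce
    let ?e = "reindex_extend {..<d} (\<lambda>j. j) {..<i} (\<lambda>_. 1) :: (nat \<Rightarrow> 'k) \<Rightarrow> _"
    have e: "monomial_transformation {..<i} {..<d} ?e"
      by (rule monomial_transformation_reindex_extend) auto
    have "Z i = ?e ` carrier (torus {..<i})"
    proof (intro equalityI subsetI)
      fix x assume x: "x \<in> Z i"
      then have "x = ?e (restrict x {..<i})"
        by (auto simp: Z_def reindex_extend_def carrier_torus fun_eq_iff extensional_def)
      moreover have "restrict x {..<i} \<in> carrier (torus {..<i})"
        using x i by (auto simp: Z_def carrier_torus)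
      ultimately show "x \<in> ?e ` carrier (torus {..<i})" by blast
    next
      fix x assume "x \<in> ?e ` carrier (torus {..<i})"
      then show "x \<in> Z i"
        using e by (auto simp: Z_def monomial_transformation_def reindex_extend_def)
    qed
    moreover have "irreduciblein (zariski {..<d}) (?e ` carrier (torus {..<i}))"
      by (rule irreduciblein_continuous_image[OF irreducible_torus
            monomial_transformation_continuous[OF _ _ e]]) simp_all
    ultimately show "irreduciblein (zariski {..<d}) (Z i)" by simp
  next
    fix i assume i: "i < d"
    \<comment> \<open>In characteristic 0 the number 2 is a unit different from 1.\<close>
    let ?x = "\<lambda>j\<in>{..<d}. if j = i then 2 else 1 :: 'k"
    have "?x \<in> Z (Suc i)" "?x \<notin> Z i" using i by (auto simp: Z_def carrier_torus)
    moreover have "Z i \<subseteq> Z (Suc i)" by (auto simp: Z_def)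
    ultimately show "Z i \<subset> Z (Suc i)" by blast
  qed
qed


section \<open>Slices of a torus by a monomial change of coordinates\<close>

text \<open>
  The maps of \<open>W\<close> and \<open>V\<close> are mutually inverse automorphisms of the torus, and \<open>u\<close>, \<open>e\<close> are mutually inverse
  enumerations of the set \<open>J\<close> of those coordinates of \<open>monomial_map W x\<close> that are allowed to vary.
\<close>

locale monomial_chart =
  fixes V W :: "int^'m^'m" and J :: "'m set" and u :: "'m \<Rightarrow> nat" and e :: "nat \<Rightarrow> 'm" and d :: nat
  assumes VW: "V ** W = mat 1" and WV: "W ** V = mat 1"
    and u: "\<And>j. j \<in> J \<Longrightarrow> u j < d" "\<And>j. j \<in> J \<Longrightarrow> e (u j) = j"
    and e: "\<And>k. k < d \<Longrightarrow> e k \<in> J" "\<And>k. k < d \<Longrightarrow> u (e k) = k"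
begin

lemma monomial_map_VW: "x \<in> carrier (torus UNIV) \<Longrightarrow> monomial_map V (monomial_map W x) = x"
  by (simp flip: monomial_map_matrix_mult add: VW monomial_map_mat_1)

lemma monomial_map_WV: "x \<in> carrier (torus UNIV) \<Longrightarrow> monomial_map W (monomial_map V x) = x"
  by (simp flip: monomial_map_matrix_mult add: WV monomial_map_mat_1)

definition slice :: "('m \<Rightarrow> 'k::field) \<Rightarrow> ('m \<Rightarrow> 'k) set" where
  "slice a = {x \<in> carrier (torus UNIV). \<forall>j\<in>- J. monomial_map W x j = a j}"

definition param :: "('m \<Rightarrow> 'k::field) \<Rightarrow> (nat \<Rightarrow> 'k) \<Rightarrow> ('m \<Rightarrow> 'k)" where
  "param a s = monomial_map V (reindex_extend UNIV u J a s)"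

definition coords :: "('m \<Rightarrow> 'k::field) \<Rightarrow> (nat \<Rightarrow> 'k)" where
  "coords x = reindex_extend {..<d} e UNIV (\<lambda>_. 1) (monomial_map W x)"

lemma reindex_extend_carrier:
  assumes "s \<in> carrier (torus {..<d})" "\<And>j. j \<notin> J \<Longrightarrow> a j \<noteq> 0"
  shows "reindex_extend UNIV u J a s \<in> carrier (torus UNIV)"
  using assms u(1) by (auto simp: carrier_torus reindex_extend_def)

lemma monomial_transformation_param:
  assumes "\<And>j. j \<notin> J \<Longrightarrow> a j \<noteq> 0"
  shows "monomial_transformation {..<d} UNIV (param a)"
proof -
  have "monomial_transformation {..<d} UNIV (reindex_extend UNIV u J a)"
    using u(1) assms by (intro monomial_transformation_reindex_extend) auto
  from monomial_transformation_comp[OF _ _ this monomial_transformation_monomial_map]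
  show ?thesis by (simp add: param_def[abs_def])
qed

lemma monomial_transformation_coords: "monomial_transformation UNIV {..<d} coords"
proof -
  have "monomial_transformation UNIV {..<d} (reindex_extend {..<d} e UNIV (\<lambda>_. 1))"
    by (intro monomial_transformation_reindex_extend) auto
  from monomial_transformation_comp[OF _ _ monomial_transformation_monomial_map this]
  show ?thesis by (simp add: coords_def[abs_def])
qed

lemma param_in_slice:
  assumes "s \<in> carrier (torus {..<d})" "\<And>j. j \<notin> J \<Longrightarrow> a j \<noteq> 0"
  shows "param a s \<in> slice a"
  using reindex_extend_carrier[OF assms]
  by (simp add: slice_def param_def monomial_map_WV monomial_map_carrier) (simp add: reindex_extend_def)

lemma coords_param:
  assumes "s \<in> carrier (torus {..<d})" "\<And>j. j \<notin> J \<Longrightarrow> a j \<noteq> 0"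
  shows "coords (param a s) = s"
proof -
  have "coords (param a s) = reindex_extend {..<d} e UNIV (\<lambda>_. 1) (reindex_extend UNIV u J a s)"
    by (simp add: coords_def param_def monomial_map_WV reindex_extend_carrier[OF assms])
  also have "\<dots> = s"
    using e assms(1) by (auto simp: reindex_extend_def carrier_torus fun_eq_iff extensional_def)
  finally show ?thesis .
qed

lemma param_coords:
  assumes "x \<in> slice a"
  shows "param a (coords x) = x"
proof -
  have "reindex_extend UNIV u J a (coords x) = monomial_map W x"
    using assms u by (auto simp: fun_eq_iff reindex_extend_def coords_def slice_def)
  then show ?thesis using assms by (simp add: param_def slice_def monomial_map_VW)
qed

text \<open>
  The homeomorphism transports dimension and irreducibility from tori to slices.
\<close>

lemma homeomorphic_maps_slice:
  assumes "\<And>j. j \<notin> J \<Longrightarrow> a j \<noteq> 0"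
  shows "homeomorphic_maps (zariski {..<d}) (subtopology (zariski UNIV) (slice a)) (param a) coords"
  unfolding homeomorphic_maps_def
proof (intro conjI ballI)
  have "continuous_map (zariski {..<d}) (zariski UNIV) (param a)"
    by (rule monomial_transformation_continuous[OF _ _ monomial_transformation_param[OF assms]]) auto
  then show "continuous_map (zariski {..<d}) (subtopology (zariski UNIV) (slice a)) (param a)"
    using param_in_slice[OF _ assms]
    by (auto simp: continuous_map_in_subtopology topspace_zariski)
  show "continuous_map (subtopology (zariski UNIV) (slice a)) (zariski {..<d}) coords"
    by (intro continuous_map_from_subtopology
        monomial_transformation_continuous[OF _ _ monomial_transformation_coords]) auto
qed (auto simp: topspace_zariski coords_param[OF _ assms] param_coords)

lemma closedin_slice: "closedin (zariski UNIV) (slice a)"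
  unfolding slice_def
  by (rule closedin_prescribed_coordinates[OF _ _ monomial_transformation_monomial_map]) auto

lemma slice_eq_image_param:
  assumes "\<And>j. j \<notin> J \<Longrightarrow> a j \<noteq> 0"
  shows "slice a = param a ` carrier (torus {..<d})"
proof (intro equalityI subsetI)
  fix x assume x: "x \<in> slice a"
  then have "x \<in> carrier (torus UNIV)" by (simp add: slice_def)
  then have "coords x \<in> carrier (torus {..<d})"
    using monomial_transformation_coords by (auto simp: monomial_transformation_def)
  then show "x \<in> param a ` carrier (torus {..<d})" using param_coords[OF x] by force
qed (use param_in_slice[OF _ assms] in auto)

lemma irreducible_slice:
  fixes a :: "'m \<Rightarrow> 'k::field_char_0"
  assumes "\<And>j. j \<notin> J \<Longrightarrow> a j \<noteq> 0"
  shows "irreduciblein (zariski UNIV) (slice a)"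
proof -
  have "continuous_map (zariski {..<d}) (zariski UNIV) (param a)"
    by (rule monomial_transformation_continuous[OF _ _ monomial_transformation_param]) (use assms in auto)
  then have "irreduciblein (zariski UNIV) (param a ` carrier (torus {..<d}))"
    by (rule irreduciblein_continuous_image[OF irreducible_torus, rotated]) simp
  then show ?thesis using slice_eq_image_param[of a] assms by simp
qed

text \<open>
  The slices are finitely many irreducible closed sets that cover \<open>S\<close>, so every irreducible component is
  one of them.
\<close>

lemma pure_dimensional_union_of_slices:
  fixes A :: "('m \<Rightarrow> 'k::field_char_0) set"
  assumes "finite A" "\<And>a j. a \<in> A \<Longrightarrow> j \<notin> J \<Longrightarrow> a j \<noteq> 0" "S = (\<Union>a\<in>A. slice a)"
  shows "pure_dimensional (subtopology (zariski UNIV) S) d"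
  unfolding pure_dimensional_def
proof
  let ?X = "subtopology (zariski UNIV) S"
  have sub: "slice a \<subseteq> S" if "a \<in> A" for a using that assms(3) by blast
  have "S \<subseteq> carrier (torus UNIV)" using assms(3) by (auto simp: slice_def)
  then have top: "topspace ?X = \<Union>(slice ` A)" using assms(3) by (auto simp: topspace_zariski)
  have cl: "closedin ?X C" if C: "C \<in> slice ` A" for C
  proof -
    obtain a where "a \<in> A" "C = slice a" using C by blast
    then show ?thesis using sub closedin_slice[of a] by (auto simp: closedin_subtopology)
  qed
  have irr: "irreduciblein ?X C" if C: "C \<in> slice ` A" for C
  proof -
    obtain a where "a \<in> A" "C = slice a" using C by blast
    then show ?thesis using sub irreducible_slice[of a] assms(2) by (simp add: irreduciblein_subtopology)
  qed
  fix Z assume "Z \<in> irreducible_components_of ?X"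
  then obtain a where a: "a \<in> A" "Z = slice a"
    using irreducible_components_subset_finite_cover[OF finite_imageI[OF assms(1)] top cl irr] by blast
  have "subtopology ?X Z = subtopology (zariski UNIV) (slice a)"
    using sub[OF a(1)] a(2) by (simp add: subtopology_subtopology inf.absorb2)
  then show "krull_dim (subtopology ?X Z) = enat d"
    using homeomorphic_maps_krull_dim[OF homeomorphic_maps_slice[of a]] assms(2)[OF a(1)]
      krull_dim_zariski[where 'k = 'k, of d] by simp
qed

text \<open>
  Distinct slices are disjoint, since a slice is determined by the fixed coordinates of any of its
  points.
\<close>

lemma connected_component_union_of_slices:
  fixes A :: "('m \<Rightarrow> 'k::field_char_0) set"
  assumes "finite A" "\<And>a j. a \<in> A \<Longrightarrow> j \<notin> J \<Longrightarrow> a j \<noteq> 0" "S = (\<Union>a\<in>A. slice a)"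
    and "a \<in> A" "x \<in> slice a"
  shows "connected_component_of_set (subtopology (zariski UNIV) S) x = slice a"
proof (rule connected_component_of_finite_partition[where \<C> = "slice ` A"])
  let ?X = "subtopology (zariski UNIV) S"
  show "finite (slice ` A)" using assms(1) by simp
  have "S \<subseteq> carrier (torus UNIV)" using assms(3) by (auto simp: slice_def)
  then show "topspace ?X = \<Union>(slice ` A)" using assms(3) by (auto simp: topspace_zariski)
  show "disjoint (slice ` A)"
    unfolding disjoint_def
  proof (intro ballI impI, elim imageE)
    fix C D a b assume CD: "C \<noteq> D" "C = slice a" "D = slice b"
    have "slice a = slice b" if "x \<in> slice a" "x \<in> slice b" for x
      using that unfolding slice_def by auto
    then show "C \<inter> D = {}" using CD by blast
  qed
  show "closedin ?X C" if C: "C \<in> slice ` A" for C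
  proof -
    obtain a where "a \<in> A" "C = slice a" using C by blast
    then show ?thesis using assms(3) closedin_slice[of a] by (auto simp: closedin_subtopology)
  qed
  have "irreduciblein ?X (slice a)"
    using assms(3,4) irreducible_slice[of a] assms(2) by (auto simp: irreduciblein_subtopology)
  then show "connectedin ?X (slice a)" by (rule irreduciblein_imp_connectedin)
qed (use assms(4,5) in auto)

lemma reindex_extend_torus_mult:
  "reindex_extend UNIV u J (\<lambda>_. 1) (s \<otimes>\<^bsub>torus {..<d}\<^esub> t) =
   reindex_extend UNIV u J (\<lambda>_. 1) s \<otimes>\<^bsub>torus UNIV\<^esub> reindex_extend UNIV u J (\<lambda>_. 1) t"
  using u(1) by (auto simp: fun_eq_iff reindex_extend_def torus_mult)

lemma param_1_mult:
  assumes "s \<in> carrier (torus {..<d})" "t \<in> carrier (torus {..<d})"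
  shows "param (\<lambda>_. 1) (s \<otimes>\<^bsub>torus {..<d}\<^esub> t) = param (\<lambda>_. 1) s \<otimes>\<^bsub>torus UNIV\<^esub> param (\<lambda>_. 1) t"
  unfolding param_def reindex_extend_torus_mult
  using assms by (intro monomial_map_torus_mult reindex_extend_carrier) auto

lemma subgroup_slice_1: "subgroup (slice (\<lambda>_. 1 :: 'k::field)) (torus UNIV)"
proof (rule group.subgroupI[OF group_torus])
  show "slice (\<lambda>_. 1) \<subseteq> carrier (torus UNIV)" by (auto simp: slice_def)
  show "slice (\<lambda>_. 1 :: 'k) \<noteq> {}"
    unfolding slice_eq_image_param[of "\<lambda>_. 1 :: 'k", simplified]
    using group.subgroup_self[OF group_torus] subgroup.one_closed by blast
next
  fix x :: "'m \<Rightarrow> 'k" assume x: "x \<in> slice (\<lambda>_. 1)"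
  let ?x = "inv\<^bsub>torus UNIV\<^esub> x"
  have c: "x \<in> carrier (torus UNIV)" using x by (simp add: slice_def)
  then have i: "?x \<in> carrier (torus UNIV)" "?x \<otimes>\<^bsub>torus UNIV\<^esub> x = \<one>\<^bsub>torus UNIV\<^esub>"
    by (simp_all add: group.inv_closed[OF group_torus] group.l_inv[OF group_torus])
  have "monomial_map W (?x \<otimes>\<^bsub>torus UNIV\<^esub> x) = (\<lambda>_. 1)"
    unfolding i(2) by (simp add: torus_one_UNIV monomial_map_one)
  then have "monomial_map W ?x j * monomial_map W x j = 1" for j
    unfolding monomial_map_torus_mult[OF i(1) c] by (simp add: torus_mult_UNIV fun_eq_iff)
  then show "?x \<in> slice (\<lambda>_. 1)" using x i(1) by (simp add: slice_def) (metis mult.right_neutral)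
next
  fix x y :: "'m \<Rightarrow> 'k" assume xy: "x \<in> slice (\<lambda>_. 1)" "y \<in> slice (\<lambda>_. 1)"
  then have c: "x \<in> carrier (torus UNIV)" "y \<in> carrier (torus UNIV)" by (simp_all add: slice_def)
  then have "x \<otimes>\<^bsub>torus UNIV\<^esub> y \<in> carrier (torus UNIV)"
    by (simp add: carrier_torus_UNIV torus_mult_UNIV)
  then show "x \<otimes>\<^bsub>torus UNIV\<^esub> y \<in> slice (\<lambda>_. 1)"
    using xy by (simp add: slice_def monomial_map_torus_mult[OF c]) (simp add: torus_mult_UNIV)
qed

lemma algebraic_group_iso_param:
  "algebraic_group_iso {..<d} (carrier (torus {..<d})) UNIV (slice (\<lambda>_. 1 :: 'k::field)) (param (\<lambda>_. 1))"
  unfolding algebraic_group_iso_def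
proof (intro conjI)
  let ?\<gamma> = "param (\<lambda>_. 1 :: 'k)" and ?T = "carrier (torus {..<d}) :: (nat \<Rightarrow> 'k) set"
  have inj: "inj_on ?\<gamma> ?T"
    by (rule inj_on_inverseI[of _ coords]) (simp add: coords_param)
  have img: "?\<gamma> ` ?T = slice (\<lambda>_. 1)" using slice_eq_image_param[of "\<lambda>_. 1 :: 'k"] by simp
  show "?\<gamma> \<in> iso (torus {..<d}\<lparr>carrier := ?T\<rparr>) (torus UNIV\<lparr>carrier := slice (\<lambda>_. 1)\<rparr>)"
    unfolding iso_def hom_def bij_betw_def using inj img by (auto simp: param_1_mult)
  show "regular_map_on {..<d} ?T UNIV ?\<gamma>"
    by (rule monomial_transformation_regular[OF _ monomial_transformation_param]) auto
  have "regular_map_on UNIV (slice (\<lambda>_. 1)) {..<d} (coords :: ('m \<Rightarrow> 'k) \<Rightarrow> _)"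
    by (rule monomial_transformation_regular[OF _ monomial_transformation_coords])
       (auto simp: slice_def)
  moreover have "inv_into ?T ?\<gamma> x = coords x" if "x \<in> slice (\<lambda>_. 1)" for x
  proof -
    have "x \<in> ?\<gamma> ` ?T" using that img by simp
    then obtain s where s: "x = ?\<gamma> s" "s \<in> ?T" by (rule imageE)
    then show ?thesis by (simp add: coords_param inv_into_f_f[OF inj])
  qed
  ultimately show "regular_map_on UNIV (slice (\<lambda>_. 1)) {..<d} (inv_into ?T ?\<gamma>)"
    by (simp add: regular_map_on_def)
qed

lemma algebraic_subtorus_slice:
  "algebraic_subtorus UNIV d (slice (\<lambda>_. 1 :: 'k::field))"
  unfolding algebraic_subtorus_def
  using subgroup_slice_1 closedin_slice algebraic_group_iso_param by blast

end

section \<open>Torsors under the kernel of a monomial map\<close>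

lemma (in group) torsor_subgroup_coset:
  assumes H: "subgroup H G" and x0: "x0 \<in> carrier G" and E: "E = H #> x0"
  shows "torsor (G\<lparr>carrier := H\<rparr>) E (\<lambda>g. \<lambda>x\<in>E. g \<otimes> x)"
  unfolding torsor_def
proof (intro conjI ballI)
  have H_carrier: "h \<in> carrier G" if "h \<in> H" for h using that subgroup.mem_carrier[OF H] by blast
  have E_mem: "x \<in> E \<longleftrightarrow> (\<exists>h\<in>H. x = h \<otimes> x0)" for x by (auto simp: E r_coset_def)
  then have E_carrier: "x \<in> carrier G" if "x \<in> E" for x using that H_carrier x0 by auto
  have act: "h \<otimes> x \<in> E" if "h \<in> H" "x \<in> E" for h x
    using that E_mem subgroup.m_closed[OF H] H_carrier x0 by (metis m_assoc)
  have bij: "bij_betw (\<lambda>x. h \<otimes> x) E E" if h: "h \<in> H" for h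
  proof (rule bij_betwI[where g = "\<lambda>x. inv h \<otimes> x"])
    have ih: "inv h \<in> H" using subgroup.m_inv_closed[OF H h] .
    show "(\<lambda>x. h \<otimes> x) \<in> E \<rightarrow> E" "(\<lambda>x. inv h \<otimes> x) \<in> E \<rightarrow> E" using act h ih by auto
    show "inv h \<otimes> (h \<otimes> x) = x" "h \<otimes> (inv h \<otimes> x) = x" if "x \<in> E" for x
      using E_carrier[OF that] H_carrier[OF h] by (simp_all flip: m_assoc)
  qed
  then have Bij: "(\<lambda>x\<in>E. h \<otimes> x) \<in> Bij E" if "h \<in> H" for h
    using that by (simp add: Bij_def cong: bij_betw_cong)
  show "group_action (G\<lparr>carrier := H\<rparr>) E (\<lambda>g. \<lambda>x\<in>E. g \<otimes> x)"
    unfolding group_action_def group_hom_def group_hom_axioms_def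
  proof (intro conjI)
    show "group (G\<lparr>carrier := H\<rparr>)" using H by (rule subgroup_imp_group)
    show "group (BijGroup E)" by (rule group_BijGroup)
    show "(\<lambda>g. \<lambda>x\<in>E. g \<otimes> x) \<in> hom (G\<lparr>carrier := H\<rparr>) (BijGroup E)"
    proof (rule homI)
      fix h k assume "h \<in> carrier (G\<lparr>carrier := H\<rparr>)" "k \<in> carrier (G\<lparr>carrier := H\<rparr>)"
      then have hk: "h \<in> H" "k \<in> H" by simp_all
      then show "(\<lambda>x\<in>E. (h \<otimes>\<^bsub>G\<lparr>carrier := H\<rparr>\<^esub> k) \<otimes> x) =
          (\<lambda>x\<in>E. h \<otimes> x) \<otimes>\<^bsub>BijGroup E\<^esub> (\<lambda>x\<in>E. k \<otimes> x)"
        using Bij act E_carrier H_carrier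
        by (auto simp: BijGroup_def compose_def m_assoc intro!: restrict_ext)
    qed (simp add: BijGroup_def Bij)
  qed
  have "\<one> \<otimes> x0 \<in> E" using subgroup.one_closed[OF H] E_mem by blast
  then show "E \<noteq> {}" by blast
  fix x y assume xy: "x \<in> E" "y \<in> E"
  then obtain h k where hk: "h \<in> H" "k \<in> H" "x = h \<otimes> x0" "y = k \<otimes> x0" using E_mem by blast
  have c: "h \<in> carrier G" "k \<in> carrier G" "x \<in> carrier G" "y \<in> carrier G"
    using hk H_carrier xy E_carrier by auto
  show "\<exists>!g. g \<in> carrier (G\<lparr>carrier := H\<rparr>) \<and> (\<lambda>x\<in>E. g \<otimes> x) x = y"
  proof (rule ex1I[of _ "k \<otimes> inv h"])
    have "k \<otimes> inv h \<in> H" using subgroup.m_closed[OF H] subgroup.m_inv_closed[OF H] hk by blast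
    moreover have "(k \<otimes> inv h) \<otimes> x = y" using c x0 hk(3,4) by (metis inv_solve_left m_assoc inv_closed m_closed)
    ultimately show "k \<otimes> inv h \<in> carrier (G\<lparr>carrier := H\<rparr>) \<and> (\<lambda>x\<in>E. (k \<otimes> inv h) \<otimes> x) x = y"
      using xy by simp
  next
    fix g assume "g \<in> carrier (G\<lparr>carrier := H\<rparr>) \<and> (\<lambda>x\<in>E. g \<otimes> x) x = y"
    then have g: "g \<in> carrier G" "g \<otimes> x = y" using xy H_carrier by auto
    then have "(g \<otimes> h) \<otimes> x0 = k \<otimes> x0" using hk c x0 by (simp add: m_assoc)
    then have "g \<otimes> h = k" using g c x0 by simp
    then show "g = k \<otimes> inv h" using g(1) c by (metis inv_solve_right)
  qed
qed

text \<open>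
  Used to pass from the kernel to an isomorphic product of groups.
\<close>

lemma torsor_iso:
  assumes T: "torsor H E \<phi>" and h: "h \<in> iso G H" and G: "group G"
  shows "torsor G E (\<lambda>g. \<phi> (h g))"
  unfolding torsor_def
proof (intro conjI ballI)
  have hom: "group_hom H (BijGroup E) \<phi>" using T by (simp add: torsor_def group_action_def)
  then have "\<phi> \<in> hom H (BijGroup E)" "group (BijGroup E)"
    by (auto simp: group_hom_def group_hom_axioms_def)
  moreover have "h \<in> hom G H" using h by (simp add: iso_def)
  ultimately have "\<phi> \<circ> h \<in> hom G (BijGroup E)" using hom_compose by blast
  then show "group_action G E (\<lambda>g. \<phi> (h g))"
    using G \<open>group (BijGroup E)\<close>
    by (simp add: group_action_def group_hom_def group_hom_axioms_def o_def)
  show "E \<noteq> {}" using T by (simp add: torsor_def)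
  fix x y assume "x \<in> E" "y \<in> E"
  then have ex1: "\<exists>!k. k \<in> carrier H \<and> \<phi> k x = y" using T by (simp add: torsor_def)
  have bij: "bij_betw h (carrier G) (carrier H)" using h by (simp add: iso_def)
  obtain k where k: "k \<in> carrier H" "\<phi> k x = y" using ex1 by blast
  obtain g where g: "g \<in> carrier G" "h g = k" using k(1) bij by (metis bij_betw_iff_bijections)
  show "\<exists>!g. g \<in> carrier G \<and> \<phi> (h g) x = y"
  proof (rule ex1I[of _ g])
    show "g \<in> carrier G \<and> \<phi> (h g) x = y" using g k by simp
    fix g' assume g': "g' \<in> carrier G \<and> \<phi> (h g') x = y"
    then have "h g' \<in> carrier H" using bij bij_betwE by blast
    then have "h g' = h g" using g' k g ex1 by blast
    then show "g' = g" using bij g(1) g' by (meson bij_betw_imp_inj_on inj_onD)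
  qed
qed

lemma torsor_card_eq:
  assumes "torsor G E \<phi>" shows "card E = card (carrier G)"
proof -
  obtain x where x: "x \<in> E" using assms by (auto simp: torsor_def)
  have act: "group_action G E \<phi>" using assms by (simp add: torsor_def)
  have ex1: "\<exists>!g. g \<in> carrier G \<and> \<phi> g x = y" if "y \<in> E" for y
    using assms x that by (simp add: torsor_def)
  have mem: "\<phi> g x \<in> E" if "g \<in> carrier G" for g
    using group_action.element_image[OF act that x] by blast
  have "bij_betw (\<lambda>g. \<phi> g x) (carrier G) E"
    unfolding bij_betw_def
  proof
    show "inj_on (\<lambda>g. \<phi> g x) (carrier G)"
      using ex1 mem by (intro inj_onI) blast
    show "(\<lambda>g. \<phi> g x) ` carrier G = E"
      using ex1 mem by blast
  qed
  then show ?thesis using bij_betw_same_card by metis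
qed

lemma subgroup_monomial_kernel: "subgroup (monomial_kernel B :: ('m::finite \<Rightarrow> 'k::field) set) (torus UNIV)"
proof -
  interpret group_hom "torus UNIV :: ('m \<Rightarrow> 'k) monoid" "torus UNIV" "monomial_map B"
    using monomial_map_hom by (simp add: group_hom_def group_hom_axioms_def group_torus)
  show ?thesis unfolding monomial_kernel_def by (rule subgroup_kernel)
qed

lemma monomial_kernel_eq_solution_set: "monomial_kernel B = solution_set B (\<lambda>_. 1)"
  by (simp add: monomial_kernel_def kernel_def solution_set_def torus_one_UNIV)

lemma torus_inv_UNIV:
  fixes x :: "'m \<Rightarrow> 'k::field"
  assumes "x \<in> carrier (torus UNIV)"
  shows "inv\<^bsub>torus UNIV\<^esub> x = (\<lambda>i. inverse (x i))"
  using assms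
  by (intro group.inv_equality[OF group_torus])
     (auto simp: torus_mult_UNIV torus_one_UNIV carrier_torus_UNIV)

text \<open>
  The quotient of two solutions lies in the kernel.
\<close>

lemma solution_set_eq_coset:
  fixes x0 :: "'m::finite \<Rightarrow> 'k::field"
  assumes x0: "x0 \<in> solution_set B c"
  shows "solution_set B c = monomial_kernel B #>\<^bsub>torus UNIV\<^esub> x0"
proof (intro equalityI subsetI)
  have c0: "x0 \<in> carrier (torus UNIV)" "monomial_map B x0 = c" using x0 by (auto simp: solution_set_def)
  fix x :: "'m \<Rightarrow> 'k"
  {
    assume "x \<in> solution_set B c"
    then have x: "x \<in> carrier (torus UNIV)" "monomial_map B x = c" by (auto simp: solution_set_def)
    let ?h = "\<lambda>i. x i / x0 i"
    have h: "?h \<in> carrier (torus UNIV)" using x(1) c0(1) by (simp add: carrier_torus_UNIV)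
    have eq: "x = ?h \<otimes>\<^bsub>torus UNIV\<^esub> x0" using c0(1) by (simp add: torus_mult_UNIV carrier_torus_UNIV)
    have nz: "c i \<noteq> 0" for i using monomial_map_carrier[OF c0(1), of B] c0(2) by (simp add: carrier_torus_UNIV)
    have "monomial_map B ?h \<otimes>\<^bsub>torus UNIV\<^esub> c = c"
      using monomial_map_torus_mult[OF h c0(1), of B] x(2) c0(2) eq by simp
    then have "monomial_map B ?h = (\<lambda>_. 1)"
      using nz by (simp add: torus_mult_UNIV fun_eq_iff)
    then show "x \<in> monomial_kernel B #>\<^bsub>torus UNIV\<^esub> x0"
      using h eq unfolding monomial_kernel_eq_solution_set r_coset_def solution_set_def by blast
  next
    assume "x \<in> monomial_kernel B #>\<^bsub>torus UNIV\<^esub> x0"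
    then obtain h where h: "h \<in> carrier (torus UNIV)" "monomial_map B h = (\<lambda>_. 1)"
      "x = h \<otimes>\<^bsub>torus UNIV\<^esub> x0"
      unfolding monomial_kernel_eq_solution_set r_coset_def solution_set_def by blast
    then have "monomial_map B x = c"
      using monomial_map_torus_mult[OF h(1) c0(1), of B] c0(2) by (simp add: torus_mult_UNIV)
    moreover have "x \<in> carrier (torus UNIV)"
      using h c0 by (simp add: torus_mult_UNIV carrier_torus_UNIV)
    ultimately show "x \<in> solution_set B c" by (simp add: solution_set_def)
  }
qed

lemma torsor_solution_set:
  fixes c :: "'m::finite \<Rightarrow> 'k::field"
  assumes "solution_set B c \<noteq> {}"
  shows "torsor (torus UNIV\<lparr>carrier := monomial_kernel B\<rparr>) (solution_set B c)
          (\<lambda>g. \<lambda>x\<in>solution_set B c. g \<otimes>\<^bsub>torus UNIV\<^esub> x)"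
proof -
  obtain x0 where x0: "x0 \<in> solution_set B c" using assms by blast
  then have "x0 \<in> carrier (torus UNIV)" by (simp add: solution_set_def)
  then show ?thesis
    using group.torsor_subgroup_coset[OF group_torus subgroup_monomial_kernel _ solution_set_eq_coset[OF x0]]
    by blast
qed

lemma solution_set_in_rcosets:
  fixes c :: "'m::finite \<Rightarrow> 'k::field"
  assumes "solution_set B c \<noteq> {}"
  shows "solution_set B c \<in> rcosets\<^bsub>torus UNIV\<^esub> (monomial_kernel B)"
proof -
  obtain x0 where x0: "x0 \<in> solution_set B c" using assms by blast
  then have "x0 \<in> carrier (torus UNIV)" by (simp add: solution_set_def)
  then show ?thesis
    using solution_set_eq_coset[OF x0] unfolding RCOSETS_def by blast
qed


section \<open>The kernel of a monomial map in diagonal form\<close>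

text \<open>
  For negative \<open>n\<close> the equation is the one for \<open>- n\<close> with the inverse right-hand side.
\<close>

lemma finite_powi_roots:
  fixes c :: "'k::field"
  assumes "n \<noteq> 0"
  shows "finite {z. z powi n = c}"
proof -
  have fin: "finite {z :: 'k. z ^ k = c}" if "k > 0" for k c
  proof -
    let ?p = "monom 1 k - [:c:]"
    have "coeff ?p k = 1" using that by (simp add: coeff_pCons split: nat.split)
    then have "?p \<noteq> 0" by (metis coeff_0 zero_neq_one)
    from poly_roots_finite[OF this] show ?thesis by (simp add: poly_monom)
  qed
  show ?thesis
  proof (cases "n > 0")
    case True
    then show ?thesis using fin[of "nat n" c] by (simp add: power_int_def)
  next
    case False
    have "{z. z powi n = c} \<subseteq> {z. z ^ nat (- n) = inverse c}"
      using False by (auto simp: power_int_def power_inverse)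
    then show ?thesis using fin[of "nat (- n)" "inverse c"] False assms finite_subset by fastforce
  qed
qed

text \<open>
  A factorization of \<open>B\<close> as in \<open>unimodular_diagonalization\<close>, with inverses of both outer factors: \<open>V\<close> is
  inverse to \<open>W\<close> and \<open>U'\<close> to \<open>U\<close>. The free coordinates are those with a zero diagonal entry.
\<close>

locale diagonalized_matrix = monomial_chart V W J u e d
  for V W :: "int^'m^'m" and J :: "'m set" and u :: "'m \<Rightarrow> nat" and e :: "nat \<Rightarrow> 'm" and d :: nat +
  fixes B U U' :: "int^'m^'m" and D :: "'m \<Rightarrow> int"
  assumes B_eq: "B = U ** diagonal_matrix D ** W"
    and UU': "U ** U' = mat 1" and U'U: "U' ** U = mat 1"
    and J_eq: "J = {j. D j = 0}"
begin

lemma monomial_map_B_eq_iff: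
  fixes x c :: "'m \<Rightarrow> 'k::field"
  assumes x: "x \<in> carrier (torus UNIV)" and c: "c \<in> carrier (torus UNIV)"
  shows "monomial_map B x = c \<longleftrightarrow> (\<forall>i. monomial_map W x i powi D i = monomial_map U' c i)"
proof -
  let ?y = "monomial_map (diagonal_matrix D) (monomial_map W x)"
  have y: "?y \<in> carrier (torus UNIV)" using x by (intro monomial_map_carrier)
  have "monomial_map B x = monomial_map U ?y"
    using x by (simp add: B_eq monomial_map_matrix_mult monomial_map_carrier)
  moreover have "monomial_map U ?y = c \<longleftrightarrow> ?y = monomial_map U' c"
    using y c by (metis U'U UU' monomial_map_mat_1 monomial_map_matrix_mult)
  ultimately show ?thesis by (simp add: fun_eq_iff monomial_map_diagonal)
qed

text \<open>
  The free coordinates are normalized to 1, so that different root vectors give disjoint slices.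
\<close>

definition root_vectors :: "('m \<Rightarrow> 'k::field) \<Rightarrow> ('m \<Rightarrow> 'k) set" where
  "root_vectors b = (\<Pi>\<^sub>E i\<in>UNIV. if i \<in> J then {1} else {z. z powi D i = b i})"

lemma root_vectors_iff:
  "a \<in> root_vectors b \<longleftrightarrow> (\<forall>i\<in>J. a i = 1) \<and> (\<forall>i\<in>- J. a i powi D i = b i)"
  by (auto simp: root_vectors_def PiE_iff split: if_splits)

lemma finite_root_vectors: "finite (root_vectors b)"
  unfolding root_vectors_def
  by (intro finite_PiE) (auto simp: J_eq finite_powi_roots)

lemma root_vectors_nonzero:
  assumes "a \<in> root_vectors b" "b \<in> carrier (torus UNIV)"
  shows "a i \<noteq> 0"
proof (cases "i \<in> J")
  case True
  then show ?thesis using assms(1) by (simp add: root_vectors_iff)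
next
  case False
  then have "a i powi D i = b i" using assms(1) by (simp add: root_vectors_iff)
  moreover have "b i \<noteq> 0" using assms(2) by (simp add: carrier_torus_UNIV)
  moreover have "D i \<noteq> 0" using False by (simp add: J_eq)
  ultimately show ?thesis by (auto simp: power_int_0_left_if)
qed

text \<open>
  Nonemptiness enters through the equations with \<open>D i = 0\<close>. They read \<open>1 = c' i\<close> and hold for all
  points as soon as they hold for one.
\<close>

lemma solution_set_eq_union_of_slices:
  fixes c :: "'m \<Rightarrow> 'k::field"
  assumes c: "c \<in> carrier (torus UNIV)" and ne: "solution_set B c \<noteq> {}"
  shows "solution_set B c = (\<Union>a\<in>root_vectors (monomial_map U' c). slice a)"
proof -
  let ?c = "monomial_map U' c"
  have sol: "x \<in> solution_set B c \<longleftrightarrow>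
      x \<in> carrier (torus UNIV) \<and> (\<forall>i. monomial_map W x i powi D i = ?c i)" for x
    using monomial_map_B_eq_iff[OF _ c] by (auto simp: solution_set_def)
  have c1: "?c i = 1" if "i \<in> J" for i
  proof -
    obtain x where "monomial_map W x i powi D i = ?c i" using ne sol by blast
    moreover have "D i = 0" using that by (simp add: J_eq)
    ultimately show ?thesis by simp
  qed
  show ?thesis
  proof (intro equalityI subsetI)
    fix x assume x: "x \<in> solution_set B c"
    let ?a = "\<lambda>i. if i \<in> J then 1 else monomial_map W x i"
    have "?a \<in> root_vectors ?c" "x \<in> slice ?a"
      using x sol by (auto simp: root_vectors_iff slice_def)
    then show "x \<in> (\<Union>a\<in>root_vectors ?c. slice a)" by blast
  next
    fix x assume "x \<in> (\<Union>a\<in>root_vectors ?c. slice a)"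
    then obtain a where a: "a \<in> root_vectors ?c" "x \<in> slice a" by blast
    have "monomial_map W x i powi D i = ?c i" for i
    proof (cases "i \<in> J")
      case True
      then have "D i = 0" by (simp add: J_eq)
      then show ?thesis using c1[OF True] by simp
    next
      case False
      then show ?thesis using a by (simp add: root_vectors_iff slice_def)
    qed
    then show "x \<in> solution_set B c" using a sol by (auto simp: slice_def)
  qed
qed

lemma one_in_torus: "(\<lambda>_. 1 :: 'k::field) \<in> carrier (torus (UNIV :: 'm set))"
  by (simp add: carrier_torus_UNIV)

lemma monomial_kernel_eq_union_of_slices:
  "(monomial_kernel B :: ('m \<Rightarrow> 'k::field) set) = (\<Union>a\<in>root_vectors (\<lambda>_. 1). slice a)"
proof -
  have "(\<lambda>_. 1) \<in> (solution_set B (\<lambda>_. 1) :: ('m \<Rightarrow> 'k) set)"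
    by (simp add: solution_set_def one_in_torus monomial_map_one)
  then show ?thesis
    using solution_set_eq_union_of_slices[OF one_in_torus, where 'k = 'k]
    by (auto simp: monomial_kernel_eq_solution_set monomial_map_one)
qed

text \<open>
  The elements of the kernel with free coordinates 1, in the coordinates given by \<open>W\<close>.
\<close>

definition torsion_part :: "('m \<Rightarrow> 'k::field) set" where
  "torsion_part = monomial_map V ` root_vectors (\<lambda>_. 1)"

lemma one_in_root_vectors: "(\<lambda>_. 1) \<in> root_vectors (\<lambda>_. 1)"
  by (simp add: root_vectors_iff)

lemma subgroup_root_vectors: "subgroup (root_vectors (\<lambda>_. 1 :: 'k::field)) (torus UNIV)"
proof (rule group.subgroupI[OF group_torus])
  have sub: "a \<in> carrier (torus UNIV)" if "a \<in> root_vectors (\<lambda>_. 1)" for a :: "'m \<Rightarrow> 'k"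
    using root_vectors_nonzero[OF that one_in_torus] by (simp add: carrier_torus_UNIV)
  then show "root_vectors (\<lambda>_. 1 :: 'k) \<subseteq> carrier (torus UNIV)" by blast
  show "root_vectors (\<lambda>_. 1 :: 'k) \<noteq> {}" using one_in_root_vectors by blast
  fix a b :: "'m \<Rightarrow> 'k" assume a: "a \<in> root_vectors (\<lambda>_. 1)"
  show "inv\<^bsub>torus UNIV\<^esub> a \<in> root_vectors (\<lambda>_. 1)"
    unfolding torus_inv_UNIV[OF sub[OF a]]
    using a by (simp add: root_vectors_iff power_int_inverse)
  assume "b \<in> root_vectors (\<lambda>_. 1)"
  then show "a \<otimes>\<^bsub>torus UNIV\<^esub> b \<in> root_vectors (\<lambda>_. 1)"
    using a by (simp add: root_vectors_iff torus_mult_UNIV power_int_mult_distrib)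
qed

text \<open>
  In the coordinates given by \<open>W\<close>, one factor is 1 at all free coordinates and the other at all
  remaining ones.
\<close>

lemma torsion_mult_param:
  fixes a :: "'m \<Rightarrow> 'k::field"
  assumes a: "a \<in> root_vectors (\<lambda>_. 1)" and s: "s \<in> carrier (torus {..<d})"
  shows "monomial_map V a \<otimes>\<^bsub>torus UNIV\<^esub> param (\<lambda>_. 1) s = param a s"
proof -
  have a': "a \<in> carrier (torus UNIV)"
    using root_vectors_nonzero[OF a one_in_torus] by (simp add: carrier_torus_UNIV)
  have "a \<otimes>\<^bsub>torus UNIV\<^esub> reindex_extend UNIV u J (\<lambda>_. 1) s = reindex_extend UNIV u J a s"
    using a by (auto simp: torus_mult_UNIV reindex_extend_def root_vectors_iff fun_eq_iff)
  then show ?thesis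
    unfolding param_def using monomial_map_torus_mult[OF a' reindex_extend_carrier[OF s], of "\<lambda>_. 1" V]
    by simp
qed

text \<open>
  By \<open>torsion_mult_param\<close> the product map sends \<open>(f, s)\<close> to the point with parameter \<open>s\<close> on the slice of
  \<open>f\<close>. It is bijective because the kernel is the disjoint union of these slices and each slice is
  parametrized bijectively.
\<close>

lemma kernel_decomposition:
  "(\<lambda>(f, s). f \<otimes>\<^bsub>torus UNIV\<^esub> param (\<lambda>_. 1) s) \<in>
     iso (torus UNIV\<lparr>carrier := torsion_part :: ('m \<Rightarrow> 'k::field) set\<rparr> \<times>\<times> torus {..<d})
         (torus UNIV\<lparr>carrier := monomial_kernel B\<rparr>)"
proof -
  let ?A = "root_vectors (\<lambda>_. 1 :: 'k)" and ?T = "carrier (torus {..<d}) :: (nat \<Rightarrow> 'k) set"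
  let ?G = "torus UNIV\<lparr>carrier := torsion_part :: ('m \<Rightarrow> 'k) set\<rparr> \<times>\<times> (torus {..<d} :: (nat \<Rightarrow> 'k) monoid)"
  let ?m = "\<lambda>(f, s). f \<otimes>\<^bsub>torus UNIV\<^esub> param (\<lambda>_. 1 :: 'k) s"
  have nz: "a j \<noteq> 0" if "a \<in> ?A" for a j
    using root_vectors_nonzero[OF that one_in_torus] .
  have img: "?m ` (torsion_part \<times> ?T) = monomial_kernel B"
  proof (intro equalityI subsetI)
    fix x assume "x \<in> ?m ` (torsion_part \<times> ?T)"
    then obtain a s where as: "a \<in> ?A" "s \<in> ?T" "x = monomial_map V a \<otimes>\<^bsub>torus UNIV\<^esub> param (\<lambda>_. 1) s"
      by (auto simp: torsion_part_def)
    then have "x \<in> slice a" using param_in_slice[OF as(2), of a] nz[OF as(1)] by (simp add: torsion_mult_param)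
    then show "x \<in> monomial_kernel B" using as(1) monomial_kernel_eq_union_of_slices by blast
  next
    fix x :: "'m \<Rightarrow> 'k" assume "x \<in> monomial_kernel B"
    then obtain a where a: "a \<in> ?A" "x \<in> slice a" using monomial_kernel_eq_union_of_slices by blast
    then obtain s where s: "s \<in> ?T" "x = param a s" using slice_eq_image_param[of a] nz by blast
    then have "x = ?m (monomial_map V a, s)" using a by (simp add: torsion_mult_param)
    then show "x \<in> ?m ` (torsion_part \<times> ?T)" using a(1) s(1) unfolding torsion_part_def by blast
  qed
  have inj: "inj_on ?m (torsion_part \<times> ?T)"
  proof (rule inj_onI, clarify)
    fix f s f' s'
    assume "f \<in> torsion_part" "f' \<in> torsion_part" and s: "s \<in> ?T" "s' \<in> ?T"
      and eq: "f \<otimes>\<^bsub>torus UNIV\<^esub> param (\<lambda>_. 1) s = f' \<otimes>\<^bsub>torus UNIV\<^esub> param (\<lambda>_. 1) s'"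
    then obtain a a' where a: "a \<in> ?A" "f = monomial_map V a" and a': "a' \<in> ?A" "f' = monomial_map V a'"
      unfolding torsion_part_def by blast
    have p: "param a s = param a' s'" using eq s a a' by (simp add: torsion_mult_param)
    then have "s = s'" using coords_param[OF s(1), of a] coords_param[OF s(2), of a'] nz a(1) a'(1) by metis
    moreover have "a j = a' j" for j
    proof (cases "j \<in> J")
      case False
      have "param a s \<in> slice a" "param a' s' \<in> slice a'"
        using param_in_slice[OF s(1), of a] param_in_slice[OF s(2), of a'] nz a(1) a'(1) by simp_all
      then show ?thesis using p False by (simp add: slice_def)
    qed (use a(1) a'(1) in \<open>simp add: root_vectors_iff\<close>)
    ultimately show "f = f' \<and> s = s'" using a(2) a'(2) by (simp add: fun_eq_iff ext[of a a'])
  qed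
  show ?thesis
    unfolding iso_def
  proof (intro CollectI conjI homI)
    show "bij_betw ?m (carrier ?G)
        (carrier (torus UNIV\<lparr>carrier := monomial_kernel B\<rparr>))"
      using inj img by (simp add: bij_betw_def DirProd_def)
    fix p assume "p \<in> carrier ?G"
    then have "p \<in> torsion_part \<times> ?T" by (simp add: DirProd_def)
    then show "?m p \<in> carrier (torus UNIV\<lparr>carrier := monomial_kernel B\<rparr>)" using img by auto
    fix q assume "q \<in> carrier ?G"
    then have q: "q \<in> torsion_part \<times> ?T" by (simp add: DirProd_def)
    obtain f s g t where [simp]: "p = (f, s)" "q = (g, t)" by (cases p, cases q) auto
    show "?m (p \<otimes>\<^bsub>?G\<^esub> q) =
        ?m p \<otimes>\<^bsub>torus UNIV\<lparr>carrier := monomial_kernel B\<rparr>\<^esub> ?m q"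
      using q \<open>p \<in> torsion_part \<times> ?T\<close> by (simp add: param_1_mult) (simp add: torus_mult_UNIV mult_ac)
  qed
qed

lemma subgroup_torsion_part_torus: "subgroup (torsion_part :: ('m \<Rightarrow> 'k::field) set) (torus UNIV)"
proof -
  interpret group_hom "torus UNIV :: ('m \<Rightarrow> 'k) monoid" "torus UNIV" "monomial_map V"
    using monomial_map_hom by (simp add: group_hom_def group_hom_axioms_def group_torus)
  show ?thesis unfolding torsion_part_def by (rule subgroup_img_is_subgroup[OF subgroup_root_vectors])
qed

lemma torsion_part_subset_kernel: "(torsion_part :: ('m \<Rightarrow> 'k::field) set) \<subseteq> monomial_kernel B"
proof
  fix f :: "'m \<Rightarrow> 'k" assume "f \<in> torsion_part"
  then obtain a where a: "a \<in> root_vectors (\<lambda>_. 1)" "f = monomial_map V a"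
    by (auto simp: torsion_part_def)
  have "a \<in> carrier (torus UNIV)"
    using root_vectors_nonzero[OF a(1) one_in_torus] by (simp add: carrier_torus_UNIV)
  then have "f \<in> slice a" by (simp add: slice_def a(2) monomial_map_WV monomial_map_carrier)
  then show "f \<in> monomial_kernel B" using a(1) monomial_kernel_eq_union_of_slices by blast
qed

lemma subgroup_torsion_part:
  "subgroup (torsion_part :: ('m \<Rightarrow> 'k::field) set) (torus UNIV\<lparr>carrier := monomial_kernel B\<rparr>)"
  by (rule group.subgroup_incl[OF group_torus subgroup_torsion_part_torus subgroup_monomial_kernel
        torsion_part_subset_kernel])

lemma finite_torsion_part: "finite torsion_part"
  unfolding torsion_part_def using finite_root_vectors by blast

text \<open>
  The slices through the torsion elements partition the kernel into finitely many closed connected sets.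
\<close>

lemma identity_component_monomial_kernel:
  "identity_component UNIV (monomial_kernel B :: ('m \<Rightarrow> 'k::field_char_0) set) = slice (\<lambda>_. 1)"
proof -
  have one: "\<one>\<^bsub>torus UNIV\<^esub> \<in> slice (\<lambda>_. 1 :: 'k)"
    using subgroup.one_closed[OF subgroup_slice_1] .
  show ?thesis
    unfolding identity_component_def
    by (rule connected_component_union_of_slices[OF finite_root_vectors _
          monomial_kernel_eq_union_of_slices one_in_root_vectors one])
       (rule root_vectors_nonzero[OF _ one_in_torus])
qed

lemma pure_dimensional_solution_set:
  fixes c :: "'m \<Rightarrow> 'k::field_char_0"
  assumes "c \<in> carrier (torus UNIV)" "solution_set B c \<noteq> {}"
  shows "pure_dimensional (subtopology (zariski UNIV) (solution_set B c)) d"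
  by (rule pure_dimensional_union_of_slices[OF finite_root_vectors _ solution_set_eq_union_of_slices[OF assms]])
     (rule root_vectors_nonzero[OF _ monomial_map_carrier[OF assms(1)]])

lemma torsor_decomposition:
  fixes c :: "'m \<Rightarrow> 'k::field"
  assumes "solution_set B c \<noteq> {}"
  shows "torsor (torus UNIV\<lparr>carrier := torsion_part\<rparr> \<times>\<times> torus {..<d}) (solution_set B c)
    (\<lambda>(f, s). \<lambda>x\<in>solution_set B c. (f \<otimes>\<^bsub>torus UNIV\<^esub> param (\<lambda>_. 1) s) \<otimes>\<^bsub>torus UNIV\<^esub> x)"
proof -
  have "group (torus UNIV\<lparr>carrier := torsion_part :: ('m \<Rightarrow> 'k) set\<rparr> \<times>\<times> torus {..<d})"
    by (intro DirProd_group group.subgroup_imp_group[OF group_torus subgroup_torsion_part_torus] group_torus)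
  from torsor_iso[OF torsor_solution_set[OF assms] kernel_decomposition this]
  show ?thesis by (simp add: case_prod_unfold)
qed

end

section \<open>Rank, determinant, lattice index and roots of unity\<close>

definition puiseux_const :: "'a::field \<Rightarrow> 'a puiseux" where
  "puiseux_const c = puiseux_of_fls 1 (fls_const c)"

lemma puiseux_const_1: "puiseux_const 1 = 1"
  by (simp only: puiseux_const_def fls_const_1 puiseux_of_fls_one[OF zero_less_one])

lemma puiseux_const_mult: "puiseux_const (a * b) = puiseux_const a * puiseux_const b"
  by (simp only: puiseux_const_def fls_const_mult_const[symmetric] puiseux_of_fls_mult[OF zero_less_one])

lemma puiseux_const_power: "puiseux_const (c ^ n) = puiseux_const c ^ n"
  by (induction n) (simp_all add: puiseux_const_1 puiseux_const_mult)

lemma inj_puiseux_const: "inj puiseux_const"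
proof (rule injI)
  fix x y :: 'a assume "puiseux_const x = puiseux_const y"
  then have "fls_const x = fls_const y"
    unfolding puiseux_const_def by (rule puiseux_of_fls_inject[rotated]) simp
  then show "x = y" by (metis fls_const_nth)
qed

text \<open>
  The constant series provide \<open>n\<close> roots, and a polynomial of degree \<open>n\<close> has no more.
\<close>

lemma card_puiseux_roots_unity:
  assumes "n > 0"
  shows "card {z :: complex puiseux. z ^ n = 1} = n"
proof (rule antisym)
  let ?p = "monom 1 n - 1 :: complex puiseux poly"
  have "coeff ?p n = 1" using assms by simp
  then have nz: "?p \<noteq> 0" by (metis coeff_0 zero_neq_one)
  have "degree ?p \<le> n" by (intro degree_diff_le) (auto simp: degree_monom_le)
  moreover have "{z. poly ?p z = 0} = {z. z ^ n = 1}" by (simp add: poly_monom)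
  ultimately show "card {z :: complex puiseux. z ^ n = 1} \<le> n"
    using card_poly_roots_bound[OF nz] by simp
  have fin: "finite {z :: complex puiseux. z ^ n = 1}"
    using poly_roots_finite[OF nz] by (simp add: poly_monom)
  have "puiseux_const ` {z :: complex. z ^ n = 1} \<subseteq> {z. z ^ n = 1}"
    by (auto simp: puiseux_const_1 simp flip: puiseux_const_power)
  from card_mono[OF fin this] show "n \<le> card {z :: complex puiseux. z ^ n = 1}"
    using assms by (simp add: card_image[OF inj_on_subset[OF inj_puiseux_const subset_UNIV]] card_roots_unity_eq)
qed

lemma card_puiseux_powi_roots_unity:
  assumes "n \<noteq> 0"
  shows "card {z :: complex puiseux. z powi n = 1} = nat \<bar>n\<bar>"
proof -
  have "z powi n = 1 \<longleftrightarrow> z ^ nat \<bar>n\<bar> = 1" for z :: "complex puiseux"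
    by (cases "n \<ge> 0") (auto simp: power_int_def power_inverse)
  then show ?thesis using card_puiseux_roots_unity[of "nat \<bar>n\<bar>"] assms by simp
qed

text \<open>
  Over an arbitrary field, the row space is the range of the transpose.
\<close>

lemma rank_eq_dim_range_transpose:
  fixes A :: "'a::field^'n^'m"
  shows "rank A = vec.dim (range ((*v) (transpose A)))"
proof -
  let ?T = "transpose A"
  have lin: "Vector_Spaces.linear (*s) (*s) ((*v) ?T)" by (rule matrix_vector_mul_linear_gen)
  have "vec.span (columns ?T) = range ((*v) ?T)"
  proof (rule antisym)
    show "range ((*v) ?T) \<subseteq> vec.span (columns ?T)"
      using matrix_vector_mult_in_columnspace_gen by blast
    have "columns ?T \<subseteq> range ((*v) ?T)"
    proof
      fix v assume "v \<in> columns ?T"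
      then obtain i where "v = column i ?T" by (auto simp: columns_def)
      then have "v = ?T *v axis i 1" by (simp add: vec_eq_iff matrix_vector_mult_def column_def axis_def if_distrib[of "\<lambda>y. _ * y"]
            cong: if_cong del: transpose_matrix_vector)
      then show "v \<in> range ((*v) ?T)" by (rule range_eqI)
    qed
    moreover have "vec.subspace (range ((*v) ?T))"
      using vec.subspace_UNIV lin by (rule vec.linear_subspace_image[rotated])
    ultimately show "vec.span (columns ?T) \<subseteq> range ((*v) ?T)"
      by (rule vec.span_minimal)
  qed
  then show ?thesis
    unfolding row_rank_def_gen using vec.dim_span[of "columns ?T"] by simp
qed

text \<open>
  Invertible factors do not change the dimension of the range, and the range of the diagonal matrix is
  spanned by the unit vectors with nonzero diagonal entry.
\<close>

lemma rank_unimodular_mult_diagonal: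
  fixes P Q :: "'a::field^'m^'m"
  assumes P: "invertible P" and Q: "invertible Q"
  shows "rank (P ** (\<chi> i j. if i = j then D i else 0) ** Q) = card {i. D i \<noteq> 0}"
proof -
  let ?D = "(\<chi> i j. if i = j then D i else 0) :: 'a^'m^'m"
  obtain Q' where Q': "transpose Q ** Q' = mat 1" "Q' ** transpose Q = mat 1"
    using invertible_transpose[OF Q] by (auto simp: invertible_def)
  obtain P' where P': "transpose P ** P' = mat 1" "P' ** transpose P = mat 1"
    using invertible_transpose[OF P] by (auto simp: invertible_def)
  have D: "?D *v x = (\<chi> i. D i * x $ i)" for x
    by (simp add: vec_eq_iff matrix_vector_mult_def if_distrib[of "\<lambda>y. y * _"] cong: if_cong)
  have tD: "transpose ?D = ?D" by (auto simp: vec_eq_iff Finite_Cartesian_Product.transpose_def)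
  have surj: "range ((*v) (transpose P)) = UNIV"
    using P'(1) by (metis matrix_vector_mul_assoc matrix_vector_mul_lid surj_def)
  have "transpose (P ** ?D ** Q) *v x = transpose Q *v (?D *v (transpose P *v x))" for x
    by (simp only: matrix_transpose_mul tD matrix_vector_mul_assoc matrix_mul_assoc)
  then have "range ((*v) (transpose (P ** ?D ** Q))) =
      (*v) (transpose Q) ` (*v) ?D ` range ((*v) (transpose P))"
    by (auto simp: image_image)
  then have "rank (P ** ?D ** Q) = vec.dim ((*v) (transpose Q) ` range ((*v) ?D))"
    by (simp only: rank_eq_dim_range_transpose surj)
  also have "\<dots> = vec.dim (range ((*v) ?D))"
  proof (rule vec.dim_image_eq)
    show "Vector_Spaces.linear (*s) (*s) ((*v) (transpose Q))" by (rule matrix_vector_mul_linear_gen)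
    show "inj_on ((*v) (transpose Q)) (vec.span (range ((*v) ?D)))"
      using inj_matrix_vector_mult[OF invertible_transpose[OF Q]] by (rule inj_on_subset) simp
  qed
  also have "\<dots> = card {i. D i \<noteq> 0}"
  proof -
    let ?b = "\<lambda>i. axis i (1 :: 'a)"
    let ?E = "?b ` {i. D i \<noteq> 0}"
    have sub: "vec.span ?E = range ((*v) ?D)"
    proof (rule antisym)
      have "?b i \<in> range ((*v) ?D)" if "D i \<noteq> 0" for i
        using that by (intro range_eqI[of _ _ "axis i (1 / D i)"]) (unfold D, auto simp: vec_eq_iff axis_def)
      moreover have "vec.subspace (range ((*v) ?D))"
        using vec.subspace_UNIV matrix_vector_mul_linear_gen by (rule vec.linear_subspace_image[rotated])
      ultimately show "vec.span ?E \<subseteq> range ((*v) ?D)" by (intro vec.span_minimal) auto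
      have "?D *v x \<in> vec.span ?E" for x
      proof -
        have "?D *v x = (\<Sum>i\<in>{i. D i \<noteq> 0}. (D i * x $ i) *s ?b i)"
          unfolding D by (auto simp: vec_eq_iff axis_def if_distrib[of "\<lambda>y. _ * y"] cong: if_cong)
        also have "\<dots> \<in> vec.span ?E"
          by (intro vec.span_sum vec.span_scale vec.span_base) auto
        finally show ?thesis .
      qed
      then show "range ((*v) ?D) \<subseteq> vec.span ?E" by blast
    qed
    have "?E \<subseteq> cart_basis" by (auto simp: cart_basis_def)
    then have "vec.independent ?E" using independent_cart_basis vec.independent_mono by blast
    then have "vec.dim (range ((*v) ?D)) = card ?E"
      unfolding sub[symmetric] by (rule vec.dim_span_eq_card_independent)
    also have "\<dots> = card {i. D i \<noteq> 0}"
      by (intro card_image inj_onI) (metis axis_eq_axis zero_neq_one)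
    finally show ?thesis .
  qed
  finally show ?thesis .
qed

lemma rat_matrix_mult: "rat_matrix (A ** B) = rat_matrix A ** rat_matrix B"
  by (simp add: vec_eq_iff matrix_matrix_mult_def)

lemma rat_matrix_mat_1: "rat_matrix (mat 1) = mat 1"
  by (simp add: vec_eq_iff mat_def)

lemma invertible_rat_matrix: "invertible A \<Longrightarrow> invertible (rat_matrix A)"
  unfolding invertible_def by (metis rat_matrix_mult rat_matrix_mat_1)

lemma rat_matrix_diagonal:
  "rat_matrix (diagonal_matrix D) = (\<chi> i j. if i = j then rat_of_int (D i) else 0)"
  by (simp add: vec_eq_iff diagonal_matrix_def)

lemma det_unimodular:
  fixes U :: "int^'m^'m"
  assumes "invertible U" shows "\<bar>det U\<bar> = 1"
proof -
  obtain U' where "U ** U' = mat 1" using assms by (auto simp: invertible_def)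
  then have "det U * det U' = 1" by (metis det_I det_mul)
  then show ?thesis by (metis abs_zmult_eq_1 abs_1)
qed

context diagonalized_matrix
begin

lemma invertible_factors: "invertible U" "invertible W"
  using UU' U'U VW WV by (auto simp: invertible_def)

lemma d_eq_card: "d = card J"
proof -
  have "bij_betw e {..<d} J"
    by (rule bij_betwI[where g = u]) (use u e in auto)
  then show ?thesis using bij_betw_same_card by fastforce
qed

lemma rank_eq: "rank (rat_matrix B) = CARD('m) - d"
proof -
  have "rank (rat_matrix B) = card {i. D i \<noteq> 0}"
    unfolding B_eq rat_matrix_mult rat_matrix_diagonal
    using rank_unimodular_mult_diagonal[OF invertible_rat_matrix[OF invertible_factors(1)]
        invertible_rat_matrix[OF invertible_factors(2)], of "\<lambda>i. rat_of_int (D i)"] by simp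
  also have "{i. D i \<noteq> 0} = UNIV - J" by (auto simp: J_eq)
  also have "card \<dots> = CARD('m) - d" by (simp add: card_Diff_subset d_eq_card)
  finally show ?thesis .
qed

lemma d_le: "d \<le> CARD('m)"
  unfolding d_eq_card by (rule card_mono) auto

lemma full_rank_iff: "rank (rat_matrix B) = CARD('m) \<longleftrightarrow> J = {}"
proof -
  have "rank (rat_matrix B) = CARD('m) \<longleftrightarrow> d = 0"
    using d_le zero_less_card_finite[where 'a = 'm] by (auto simp: rank_eq)
  then show ?thesis by (simp add: d_eq_card)
qed

lemma abs_det_B: "\<bar>det B\<bar> = (\<Prod>i\<in>UNIV. \<bar>D i\<bar>)"
proof -
  have "det (diagonal_matrix D) = (\<Prod>i\<in>UNIV. D i)"
    by (subst det_diagonal) (auto simp: diagonal_matrix_def)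
  then show ?thesis
    using invertible_factors by (simp add: B_eq det_mul abs_mult det_unimodular abs_prod)
qed

lemma invertible_rat_matrix_iff: "invertible (rat_matrix B) \<longleftrightarrow> J = {}"
proof -
  have "det (rat_matrix (diagonal_matrix D)) = (\<Prod>i\<in>UNIV. rat_of_int (D i))"
    unfolding rat_matrix_diagonal by (subst det_diagonal) auto
  moreover have "det (rat_matrix U) \<noteq> 0" "det (rat_matrix W) \<noteq> 0"
    using invertible_factors invertible_rat_matrix invertible_det_nz by blast+
  ultimately have "det (rat_matrix B) = 0 \<longleftrightarrow> (\<exists>i. D i = 0)"
    by (simp add: B_eq rat_matrix_mult det_mul)
  then show ?thesis by (auto simp: invertible_det_nz J_eq)
qed

text \<open>
  Without free coordinates the second factor in \<open>kernel_decomposition\<close> is trivial, and the root vectors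
  form a product of groups of roots of unity.
\<close>

lemma card_monomial_kernel_full_rank:
  assumes "J = {}"
  shows "card (monomial_kernel B :: ('m \<Rightarrow> complex puiseux) set) = (\<Prod>i\<in>UNIV. nat \<bar>D i\<bar>)"
    and "finite (monomial_kernel B :: ('m \<Rightarrow> complex puiseux) set)"
proof -
  have "d = 0" using assms by (simp add: d_eq_card)
  then have T: "carrier (torus {..<d} :: (nat \<Rightarrow> complex puiseux) monoid) = {\<lambda>_. undefined}"
    by (simp add: carrier_torus)
  let ?F = "torsion_part :: ('m \<Rightarrow> complex puiseux) set"
  have bij: "bij_betw (\<lambda>(f, s). f \<otimes>\<^bsub>torus UNIV\<^esub> param (\<lambda>_. 1) s)
      (?F \<times> carrier (torus {..<d})) (monomial_kernel B)"
    using kernel_decomposition[where 'k = "complex puiseux"] by (simp add: iso_def DirProd_def)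
  have "finite (?F \<times> carrier (torus {..<d} :: (nat \<Rightarrow> complex puiseux) monoid))"
    by (simp add: T finite_cartesian_product finite_torsion_part)
  then show "finite (monomial_kernel B :: ('m \<Rightarrow> complex puiseux) set)"
    using bij bij_betw_finite by blast
  have inj: "inj_on (monomial_map V) (root_vectors (\<lambda>_. 1 :: complex puiseux))"
  proof (rule inj_on_inverseI)
    fix a :: "'m \<Rightarrow> complex puiseux" assume "a \<in> root_vectors (\<lambda>_. 1)"
    then have "a i \<noteq> 0" for i by (rule root_vectors_nonzero[OF _ one_in_torus])
    then show "monomial_map W (monomial_map V a) = a"
      by (intro monomial_map_WV) (simp add: carrier_torus_UNIV)
  qed
  have "card (monomial_kernel B :: ('m \<Rightarrow> complex puiseux) set) = card ?F"
    using bij_betw_same_card[OF bij] by (simp add: T card_cartesian_product)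
  also have "\<dots> = card (root_vectors (\<lambda>_. 1 :: complex puiseux))"
    unfolding torsion_part_def by (rule card_image[OF inj])
  also have "\<dots> = (\<Prod>i\<in>UNIV. nat \<bar>D i\<bar>)"
    unfolding root_vectors_def using assms J_eq
    by (simp add: card_PiE card_puiseux_powi_roots_unity)
  finally show "card (monomial_kernel B :: ('m \<Rightarrow> complex puiseux) set) = (\<Prod>i\<in>UNIV. nat \<bar>D i\<bar>)" .
qed

text \<open>
  The transpose of \<open>U\<close> permutes the integer vectors, so only \<open>D\<close> and the automorphism given by the
  transpose of \<open>W\<close> are left.
\<close>

lemma row_lattice_eq: "row_lattice B = {transpose W *v (\<chi> i. D i * z $ i) | z. True}"
proof -
  have D: "diagonal_matrix D *v x = (\<chi> i. D i * x $ i)" for x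
    by (simp add: vec_eq_iff matrix_vector_mult_def diagonal_matrix_def
        if_distrib[of "\<lambda>y. y * _"] cong: if_cong)
  have tD: "transpose (diagonal_matrix D) = diagonal_matrix D"
    by (auto simp: vec_eq_iff Finite_Cartesian_Product.transpose_def diagonal_matrix_def)
  have eq: "transpose B *v y = transpose W *v (diagonal_matrix D *v (transpose U *v y))" for y
    by (simp only: B_eq matrix_transpose_mul tD matrix_vector_mul_assoc matrix_mul_assoc)
  have surj: "\<exists>y. z = transpose U *v y" for z
    by (intro exI[of _ "transpose U' *v z"])
       (simp add: matrix_vector_mul_assoc flip: matrix_transpose_mul add: U'U del: transpose_matrix_vector)
  show ?thesis
  proof (intro equalityI subsetI)
    fix v assume "v \<in> row_lattice B"
    then obtain y where "v = transpose B *v y" unfolding row_lattice_def by (rule rangeE)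
    then have "v = transpose W *v (\<chi> i. D i * (transpose U *v y) $ i)" by (simp only: eq D)
    then show "v \<in> {transpose W *v (\<chi> i. D i * z $ i) | z. True}" by blast
  next
    fix v assume "v \<in> {transpose W *v (\<chi> i. D i * z $ i) | z. True}"
    then obtain z where z: "v = transpose W *v (\<chi> i. D i * z $ i)" by blast
    obtain y where "z = transpose U *v y" using surj by blast
    then have "v = transpose B *v y" by (simp only: z eq D)
    then show "v \<in> row_lattice B" unfolding row_lattice_def by (rule range_eqI)
  qed
qed

text \<open>
  In the coordinates given by the transpose of \<open>V\<close>, a coset is a residue class modulo \<open>D i\<close> in every
  coordinate \<open>i\<close>.
\<close>

lemma lattice_index_full_rank:
  assumes "J = {}"
  shows "lattice_index (row_lattice B) = (\<Prod>i\<in>UNIV. nat \<bar>D i\<bar>)"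
proof -
  let ?L = "row_lattice B" and ?W = "(*v) (transpose W)" and ?V = "(*v) (transpose V)"
  have D0: "D i \<noteq> 0" for i using assms J_eq by auto
  have VW': "?V (?W x) = x" "?W (?V x) = x" for x
    by (simp_all add: matrix_vector_mul_assoc VW WV flip: matrix_transpose_mul del: transpose_matrix_vector)
  have L_mem: "?W x \<in> ?L \<longleftrightarrow> (\<forall>i. D i dvd x $ i)" for x
  proof
    assume "?W x \<in> ?L"
    then obtain z where "?W x = ?W (\<chi> i. D i * z $ i)" unfolding row_lattice_eq by blast
    then have "x = (\<chi> i. D i * z $ i)" using VW'(1) by metis
    then show "\<forall>i. D i dvd x $ i" by simp
  next
    assume "\<forall>i. D i dvd x $ i"
    then have "x = (\<chi> i. D i * (\<chi> i. x $ i div D i) $ i)" by (simp add: vec_eq_iff)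
    then have "?W x = ?W (\<chi> i. D i * (\<chi> i. x $ i div D i) $ i)" by (rule arg_cong)
    then show "?W x \<in> ?L" unfolding row_lattice_eq by blast
  qed
  have coset: "?L #>\<^bsub>integer_lattice\<^esub> ?W x = {?W y | y. \<forall>i. D i dvd y $ i - x $ i}" for x
  proof (intro equalityI subsetI)
    fix w assume "w \<in> ?L #>\<^bsub>integer_lattice\<^esub> ?W x"
    then obtain l where l: "l \<in> ?L" "w = l + ?W x"
      by (auto simp: r_coset_def integer_lattice_def)
    have "?W (?V w - x) = l" using l(2) by (simp only: matrix_vector_mult_diff_distrib VW') simp
    then have "\<forall>i. D i dvd ?V w $ i - x $ i" using l(1) L_mem[of "?V w - x"] by simp
    then show "w \<in> {?W y | y. \<forall>i. D i dvd y $ i - x $ i}" 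
      by (intro CollectI exI[of _ "?V w"] conjI) (rule VW'(2)[symmetric], assumption)
  next
    fix w assume "w \<in> {?W y | y. \<forall>i. D i dvd y $ i - x $ i}"
    then obtain y where y: "w = ?W y" "\<forall>i. D i dvd y $ i - x $ i" by blast
    then have "?W (y - x) \<in> ?L" using L_mem by simp
    moreover have "w = ?W (y - x) + ?W x" unfolding y(1) by (simp only: matrix_vector_mult_diff_distrib) simp
    ultimately show "w \<in> ?L #>\<^bsub>integer_lattice\<^esub> ?W x"
      unfolding r_coset_def integer_lattice_def by auto
  qed
  \<comment> \<open>Least nonnegative residues represent the cosets.\<close>
  define R where "R = (\<Pi>\<^sub>E i\<in>(UNIV :: 'm set). {0..<\<bar>D i\<bar>})"
  let ?c = "\<lambda>v. ?L #>\<^bsub>integer_lattice\<^esub> ?W (\<chi> i. v i)"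
  have "bij_betw ?c R (rcosets\<^bsub>integer_lattice\<^esub> ?L)"
    unfolding bij_betw_def
  proof
    show "inj_on ?c R"
    proof (rule inj_onI)
      fix v w assume vw: "v \<in> R" "w \<in> R" "?c v = ?c w"
      have "?W (\<chi> i. v i) \<in> ?c v" unfolding coset by fastforce
      then have "?W (\<chi> i. v i) \<in> ?c w" using vw(3) by simp
      then obtain y where "?W (\<chi> i. v i) = ?W y" "\<forall>i. D i dvd y $ i - w i"
        unfolding coset by auto
      then have dvd: "D i dvd v i - w i" for i using VW'(1) by (metis vec_lambda_beta)
      show "v = w"
      proof
        fix i
        have "v i \<in> {0..<\<bar>D i\<bar>}" "w i \<in> {0..<\<bar>D i\<bar>}" using vw(1,2) by (auto simp: R_def PiE_iff)
        then have "\<bar>v i - w i\<bar> < \<bar>D i\<bar>" by auto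
        then show "v i = w i" using dvd[of i] dvd_imp_le_int[of "v i - w i" "D i"] by fastforce
      qed
    qed
    show "?c ` R = rcosets\<^bsub>integer_lattice\<^esub> ?L"
    proof (intro equalityI subsetI)
      fix C assume "C \<in> ?c ` R"
      then show "C \<in> rcosets\<^bsub>integer_lattice\<^esub> ?L"
        by (auto simp: RCOSETS_def integer_lattice_def)
    next
      fix C assume "C \<in> rcosets\<^bsub>integer_lattice\<^esub> ?L"
      then obtain x where "C = ?L #>\<^bsub>integer_lattice\<^esub> x" by (auto simp: RCOSETS_def)
      then have C: "C = ?L #>\<^bsub>integer_lattice\<^esub> ?W (?V x)" using VW'(2) by simp
      define v where "v i = (?V x) $ i mod \<bar>D i\<bar>" for i
      have "v \<in> R" using D0 by (auto simp: R_def v_def)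
      moreover have "D i dvd v i - (?V x) $ i" for i
      proof -
        have "\<bar>D i\<bar> dvd v i - (?V x) $ i"
          unfolding v_def by (metis dvd_minus_mod dvd_diff_commute)
        then show ?thesis by simp
      qed
      then have "(\<forall>i. D i dvd y $ i - v i) \<longleftrightarrow> (\<forall>i. D i dvd y $ i - (?V x) $ i)" for y
        by (metis (no_types, lifting) diff_add_cancel dvd_add_right_iff add_diff_eq dvd_diff_commute)
      then have "C = ?c v" unfolding C coset by simp
      ultimately show "C \<in> ?c ` R" by blast
    qed
  qed
  then have "lattice_index ?L = card R"
    unfolding lattice_index_def using bij_betw_same_card by metis
  also have "\<dots> = (\<Prod>i\<in>UNIV. nat \<bar>D i\<bar>)" unfolding R_def by (simp add: card_PiE)
  finally show ?thesis .
qed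

lemma prod_nat_abs_D: "int (\<Prod>i\<in>UNIV. nat \<bar>D i\<bar>) = \<bar>det B\<bar>"
  by (simp add: abs_det_B)

text \<open>
  Index 1 forces all diagonal entries to be units. Conversely, an invertible \<open>B\<close> has determinant
  \<open>1\<close> or \<open>-1\<close>, and the index is the absolute value of the determinant.
\<close>

lemma invertible_iff_full_rank_index_1:
  "rank (rat_matrix B) = CARD('m) \<and> lattice_index (row_lattice B) = 1 \<longleftrightarrow> invertible B"
proof
  assume A: "rank (rat_matrix B) = CARD('m) \<and> lattice_index (row_lattice B) = 1"
  then have "(\<Prod>i\<in>UNIV. nat \<bar>D i\<bar>) = 1"
    using lattice_index_full_rank by (simp add: full_rank_iff)
  then have "nat \<bar>D i\<bar> = 1" for i
    using prod_eq_1_iff[OF finite, of "\<lambda>i. nat \<bar>D i\<bar>" UNIV] by blast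
  then have "\<bar>D i\<bar> = 1" for i by (simp add: nat_eq_iff)
  then have "D i * D i = 1" for i by (metis abs_mult_self_eq mult_1)
  then have "diagonal_matrix D ** diagonal_matrix D = mat 1"
    by (simp add: vec_eq_iff matrix_matrix_mult_def diagonal_matrix_def mat_def
        if_distrib[of "\<lambda>y. y * _"] cong: if_cong)
  then have "invertible (diagonal_matrix D)" unfolding invertible_def by blast
  then show "invertible B" unfolding B_eq by (intro invertible_mult invertible_factors)
next
  assume inv: "invertible B"
  then have "J = {}" using invertible_rat_matrix invertible_rat_matrix_iff by blast
  moreover have "(\<Prod>i\<in>UNIV. nat \<bar>D i\<bar>) = 1"
    using prod_nat_abs_D det_unimodular[OF inv] by linarith
  ultimately show "rank (rat_matrix B) = CARD('m) \<and> lattice_index (row_lattice B) = 1"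
    using lattice_index_full_rank by (simp add: full_rank_iff)
qed

end

lemma diagonalized_matrix_exists:
  fixes B :: "int^'m^'m"
  obtains V W J u e d U U' D where "diagonalized_matrix V W J u e d B U U' D"
proof -
  obtain U W :: "int^'m^'m" and D where UW: "invertible U" "invertible W" "B = U ** diagonal_matrix D ** W"
    using unimodular_diagonalization[of B] by blast
  obtain U' where U': "U ** U' = mat 1" "U' ** U = mat 1" using UW(1) by (auto simp: invertible_def)
  obtain V where V: "V ** W = mat 1" "W ** V = mat 1" using UW(2) by (auto simp: invertible_def)
  define J where "J = {j. D j = 0}"
  obtain e where e: "bij_betw e {..<card J} J"
    using ex_bij_betw_nat_finite[of J] by (auto simp: lessThan_atLeast0)
  have "diagonalized_matrix V W J (inv_into {..<card J} e) e (card J) B U U' D"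
  proof
    fix j assume "j \<in> J"
    then have "j \<in> e ` {..<card J}" using e by (simp add: bij_betw_def)
    then show "inv_into {..<card J} e j < card J" "e (inv_into {..<card J} e j) = j"
      using inv_into_into[of j e "{..<card J}"] by (auto intro: f_inv_into_f)
  next
    fix k assume "k < card J"
    then show "e k \<in> J" "inv_into {..<card J} e (e k) = k"
      using e by (auto simp: bij_betw_def inv_into_f_f)
  qed (use UW U' V J_def in auto)
  then show thesis by (rule that)
qed

section \<open>Solution sets of binomial systems\<close>

theorem theorem5p4:
  fixes B :: "int^'m^'m" and c :: "'m \<Rightarrow> complex puiseux"
  assumes "c \<in> carrier (torus UNIV)"
    and "solution_set B c \<noteq> {}"
  shows
    "(rank (rat_matrix B) = CARD('m) \<longrightarrow>
        finite (monomial_kernel B :: ('m \<Rightarrow> complex puiseux) set) \<and>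
        torsor (torus UNIV\<lparr>carrier := monomial_kernel B\<rparr>) (solution_set B c)
          (\<lambda>g. \<lambda>x\<in>solution_set B c. g \<otimes>\<^bsub>torus UNIV\<^esub> x) \<and>
        card (solution_set B c) = card (monomial_kernel B :: ('m \<Rightarrow> complex puiseux) set) \<and>
        card (monomial_kernel B :: ('m \<Rightarrow> complex puiseux) set) = lattice_index (row_lattice B)) \<and>
     (rank (rat_matrix B) = CARD('m) \<longleftrightarrow> invertible (rat_matrix B)) \<and>
     (invertible (rat_matrix B) \<longrightarrow> int (card (solution_set B c)) = \<bar>det B\<bar>) \<and>

     (rank (rat_matrix B) = CARD('m) \<and> lattice_index (row_lattice B) = 1 \<longleftrightarrow> invertible B) \<and>
     (rank (rat_matrix B) = CARD('m) \<and> lattice_index (row_lattice B) = 1 \<longrightarrow>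
        (\<exists>!x. x \<in> solution_set B c)) \<and>

     (\<forall>r. rank (rat_matrix B) = r \<and> r < CARD('m) \<longrightarrow>
        solution_set B c \<in> rcosets\<^bsub>torus UNIV\<^esub> (monomial_kernel B) \<and>
        algebraic_subtorus UNIV (CARD('m) - r)
          (identity_component UNIV (monomial_kernel B :: ('m \<Rightarrow> complex puiseux) set)) \<and>
        (\<exists>F \<gamma>.
           subgroup F (torus UNIV\<lparr>carrier := monomial_kernel B :: ('m \<Rightarrow> complex puiseux) set\<rparr>) \<and>
           finite F \<and>
           algebraic_group_iso {..<CARD('m) - r} (carrier (torus {..<CARD('m) - r}))
             UNIV (identity_component UNIV (monomial_kernel B)) \<gamma> \<and>
           (\<lambda>(f, s). f \<otimes>\<^bsub>torus UNIV\<^esub> \<gamma> s) \<in>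
             iso (torus UNIV\<lparr>carrier := F\<rparr> \<times>\<times> torus {..<CARD('m) - r})
                 (torus UNIV\<lparr>carrier := monomial_kernel B\<rparr>) \<and>
           torsor (torus UNIV\<lparr>carrier := F\<rparr> \<times>\<times> torus {..<CARD('m) - r}) (solution_set B c)
             (\<lambda>(f, s). \<lambda>x\<in>solution_set B c. (f \<otimes>\<^bsub>torus UNIV\<^esub> \<gamma> s) \<otimes>\<^bsub>torus UNIV\<^esub> x)) \<and>
        pure_dimensional (subtopology (zariski UNIV) (solution_set B c)) (CARD('m) - r))"
proof -
  obtain V W J u e d U U' D where "diagonalized_matrix V W J u e d B U U' D"
    using diagonalized_matrix_exists[of B] by blast
  then interpret diagonalized_matrix V W J u e d B U U' D .
  note torsor = torsor_solution_set[OF assms(2)]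
  have card_eq: "card (solution_set B c) = card (monomial_kernel B :: ('m \<Rightarrow> complex puiseux) set)"
    using torsor_card_eq[OF torsor] by simp
  have index: "card (monomial_kernel B :: ('m \<Rightarrow> complex puiseux) set) = lattice_index (row_lattice B)"
    if "J = {}"
    using card_monomial_kernel_full_rank(1)[OF that] lattice_index_full_rank[OF that] by simp
  have unique: "\<exists>!x. x \<in> solution_set B c" if "J = {}" "lattice_index (row_lattice B) = 1"
  proof -
    have "card (solution_set B c) = 1" using card_eq index[OF that(1)] that(2) by simp
    then obtain x where "solution_set B c = {x}" by (auto simp: card_1_singleton_iff)
    then show ?thesis by simp
  qed
  show ?thesis
  proof (intro conjI impI allI)
    assume "rank (rat_matrix B) = CARD('m)"
    then have J: "J = {}" by (simp add: full_rank_iff)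
    show "finite (monomial_kernel B :: ('m \<Rightarrow> complex puiseux) set)"
      by (rule card_monomial_kernel_full_rank(2)[OF J])
    show "torsor (torus UNIV\<lparr>carrier := monomial_kernel B\<rparr>) (solution_set B c)
        (\<lambda>g. \<lambda>x\<in>solution_set B c. g \<otimes>\<^bsub>torus UNIV\<^esub> x)"
      by (rule torsor)
    show "card (solution_set B c) = card (monomial_kernel B :: ('m \<Rightarrow> complex puiseux) set)"
      by (rule card_eq)
    show "card (monomial_kernel B :: ('m \<Rightarrow> complex puiseux) set) = lattice_index (row_lattice B)"
      by (rule index[OF J])
  next
    show "rank (rat_matrix B) = CARD('m) \<longleftrightarrow> invertible (rat_matrix B)"
      by (simp only: full_rank_iff invertible_rat_matrix_iff)
  next
    assume "invertible (rat_matrix B)"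
    then have "J = {}" by (simp add: invertible_rat_matrix_iff)
    then show "int (card (solution_set B c)) = \<bar>det B\<bar>"
      by (simp only: card_eq card_monomial_kernel_full_rank(1) prod_nat_abs_D)
  next
    show "rank (rat_matrix B) = CARD('m) \<and> lattice_index (row_lattice B) = 1 \<longleftrightarrow> invertible B"
      by (rule invertible_iff_full_rank_index_1)
  next
    assume "rank (rat_matrix B) = CARD('m) \<and> lattice_index (row_lattice B) = 1"
    then show "\<exists>!x. x \<in> solution_set B c"
      using unique by (simp add: full_rank_iff)
  next
    fix r assume "rank (rat_matrix B) = r \<and> r < CARD('m)"
    then have d: "CARD('m) - r = d" by (metis rank_eq d_le diff_diff_cancel)
    show "solution_set B c \<in> rcosets\<^bsub>torus UNIV\<^esub> (monomial_kernel B)"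
      by (rule solution_set_in_rcosets[OF assms(2)])
    show "algebraic_subtorus UNIV (CARD('m) - r)
        (identity_component UNIV (monomial_kernel B :: ('m \<Rightarrow> complex puiseux) set))"
      unfolding d identity_component_monomial_kernel by (rule algebraic_subtorus_slice)
    show "\<exists>F \<gamma>.
        subgroup F (torus UNIV\<lparr>carrier := monomial_kernel B :: ('m \<Rightarrow> complex puiseux) set\<rparr>) \<and>
        finite F \<and>
        algebraic_group_iso {..<CARD('m) - r} (carrier (torus {..<CARD('m) - r}))
          UNIV (identity_component UNIV (monomial_kernel B)) \<gamma> \<and>
        (\<lambda>(f, s). f \<otimes>\<^bsub>torus UNIV\<^esub> \<gamma> s) \<in>
          iso (torus UNIV\<lparr>carrier := F\<rparr> \<times>\<times> torus {..<CARD('m) - r})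
              (torus UNIV\<lparr>carrier := monomial_kernel B\<rparr>) \<and>
        torsor (torus UNIV\<lparr>carrier := F\<rparr> \<times>\<times> torus {..<CARD('m) - r}) (solution_set B c)
          (\<lambda>(f, s). \<lambda>x\<in>solution_set B c. (f \<otimes>\<^bsub>torus UNIV\<^esub> \<gamma> s) \<otimes>\<^bsub>torus UNIV\<^esub> x)"
      unfolding d identity_component_monomial_kernel
      by (intro exI[of _ torsion_part] exI[of _ "param (\<lambda>_. 1)"] conjI subgroup_torsion_part
          finite_torsion_part algebraic_group_iso_param kernel_decomposition
          torsor_decomposition[OF assms(2)])
    show "pure_dimensional (subtopology (zariski UNIV) (solution_set B c)) (CARD('m) - r)"
      unfolding d by (rule pure_dimensional_solution_set[OF assms])
  qed
qed

end
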